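(* Let $M$ be a connected smooth manifold and let $E$ be a smooth real vector bundle (of finite rank) over $M$. Let $G$ be a smooth generalized subbundle of $E$. Then $G$ is globally finitely generated, i.e. there exist finitely many smooth globally defined sections $s_1,\dots,s_k$ of $E$ such that for all $p\in M$, $$G_p=\operatorname{span}\{s_1(p),\dots,s_k(p)\}.$$
   Context: Manifolds are smooth manifolds in the usual sense (Hausdorff, second countable). A generalized subbundle $G$ of a vector bundle $E\to M$ is an assignment $p\mapsto G_p$ of a linear subspace $G_p\subseteq E_p$ to each point $p\in M$; no continuity in $p$ or constancy of dimension is assumed. A local section of $E$ is a smooth section of $E$ defined on some open subset of $M$; a local section $s$ belongs to $G$ if $s(p)\in G_p$ for all $p$ in its domain. The generalized subbundle $G$ is smooth if for every $p\in M$ there are finitely many local sections $s_1,\dots,s_k$ belonging to $G$, whose domains all contain $p$, such that $G_p=\operatorname{span}\{s_1(p),\dots,s_k(p)\}$. *)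

theory Defs
  imports "HOL-Analysis.Analysis"
begin

section \<open>Model spaces\<close>

text \<open>
  The model spaces \<open>\<real>\<^sup>n\<close> are the types of the class below: finite-dimensional real inner product
  spaces. The library class \<open>euclidean_space\<close> is not used because it demands a nonempty basis,
  which would exclude manifolds of dimension 0 and bundles of rank 0. The instance for \<open>unit\<close>
  provides \<open>\<real>\<^sup>0\<close>.
\<close>

class finite_dim_inner = real_inner +
  assumes finite_spanning_set: "\<exists>B. finite B \<and> (\<forall>x. \<exists>c. x = (\<Sum>b\<in>B. c b *\<^sub>R b))"

instance euclidean_space \<subseteq> finite_dim_inner
proof
  show "\<exists>B::'a set. finite B \<and> (\<forall>x. \<exists>c. x = (\<Sum>b\<in>B. c b *\<^sub>R b))"
    by (rule exI[of _ Basis]) (metis finite_Basis euclidean_representation)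
qed

instance prod :: (finite_dim_inner, finite_dim_inner) finite_dim_inner
proof
  obtain B :: "'a set" where B: "finite B" "\<And>x. \<exists>c. x = (\<Sum>b\<in>B. c b *\<^sub>R b)"
    using finite_spanning_set by blast
  obtain C :: "'b set" where C: "finite C" "\<And>x. \<exists>c. x = (\<Sum>b\<in>C. c b *\<^sub>R b)"
    using finite_spanning_set by blast
  let ?D = "(\<lambda>b. (b, 0)) ` B \<union> (\<lambda>b. (0, b)) ` C :: ('a \<times> 'b) set"
  have fin: "finite ?D"
    using B C by simp
  have "x \<in> span ?D" for x
  proof -
    obtain c d where c: "fst x = (\<Sum>b\<in>B. c b *\<^sub>R b)" and d: "snd x = (\<Sum>b\<in>C. d b *\<^sub>R b)"
      using B(2) C(2) by metis
    have "x = (\<Sum>b\<in>B. c b *\<^sub>R (b, 0)) + (\<Sum>b\<in>C. d b *\<^sub>R (0, b))"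
      by (rule prod_eqI) (simp_all add: c d fst_sum snd_sum)
    also have "\<dots> \<in> span ?D"
      by (intro span_add span_sum span_scale span_base) auto
    finally show ?thesis .
  qed
  then have "\<exists>c. x = (\<Sum>b\<in>?D. c b *\<^sub>R b)" for x
    using span_finite[OF fin] by blast
  then show "\<exists>B::('a \<times> 'b) set. finite B \<and> (\<forall>x. \<exists>c. x = (\<Sum>b\<in>B. c b *\<^sub>R b))"
    using fin by blast
qed

instantiation unit :: real_inner
begin

definition zero_unit :: unit where "zero_unit = ()"
definition plus_unit :: "unit \<Rightarrow> unit \<Rightarrow> unit" where "plus_unit x y = ()"
definition minus_unit :: "unit \<Rightarrow> unit \<Rightarrow> unit" where "minus_unit x y = ()"
definition uminus_unit :: "unit \<Rightarrow> unit" where "uminus_unit x = ()"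
definition scaleR_unit :: "real \<Rightarrow> unit \<Rightarrow> unit" where "scaleR_unit c x = ()"
definition inner_unit :: "unit \<Rightarrow> unit \<Rightarrow> real" where "inner_unit x y = 0"
definition norm_unit :: "unit \<Rightarrow> real" where "norm_unit x = 0"
definition sgn_unit :: "unit \<Rightarrow> unit" where "sgn_unit x = ()"
definition dist_unit :: "unit \<Rightarrow> unit \<Rightarrow> real" where "dist_unit x y = 0"
definition uniformity_unit :: "(unit \<times> unit) filter"
  where "uniformity_unit = (INF e\<in>{0<..}. principal {(x, y). dist x y < e})"
definition open_unit :: "unit set \<Rightarrow> bool"
  where "open_unit U \<longleftrightarrow> (\<forall>x\<in>U. eventually (\<lambda>(x', y). x' = x \<longrightarrow> y \<in> U) uniformity)"

instance
  by standard (auto simp: dist_unit_def norm_unit_def inner_unit_def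
      uniformity_unit_def open_unit_def)

end

instance unit :: finite_dim_inner
  by standard (auto intro: exI[of _ "{}"])

section \<open>Smooth maps between open subsets of model spaces\<close>

text \<open>
  Both notions are only meant for open \<open>S\<close>; they do not depend on the values of \<open>f\<close> off \<open>S\<close>.
\<close>

primrec Ck_on :: "nat \<Rightarrow> 'e::real_normed_vector set \<Rightarrow> ('e \<Rightarrow> 'f::real_normed_vector) \<Rightarrow> bool" where
  "Ck_on 0 S f \<longleftrightarrow> continuous_on S f"
| "Ck_on (Suc k) S f \<longleftrightarrow>
     (\<forall>x\<in>S. f differentiable (at x)) \<and> (\<forall>v. Ck_on k S (\<lambda>x. frechet_derivative f (at x) v))"

definition smooth_on :: "'e::real_normed_vector set \<Rightarrow> ('e \<Rightarrow> 'f::real_normed_vector) \<Rightarrow> bool"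
  where "smooth_on S f \<longleftrightarrow> (\<forall>k. Ck_on k S f)"

section \<open>Smooth manifolds\<close>

text \<open>
  A smooth structure is given by an atlas that need not be maximal.
  A chart is a pair of its domain \<open>U\<close> and the coordinate map \<open>\<phi>\<close>; values of \<open>\<phi>\<close> off \<open>U\<close> are irrelevant.
\<close>

record ('m, 'e) mfd =
  mtop :: "'m topology"
  atlas :: "('m set \<times> ('m \<Rightarrow> 'e)) set"

abbreviation points :: "('m, 'e, 'z) mfd_scheme \<Rightarrow> 'm set"
  where "points M \<equiv> topspace (mtop M)"

definition is_chart :: "'m topology \<Rightarrow> 'm set \<Rightarrow> ('m \<Rightarrow> 'e::topological_space) \<Rightarrow> bool" where
  "is_chart X U \<phi> \<longleftrightarrow>
     openin X U \<and> open (\<phi> ` U) \<and>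
     homeomorphic_map (subtopology X U) (top_of_set (\<phi> ` U)) \<phi>"

definition smooth_manifold :: "('m, 'e::finite_dim_inner) mfd \<Rightarrow> bool" where
  "smooth_manifold M \<longleftrightarrow>
     Hausdorff_space (mtop M) \<and> second_countable (mtop M) \<and>
     (\<forall>(U, \<phi>)\<in>atlas M. is_chart (mtop M) U \<phi>) \<and>
     (\<Union>(U, \<phi>)\<in>atlas M. U) = points M \<and>
     (\<forall>(U, \<phi>)\<in>atlas M. \<forall>(V, \<psi>)\<in>atlas M. smooth_on (\<phi> ` (U \<inter> V)) (\<psi> \<circ> inv_into U \<phi>))"

definition smooth_map ::
  "('m, 'e::finite_dim_inner) mfd \<Rightarrow> ('n, 'f::finite_dim_inner) mfd \<Rightarrow> ('m \<Rightarrow> 'n) \<Rightarrow> bool" where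
  "smooth_map M N f \<longleftrightarrow>
     continuous_map (mtop M) (mtop N) f \<and>
     (\<forall>(U, \<phi>)\<in>atlas M. \<forall>(V, \<psi>)\<in>atlas N.
        smooth_on (\<phi> ` (U \<inter> f -` V)) (\<psi> \<circ> f \<circ> inv_into U \<phi>))"

definition diffeomorphism ::
  "('m, 'e::finite_dim_inner) mfd \<Rightarrow> ('n, 'f::finite_dim_inner) mfd \<Rightarrow> ('m \<Rightarrow> 'n) \<Rightarrow> bool" where
  "diffeomorphism M N f \<longleftrightarrow>
     smooth_map M N f \<and>
     (\<exists>g. smooth_map N M g \<and> (\<forall>x\<in>points M. g (f x) = x) \<and> (\<forall>y\<in>points N. f (g y) = y))"

definition open_submanifold :: "('m, 'e) mfd \<Rightarrow> 'm set \<Rightarrow> ('m, 'e) mfd" where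
  "open_submanifold M W =
     \<lparr>mtop = subtopology (mtop M) W, atlas = (\<lambda>(U, \<phi>). (U \<inter> W, \<phi>)) ` atlas M\<rparr>"

text \<open>The product of \<open>M\<close> with the model space \<open>'v\<close>.\<close>

definition times_model :: "('m, 'e) mfd \<Rightarrow> ('m \<times> 'v::topological_space, 'e \<times> 'v) mfd" where
  "times_model M =
     \<lparr>mtop = prod_topology (mtop M) euclidean,
      atlas = (\<lambda>(U, \<phi>). (U \<times> UNIV, map_prod \<phi> id)) ` atlas M\<rparr>"

section \<open>Smooth vector bundles\<close>

text \<open>
  The total space of a bundle with typical fibre \<open>'v\<close> over a manifold modelled on \<open>'e\<close> is modelled
  on \<open>'e \<times> 'v\<close>. The operations \<open>vadd\<close> and \<open>vscale\<close> are only meaningful within a single fibre;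
  \<open>vzero p\<close> is the zero vector of the fibre over \<open>p\<close>.
\<close>

record ('m, 't, 'e, 'v) vbundle =
  total :: "('t, 'e \<times> 'v) mfd"
  proj :: "'t \<Rightarrow> 'm"
  vadd :: "'t \<Rightarrow> 't \<Rightarrow> 't"
  vscale :: "real \<Rightarrow> 't \<Rightarrow> 't"
  vzero :: "'m \<Rightarrow> 't"

definition bundle_over :: "('m, 't, 'e, 'v) vbundle \<Rightarrow> 'm set \<Rightarrow> 't set" where
  "bundle_over E U = {x \<in> points (total E). proj E x \<in> U}"

abbreviation fibre :: "('m, 't, 'e, 'v) vbundle \<Rightarrow> 'm \<Rightarrow> 't set"
  where "fibre E p \<equiv> bundle_over E {p}"

definition real_vector_space_on ::
  "'t set \<Rightarrow> ('t \<Rightarrow> 't \<Rightarrow> 't) \<Rightarrow> (real \<Rightarrow> 't \<Rightarrow> 't) \<Rightarrow> 't \<Rightarrow> bool" where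
  "real_vector_space_on V add smul z \<longleftrightarrow>
     z \<in> V \<and> (\<forall>x\<in>V. \<forall>y\<in>V. add x y \<in> V) \<and> (\<forall>c. \<forall>x\<in>V. smul c x \<in> V) \<and>
     (\<forall>x\<in>V. \<forall>y\<in>V. \<forall>w\<in>V. add (add x y) w = add x (add y w)) \<and>
     (\<forall>x\<in>V. \<forall>y\<in>V. add x y = add y x) \<and>
     (\<forall>x\<in>V. add z x = x) \<and> (\<forall>x\<in>V. \<exists>y\<in>V. add x y = z) \<and>
     (\<forall>c. \<forall>x\<in>V. \<forall>y\<in>V. smul c (add x y) = add (smul c x) (smul c y)) \<and>
     (\<forall>c d. \<forall>x\<in>V. smul (c + d) x = add (smul c x) (smul d x)) \<and>
     (\<forall>c d. \<forall>x\<in>V. smul c (smul d x) = smul (c * d) x) \<and>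
     (\<forall>x\<in>V. smul 1 x = x)"

definition local_trivialization ::
  "('m, 'e::finite_dim_inner) mfd \<Rightarrow> ('m, 't, 'e, 'v::finite_dim_inner) vbundle \<Rightarrow>
   'm set \<Rightarrow> ('t \<Rightarrow> 'm \<times> 'v) \<Rightarrow> bool" where
  "local_trivialization M E U \<Phi> \<longleftrightarrow>
     openin (mtop M) U \<and>
     diffeomorphism (open_submanifold (total E) (bundle_over E U))
       (times_model (open_submanifold M U)) \<Phi> \<and>
     (\<forall>x\<in>bundle_over E U. fst (\<Phi> x) = proj E x) \<and>
     (\<forall>p\<in>U. \<forall>x\<in>fibre E p. \<forall>y\<in>fibre E p. snd (\<Phi> (vadd E x y)) = snd (\<Phi> x) + snd (\<Phi> y)) \<and>
     (\<forall>p\<in>U. \<forall>c. \<forall>x\<in>fibre E p. snd (\<Phi> (vscale E c x)) = c *\<^sub>R snd (\<Phi> x))"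

definition smooth_vector_bundle ::
  "('m, 'e::finite_dim_inner) mfd \<Rightarrow> ('m, 't, 'e, 'v::finite_dim_inner) vbundle \<Rightarrow> bool" where
  "smooth_vector_bundle M E \<longleftrightarrow>
     smooth_manifold M \<and> smooth_manifold (total E) \<and>
     smooth_map (total E) M (proj E) \<and>
     (\<forall>p\<in>points M. real_vector_space_on (fibre E p) (vadd E) (vscale E) (vzero E p)) \<and>
     (\<forall>p\<in>points M. \<exists>U \<Phi>. p \<in> U \<and> local_trivialization M E U \<Phi>)"

definition fibre_subspace :: "('m, 't, 'e, 'v) vbundle \<Rightarrow> 'm \<Rightarrow> 't set \<Rightarrow> bool" where
  "fibre_subspace E p W \<longleftrightarrow>
     W \<subseteq> fibre E p \<and> vzero E p \<in> W \<and>
     (\<forall>x\<in>W. \<forall>y\<in>W. vadd E x y \<in> W) \<and> (\<forall>c. \<forall>x\<in>W. vscale E c x \<in> W)"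

text \<open>The linear span within the fibre over \<open>p\<close> of a subset of that fibre.\<close>

definition fibre_span :: "('m, 't, 'e, 'v) vbundle \<Rightarrow> 'm \<Rightarrow> 't set \<Rightarrow> 't set" where
  "fibre_span E p S = fibre_subspace E p hull S"

section \<open>Sections and generalized subbundles\<close>

definition smooth_section ::
  "('m, 'e::finite_dim_inner) mfd \<Rightarrow> ('m, 't, 'e, 'v::finite_dim_inner) vbundle \<Rightarrow>
   'm set \<Rightarrow> ('m \<Rightarrow> 't) \<Rightarrow> bool" where
  "smooth_section M E U s \<longleftrightarrow>
     openin (mtop M) U \<and> smooth_map (open_submanifold M U) (total E) s \<and>
     (\<forall>p\<in>U. proj E (s p) = p)"

definition generalized_subbundle ::
  "('m, 'e) mfd \<Rightarrow> ('m, 't, 'e, 'v) vbundle \<Rightarrow> ('m \<Rightarrow> 't set) \<Rightarrow> bool" where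
  "generalized_subbundle M E G \<longleftrightarrow> (\<forall>p\<in>points M. fibre_subspace E p (G p))"

definition smooth_generalized_subbundle ::
  "('m, 'e::finite_dim_inner) mfd \<Rightarrow> ('m, 't, 'e, 'v::finite_dim_inner) vbundle \<Rightarrow>
   ('m \<Rightarrow> 't set) \<Rightarrow> bool" where
  "smooth_generalized_subbundle M E G \<longleftrightarrow>
     generalized_subbundle M E G \<and>
     (\<forall>p\<in>points M. \<exists>(k::nat) U s.
        (\<forall>i<k. p \<in> U i \<and> smooth_section M E (U i) (s i) \<and> (\<forall>q\<in>U i. s i q \<in> G q)) \<and>
        G p = fibre_span E p ((\<lambda>i. s i p) ` {..<k}))"

definition globally_finitely_generated ::
  "('m, 'e::finite_dim_inner) mfd \<Rightarrow> ('m, 't, 'e, 'v::finite_dim_inner) vbundle \<Rightarrow>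
   ('m \<Rightarrow> 't set) \<Rightarrow> bool" where
  "globally_finitely_generated M E G \<longleftrightarrow>
     (\<exists>(k::nat) s.
        (\<forall>i<k. smooth_section M E (points M) (s i)) \<and>
        (\<forall>p\<in>points M. G p = fibre_span E p ((\<lambda>i. s i p) ` {..<k})))"

end

theory Submission
  imports Defs
begin

text \<open>
  Work in local trivializations. By bump functions and Lindelof there are countably many global
  sections \<open>\<sigma>\<^sub>i\<close> of \<open>G\<close> such that every nonzero \<open>w \<in> G\<^sub>p\<close> has nonzero inner product with some
  \<open>\<sigma>\<^sub>i(p)\<close>. Let \<open>D\<close> be the dimension of \<open>M\<close> plus the rank of \<open>E\<close>, and take \<open>D + 1\<close>
  generic combinations \<open>s\<^sub>j = \<Sum>\<^sub>i t\<^sub>i\<^sub>j \<sigma>\<^sub>i\<close> with rapidly decreasing coefficients, so that the series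
  converge smoothly. The pairs \<open>(p, w)\<close> range over a set of dimension \<open>D\<close>, so the \<open>D + 1\<close> equations
  \<open>\<langle>w, s\<^sub>j(p)\<rangle> = 0\<close> generically have no common solution with \<open>\<langle>w, \<sigma>\<^sub>i(p)\<rangle> \<noteq> 0\<close> for some \<open>i\<close>.
  Hence no nonzero vector of \<open>G\<^sub>p\<close> is orthogonal to all \<open>s\<^sub>j(p)\<close>, that is, they span \<open>G\<^sub>p\<close>.
  The coefficients are chosen one index \<open>i\<close> at a time: each step secures one more compact piece of the
  set of pairs with a quantitative lower bound, and all later coefficients are too small to destroy it.
\<close>

section \<open>Finite-dimensional inner product spaces\<close>

text \<open>The rank of \<open>G\<close> may jump, and sections that span \<open>G p\<close> need
  not span \<open>G q\<close> at nearby \<open>q\<close>. So the hypothesis gives no finite family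
  generating on a neighbourhood, only countably many sections, and finiteness has to come from a
  dimension count. Testing against vectors \<open>w\<close> turns spanning into a condition on pairs
  whose number of parameters does not depend on the rank of \<open>G\<close>. Unit vectors would
  save one equation; the closed unit ball is easier to count in. Genericity comes from counting grid
  points rather than from Sard's theorem. This needs only Lipschitz constants and a positive lower
  bound on the term being added, hence the closed coordinate balls and the levels
  \<open>1 / (m + 1)\<close>. A condition on partial sums says nothing about the limit of a series
  unless it holds with a margin; therefore every step returns a number \<mu> along with its
  coefficients. No metric on \<open>E\<close> is involved: inner products are those of
  \<open>'v\<close> in a trivialization. Different trivializations count as different pieces, all
  served by the same coefficients.\<close>

lemma subspace_has_frame:
  fixes W :: "'a::finite_dim_inner set"
  assumes "subspace W"
  obtains B where "finite B" "B \<subseteq> W" "\<And>b. b \<in> B \<Longrightarrow> norm b = 1"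
    "\<And>x. x \<in> W \<Longrightarrow> (\<Sum>b\<in>B. (x \<bullet> b) *\<^sub>R b) = x"
proof -
  obtain T :: "'a set" where T: "finite T" "\<And>x. \<exists>c. x = (\<Sum>b\<in>T. c b *\<^sub>R b)"
    using finite_spanning_set by blast
  have spT: "span T = UNIV"
  proof -
    have "x \<in> span T" for x
    proof -
      obtain c where "x = (\<Sum>b\<in>T. c b *\<^sub>R b)"
        using T(2) by blast
      also have "\<dots> \<in> span T"
        by (intro span_sum span_scale span_base)
      finally show ?thesis .
    qed
    then show ?thesis by blast
  qed
  obtain B0 where B0: "B0 \<subseteq> W" "independent B0" "W \<subseteq> span B0"
    using maximal_independent_subset[of W] by blast
  have "finite B0"
    using independent_span_bound[OF T(1) B0(2)] spT by simp
  then obtain C where C: "finite C" "span C = span B0" "pairwise orthogonal C"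
    using basis_orthogonal by blast
  have spC: "span C = W"
    using C(2) B0 assms span_minimal by blast
  define B where "B = (\<lambda>c. c /\<^sub>R norm c) ` (C - {0})"
  have fin: "finite B"
    unfolding B_def using C(1) by simp
  have sub: "B \<subseteq> W"
    unfolding B_def using span_superset[of C] spC assms
    by (auto intro!: subspace_scale)
  have nrm: "norm b = 1" if "b \<in> B" for b
  proof -
    obtain c where "c \<noteq> 0" "b = c /\<^sub>R norm c"
      using \<open>b \<in> B\<close> unfolding B_def by blast
    then show ?thesis by simp
  qed
  have orth: "b \<bullet> b' = 0" if "b \<in> B" "b' \<in> B" "b \<noteq> b'" for b b'
  proof -
    obtain c c' where "c \<in> C" "c' \<in> C" "b = c /\<^sub>R norm c" "b' = c' /\<^sub>R norm c'"
      using \<open>b \<in> B\<close> \<open>b' \<in> B\<close> unfolding B_def by blast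
    then show ?thesis
      using C(3) that(3) by (auto simp: pairwise_def orthogonal_def)
  qed
  have base: "(\<Sum>b\<in>B. (x \<bullet> b) *\<^sub>R b) = x" if "x \<in> B" for x
  proof -
    have "(\<Sum>b\<in>B. (x \<bullet> b) *\<^sub>R b) = (\<Sum>b\<in>B. if b = x then b else 0)"
      using orth nrm that by (intro sum.cong) (auto simp: norm_eq_1)
    then show ?thesis
      using fin that by simp
  qed
  have spB: "span B = W"
  proof
    show "span B \<subseteq> W"
      using sub assms by (rule span_minimal)
    have "c \<in> span B" if "c \<in> C" for c
    proof (cases "c = 0")
      case False
      then have "norm c *\<^sub>R (c /\<^sub>R norm c) \<in> span B"
        using that unfolding B_def by (intro span_scale span_base) blast
      then show ?thesis
        using False by simp
    qed (simp add: span_zero)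
    then show "W \<subseteq> span B"
      using spC span_minimal[of C "span B"] by auto
  qed
  have "(\<Sum>b\<in>B. (x \<bullet> b) *\<^sub>R b) = x" if "x \<in> W" for x
  proof -
    have "x \<in> span B"
      using that spB by simp
    then show ?thesis
    proof (induction rule: span_induct_alt)
      case (step c y z)
      have "(\<Sum>b\<in>B. ((c *\<^sub>R y + z) \<bullet> b) *\<^sub>R b) =
          c *\<^sub>R (\<Sum>b\<in>B. (y \<bullet> b) *\<^sub>R b) + (\<Sum>b\<in>B. (z \<bullet> b) *\<^sub>R b)"
        by (simp add: inner_left_distrib scaleR_left_distrib sum.distrib scaleR_sum_right)
      then show ?case
        using base[OF step(1)] step(2) by simp
    qed simp
  qed
  then show ?thesis
    using that fin sub nrm by blast
qed

text \<open>A fixed orthonormal basis. Orthogonality is implied: pairing the expansion of a unit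
  vector \<open>b\<close> of the set with \<open>b\<close> gives 1 = 1 + the squares of its products
  with the others. So \<open>card frame\<close> is the dimension, which may be 0.\<close>

definition frame :: "'a::finite_dim_inner set" where
  "frame = (SOME B. finite B \<and> (\<forall>b\<in>B. norm b = 1) \<and> (\<forall>x. (\<Sum>b\<in>B. (x \<bullet> b) *\<^sub>R b) = x))"

lemma frame: "finite (frame :: 'a::finite_dim_inner set) \<and> (\<forall>b\<in>frame :: 'a set. norm b = 1) \<and>
    (\<forall>x::'a. (\<Sum>b\<in>frame. (x \<bullet> b) *\<^sub>R b) = x)"
proof -
  obtain B :: "'a set" where B: "finite B" "B \<subseteq> UNIV" "\<And>b. b \<in> B \<Longrightarrow> norm b = 1"
      "\<And>x. x \<in> UNIV \<Longrightarrow> (\<Sum>b\<in>B. (x \<bullet> b) *\<^sub>R b) = x"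
    by (rule subspace_has_frame[OF subspace_UNIV]) (rule that)
  have "finite B \<and> (\<forall>b\<in>B. norm b = 1) \<and> (\<forall>x. (\<Sum>b\<in>B. (x \<bullet> b) *\<^sub>R b) = x)"
    using B(1,3) B(4)[OF UNIV_I] by simp
  then show ?thesis
    unfolding frame_def by (rule someI)
qed

lemma finite_frame [simp, intro]: "finite frame"
  by (rule frame[THEN conjunct1])

lemma norm_frame: "b \<in> frame \<Longrightarrow> norm b = 1"
  by (rule frame[THEN conjunct2, THEN conjunct1, rule_format])

lemma frame_expansion: "(\<Sum>b\<in>frame. (x \<bullet> b) *\<^sub>R b) = x"
  by (rule frame[THEN conjunct2, THEN conjunct2, rule_format])

lemma norm_le_frame_bound:
  fixes x :: "'a::finite_dim_inner"
  assumes "\<And>b. b \<in> frame \<Longrightarrow> \<bar>x \<bullet> b\<bar> \<le> r"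
  shows "norm x \<le> real (card (frame :: 'a set)) * r"
proof -
  have "norm x \<le> (\<Sum>b\<in>frame. norm ((x \<bullet> b) *\<^sub>R b))"
    using norm_sum[of "\<lambda>b. (x \<bullet> b) *\<^sub>R b" frame] by (simp only: frame_expansion)
  also have "\<dots> \<le> (\<Sum>b\<in>(frame :: 'a set). r)"
    using assms by (intro sum_mono) (simp add: norm_frame)
  finally show ?thesis
    by simp
qed

lemma abs_inner_frame_le: "b \<in> frame \<Longrightarrow> \<bar>x \<bullet> b\<bar> \<le> norm x"
  using Cauchy_Schwarz_ineq2[of x b] by (simp add: norm_frame)

lemma linear_imp_bounded_linear_finite_dim:
  fixes f :: "'a::finite_dim_inner \<Rightarrow> 'b::real_normed_vector"
  assumes "linear f"
  shows "bounded_linear f"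
proof -
  interpret linear f by fact
  have "norm (f x) \<le> norm x * (\<Sum>b\<in>frame. norm (f b))" for x
  proof -
    have "f x = (\<Sum>b\<in>frame. (x \<bullet> b) *\<^sub>R f b)"
      by (subst frame_expansion[of x, symmetric]) (simp add: sum scale)
    also have "norm \<dots> \<le> (\<Sum>b\<in>frame. norm x * norm (f b))"
      by (rule sum_norm_le) (simp add: abs_inner_frame_le mult_right_mono)
    finally show ?thesis
      by (simp add: sum_distrib_left)
  qed
  then show ?thesis
    by (intro bounded_linear_intro[where K = "\<Sum>b\<in>frame. norm (f b)"]) (auto simp: add scale)
qed

text \<open>Makes closed balls compact, where all bounds below are taken, and yields the
  completeness needed to sum series. The subsequence is refined once for each coordinate.\<close>

instance finite_dim_inner \<subseteq> heine_borel
proof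
  fix f :: "nat \<Rightarrow> 'a"
  assume bd: "bounded (range f)"
  have "\<forall>D \<subseteq> frame :: 'a set. \<exists>l. \<exists>r::nat\<Rightarrow>nat. strict_mono r \<and>
      (\<forall>b\<in>D. (\<lambda>n. f (r n) \<bullet> b) \<longlonglongrightarrow> l b)"
  proof safe
    fix D :: "'a set" assume "D \<subseteq> frame"
    then have "finite D" by (rule finite_subset) simp
    then show "\<exists>l. \<exists>r::nat\<Rightarrow>nat. strict_mono r \<and> (\<forall>b\<in>D. (\<lambda>n. f (r n) \<bullet> b) \<longlonglongrightarrow> l b)"
    proof (induction D rule: finite_induct)
      case empty
      show ?case
        using strict_mono_id by auto
    next
      case (insert b D)
      then obtain l and r :: "nat \<Rightarrow> nat" where r: "strict_mono r" "\<forall>b\<in>D. (\<lambda>n. f (r n) \<bullet> b) \<longlonglongrightarrow> l b"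
        by blast
      have "bounded ((\<lambda>x. x \<bullet> b) ` range f)"
        using bd by (intro bounded_linear_image bounded_linear_inner_left)
      then have "bounded (range (\<lambda>n. f (r n) \<bullet> b))"
        by (rule bounded_subset) auto
      then obtain l' r' where r': "strict_mono (r' :: nat \<Rightarrow> nat)" "((\<lambda>n. f (r n) \<bullet> b) \<circ> r') \<longlonglongrightarrow> l'"
        using bounded_imp_convergent_subsequence by blast
      have "strict_mono (r \<circ> r')"
        using r(1) r'(1) by (rule strict_mono_o)
      moreover have "\<forall>c\<in>insert b D. (\<lambda>n. f ((r \<circ> r') n) \<bullet> c) \<longlonglongrightarrow> (l(b := l')) c"
      proof
        fix c assume c: "c \<in> insert b D"
        show "(\<lambda>n. f ((r \<circ> r') n) \<bullet> c) \<longlonglongrightarrow> (l(b := l')) c"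
        proof (cases "c = b")
          case True
          then show ?thesis
            using r'(2) by (simp add: o_def)
        next
          case False
          then have "(\<lambda>n. f (r n) \<bullet> c) \<longlonglongrightarrow> l c"
            using c r(2) by simp
          then show ?thesis
            using LIMSEQ_subseq_LIMSEQ[OF _ r'(1)] False by (simp add: o_def)
        qed
      qed
      ultimately show ?case
        by blast
    qed
  qed
  then obtain l and r :: "nat \<Rightarrow> nat" where r: "strict_mono r" "\<And>b::'a. b \<in> frame \<Longrightarrow> (\<lambda>n. f (r n) \<bullet> b) \<longlonglongrightarrow> l b"
    by blast
  have "(\<lambda>n. \<Sum>b\<in>frame. (f (r n) \<bullet> b) *\<^sub>R b) \<longlonglongrightarrow> (\<Sum>b\<in>frame. l b *\<^sub>R b)"
    by (intro tendsto_sum tendsto_scaleR r(2) tendsto_const)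
  then have "(f \<circ> r) \<longlonglongrightarrow> (\<Sum>b\<in>frame. l b *\<^sub>R b)"
    by (simp add: frame_expansion o_def)
  then show "\<exists>l r. strict_mono r \<and> (f \<circ> r) \<longlonglongrightarrow> l"
    using r(1) by blast
qed

instance finite_dim_inner \<subseteq> banach ..

text \<open>Lets \<open>Lindelof\<close> be applied to open sets of coordinate pairs in
  \<open>'e \<times> 'v\<close>.\<close>

instance finite_dim_inner \<subseteq> second_countable_topology
proof
  define D :: "'a set" where "D = (\<lambda>q. \<Sum>b\<in>frame. q b *\<^sub>R b) ` (frame \<rightarrow>\<^sub>E \<rat>)"
  have cD: "countable D"
    unfolding D_def by (intro countable_image countable_PiE) (auto simp: countable_rat)
  have dense: "\<exists>d\<in>D. dist x d < e" if "e > 0" for x e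
  proof -
    let ?r = "e / (real (card (frame :: 'a set)) + 1)"
    have "\<exists>q\<in>\<rat>. \<bar>x \<bullet> b - q\<bar> \<le> ?r" for b
    proof -
      have "x \<bullet> b < x \<bullet> b + ?r"
        using that by (simp add: add_nonneg_pos)
      then obtain q where "q \<in> \<rat>" "x \<bullet> b < q" "q < x \<bullet> b + ?r"
        using Rats_dense_in_real by blast
      then show ?thesis
        by (intro bexI[of _ q]) auto
    qed
    then obtain q where q: "\<And>b. q b \<in> \<rat>" "\<And>b. \<bar>x \<bullet> b - q b\<bar> \<le> ?r"
      by metis
    define d where "d = (\<Sum>b\<in>frame. restrict q frame b *\<^sub>R b)"
    have "d \<in> D"
      unfolding D_def d_def using q(1) by (intro imageI) auto
    have "x - d = (\<Sum>b\<in>frame. (x \<bullet> b) *\<^sub>R b) - (\<Sum>b\<in>frame. q b *\<^sub>R b)"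
      unfolding d_def by (simp add: frame_expansion)
    also have "\<dots> = (\<Sum>b\<in>frame. (x \<bullet> b - q b) *\<^sub>R b)"
      by (simp add: scaleR_diff_left sum_subtractf)
    finally have "norm (x - d) \<le> (\<Sum>b\<in>(frame :: 'a set). ?r)"
      using q(2) by (simp only:) (rule sum_norm_le, simp add: norm_frame)
    also have "\<dots> < e"
      using that by (simp add: field_simps add_nonneg_pos)
    finally show ?thesis
      using \<open>d \<in> D\<close> by (auto simp: dist_norm)
  qed
  define \<B> where "\<B> = (\<lambda>(d, r). ball d r) ` (D \<times> \<rat>)"
  have "topological_basis \<B>"
  proof (rule topological_basisI)
    fix S and x :: 'a
    assume "open S" "x \<in> S"
    then obtain e where e: "e > 0" "ball x e \<subseteq> S"
      using open_contains_ball by blast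
    obtain d where d: "d \<in> D" "dist x d < e / 4"
      using dense[of "e / 4" x] e(1) by auto
    obtain r where r: "r \<in> \<rat>" "e / 4 < r" "r < e / 2"
      using Rats_dense_in_real[of "e / 4" "e / 2"] e(1) by auto
    have "ball d r \<subseteq> ball x e"
    proof
      fix y assume "y \<in> ball d r"
      then have "dist x y < e"
        using dist_triangle[of x y d] d(2) r(3) e(1) by simp
      then show "y \<in> ball x e" by simp
    qed
    moreover have "ball d r \<in> \<B>"
      unfolding \<B>_def using d(1) r(1) by auto
    moreover have "x \<in> ball d r"
      using d(2) r(2) by (simp add: dist_commute)
    ultimately show "\<exists>B'\<in>\<B>. x \<in> B' \<and> B' \<subseteq> S"
      using e(2) by blast
  qed (auto simp: \<B>_def)
  moreover have "countable \<B>"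
    unfolding \<B>_def using cD by (intro countable_image countable_SIGMA) (auto simp: countable_rat)
  ultimately show "\<exists>B::'a set set. countable B \<and> open = generate_topology B"
    by (blast intro: topological_basis_imp_subbasis)
qed

text \<open>Subspaces are closed: the reproducing formula of \<open>B\<close> defines a continuous
  projection onto \<open>W\<close> that fixes every term, hence also the sum. This keeps infinite
  combinations of sections inside \<open>G\<close>.\<close>

lemma subspace_suminf_mem:
  fixes f :: "nat \<Rightarrow> 'v::finite_dim_inner"
  assumes "subspace W" "summable f" "\<And>n. f n \<in> W"
  shows "(\<Sum>n. f n) \<in> W"
proof -
  obtain B where B: "finite B" "B \<subseteq> W" "\<And>b. b \<in> B \<Longrightarrow> norm b = 1"
    "\<And>x. x \<in> W \<Longrightarrow> (\<Sum>b\<in>B. (x \<bullet> b) *\<^sub>R b) = x"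
    by (rule subspace_has_frame[OF assms(1)]) (rule that)
  have "bounded_linear (\<lambda>x. \<Sum>b\<in>B. (x \<bullet> b) *\<^sub>R b)"
    by (intro bounded_linear_sum bounded_linear_scaleR_const bounded_linear_inner_left)
  then have "(\<lambda>n. \<Sum>b\<in>B. (f n \<bullet> b) *\<^sub>R b) sums (\<Sum>b\<in>B. ((\<Sum>n. f n) \<bullet> b) *\<^sub>R b)"
    by (rule bounded_linear.sums[OF _ summable_sums[OF assms(2)]])
  then have "f sums (\<Sum>b\<in>B. ((\<Sum>n. f n) \<bullet> b) *\<^sub>R b)"
    by (simp add: B(4)[OF assms(3)])
  then have "(\<Sum>n. f n) = (\<Sum>b\<in>B. ((\<Sum>n. f n) \<bullet> b) *\<^sub>R b)"
    by (rule sums_unique[symmetric])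
  also have "\<dots> \<in> W"
    using B(2) assms(1) by (intro subspace_sum subspace_scale) auto
  finally show ?thesis .
qed

text \<open>The difference of \<open>y\<close> and its orthogonal projection to \<open>T\<close>
  lies in \<open>W\<close> and is orthogonal to \<open>T\<close>, so it vanishes. This is the
  passage from nonzero inner products back to spanning.\<close>

lemma subspace_subset_if_separating:
  fixes W T :: "'v::finite_dim_inner set"
  assumes W: "subspace W" and T: "subspace T" "T \<subseteq> W"
    and sep: "\<And>w. w \<in> W \<Longrightarrow> w \<noteq> 0 \<Longrightarrow> \<exists>y\<in>T. w \<bullet> y \<noteq> 0"
  shows "W \<subseteq> T"
proof
  fix y assume y: "y \<in> W"
  obtain B where B: "finite B" "B \<subseteq> T" "\<And>b. b \<in> B \<Longrightarrow> norm b = 1"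
    "\<And>x. x \<in> T \<Longrightarrow> (\<Sum>b\<in>B. (x \<bullet> b) *\<^sub>R b) = x"
    by (rule subspace_has_frame[OF T(1)]) (rule that)
  define y' where "y' = (\<Sum>b\<in>B. (y \<bullet> b) *\<^sub>R b)"
  have y': "y' \<in> T"
    unfolding y'_def using B(2) T(1) by (intro subspace_sum subspace_scale) auto
  have orth: "(y - y') \<bullet> x = 0" if "x \<in> T" for x
  proof -
    have "y' \<bullet> x = y \<bullet> (\<Sum>b\<in>B. (x \<bullet> b) *\<^sub>R b)"
      by (simp add: y'_def inner_sum_left inner_sum_right inner_commute mult.commute)
    then show ?thesis
      by (simp add: B(4)[OF that] inner_diff_left)
  qed
  have "y - y' \<in> W"
    using W y y' T(2) by (auto intro: subspace_diff)
  then have "y - y' = 0"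
    using sep orth by blast
  then show "y \<in> T"
    using y' by simp
qed

section \<open>Calculus of smooth maps\<close>

lemma Ck_on_subset: "Ck_on k T f \<Longrightarrow> S \<subseteq> T \<Longrightarrow> Ck_on k S f"
  by (induction k arbitrary: f) (auto intro: continuous_on_subset)

lemma Ck_on_local:
  assumes "\<And>x. x \<in> S \<Longrightarrow> \<exists>T. open T \<and> x \<in> T \<and> Ck_on k T f"
  shows "Ck_on k S f"
  using assms
proof (induction k arbitrary: f)
  case 0
  show ?case
    unfolding Ck_on.simps
  proof (rule continuous_at_imp_continuous_on, rule ballI)
    fix x assume "x \<in> S"
    with 0[OF this] show "isCont f x"
      by (auto simp: continuous_on_eq_continuous_at)
  qed
next
  case (Suc k)
  have "f differentiable (at x)" if "x \<in> S" for x
    using Suc.prems[OF that] by auto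
  moreover have "Ck_on k S (\<lambda>x. frechet_derivative f (at x) v)" for v
    by (rule Suc.IH) (use Suc.prems in force)
  ultimately show ?case
    by simp
qed

lemma frechet_derivative_cong_open:
  assumes "open S" "x \<in> S" "\<And>y. y \<in> S \<Longrightarrow> f y = g y"
  shows "frechet_derivative f (at x) = frechet_derivative g (at x)"
proof -
  have "(f has_derivative D) (at x) \<longleftrightarrow> (g has_derivative D) (at x)" for D
    using assms has_derivative_transform_within_open by metis
  then show ?thesis
    unfolding frechet_derivative_def by simp
qed

lemma Ck_on_cong:
  assumes "open S" "\<And>x. x \<in> S \<Longrightarrow> f x = g x" "Ck_on k S f"
  shows "Ck_on k S g"
  using assms(2,3)
proof (induction k arbitrary: f g)
  case 0
  then show ?case
    using continuous_on_cong by fastforce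
next
  case (Suc k)
  have "g differentiable (at x)" if "x \<in> S" for x
  proof -
    have "f differentiable (at x)"
      using Suc.prems(2) that by simp
    then obtain D where "(f has_derivative D) (at x)"
      unfolding differentiable_def by blast
    then have "(g has_derivative D) (at x)"
      using has_derivative_transform_within_open assms(1) that Suc.prems(1) by metis
    then show ?thesis
      unfolding differentiable_def by blast
  qed
  moreover have "Ck_on k S (\<lambda>x. frechet_derivative g (at x) v)" for v
  proof (rule Suc.IH)
    show "Ck_on k S (\<lambda>x. frechet_derivative f (at x) v)"
      using Suc.prems(2) by simp
    show "frechet_derivative f (at x) v = frechet_derivative g (at x) v" if "x \<in> S" for x
      using frechet_derivative_cong_open[OF assms(1) that Suc.prems(1)] by simp
  qed
  ultimately show ?case
    by simp
qed

lemma Ck_on_SucD: "Ck_on (Suc k) S f \<Longrightarrow> Ck_on k S f"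
proof (induction k arbitrary: f)
  case 0
  then have "\<forall>x\<in>S. isCont f x"
    by (auto intro: differentiable_imp_continuous_within)
  then show ?case
    by (simp add: continuous_at_imp_continuous_on)
next
  case (Suc k)
  then show ?case
    by (metis Ck_on.simps(2))
qed

text \<open>Derivatives are unique, so any explicit formula may stand in for
  \<open>frechet_derivative\<close>. Openness of \<open>S\<close> lets the formula be arbitrary off
  \<open>S\<close>.\<close>

lemma Ck_on_SucI:
  assumes "open S"
    and D: "\<And>x. x \<in> S \<Longrightarrow> (f has_derivative D x) (at x)"
    and Ck: "\<And>v. Ck_on k S (\<lambda>x. D x v)"
  shows "Ck_on (Suc k) S f"
proof -
  have "Ck_on k S (\<lambda>x. frechet_derivative f (at x) v)" for v
    by (rule Ck_on_cong[OF assms(1) _ Ck[of v]]) (simp add: frechet_derivative_at[OF D, symmetric])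
  then show ?thesis
    using D by (auto simp: differentiable_def)
qed

lemma Ck_on_Suc_has_derivative:
  "Ck_on (Suc k) S f \<Longrightarrow> x \<in> S \<Longrightarrow> (f has_derivative frechet_derivative f (at x)) (at x)"
  by (simp flip: frechet_derivative_works)

lemma Ck_on_const [simp]: "Ck_on k S (\<lambda>x. c)"
  by (induction k arbitrary: c) auto

lemma Ck_on_bounded_linear:
  assumes "open S" "bounded_linear L" "Ck_on k S f"
  shows "Ck_on k S (\<lambda>x. L (f x))"
  using assms(3)
proof (induction k arbitrary: f)
  case 0
  then show ?case
    using bounded_linear.continuous_on[OF assms(2)] by simp
next
  case (Suc k)
  show ?case
  proof (rule Ck_on_SucI[OF assms(1)])
    show "((\<lambda>x. L (f x)) has_derivative (\<lambda>v. L (frechet_derivative f (at x) v))) (at x)" if "x \<in> S" for x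
      by (rule bounded_linear.has_derivative[OF assms(2) Ck_on_Suc_has_derivative[OF Suc.prems that]])
    show "Ck_on k S (\<lambda>x. L (frechet_derivative f (at x) v))" for v
      using Suc.prems by (intro Suc.IH) simp
  qed
qed

lemma Ck_on_id [simp]: "Ck_on k S (\<lambda>x. x)"
proof -
  have "Ck_on k UNIV (\<lambda>x::'a. x)"
  proof (cases k)
    case (Suc j)
    show ?thesis
      unfolding Suc by (rule Ck_on_SucI[where D = "\<lambda>_ v. v"]) auto
  qed simp
  then show ?thesis
    by (rule Ck_on_subset) simp
qed

lemma Ck_on_add:
  assumes "open S" "Ck_on k S f" "Ck_on k S g"
  shows "Ck_on k S (\<lambda>x. f x + g x)"
  using assms(2,3)
proof (induction k arbitrary: f g)
  case 0
  then show ?case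
    by (simp add: continuous_on_add)
next
  case (Suc k)
  show ?case
  proof (rule Ck_on_SucI[OF assms(1)])
    show "((\<lambda>x. f x + g x) has_derivative
        (\<lambda>v. frechet_derivative f (at x) v + frechet_derivative g (at x) v)) (at x)" if "x \<in> S" for x
      using that Suc.prems by (intro has_derivative_add Ck_on_Suc_has_derivative)
    show "Ck_on k S (\<lambda>x. frechet_derivative f (at x) v + frechet_derivative g (at x) v)" for v
      using Suc.prems by (intro Suc.IH) simp_all
  qed
qed

lemma Ck_on_sum:
  assumes "open S" "\<And>i. i \<in> I \<Longrightarrow> Ck_on k S (f i)"
  shows "Ck_on k S (\<lambda>x. \<Sum>i\<in>I. f i x)"
  using assms(2)
  by (induction I rule: infinite_finite_induct) (auto intro: Ck_on_add[OF assms(1)])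

lemma Ck_on_scaleR:
  assumes "open S" "Ck_on k S h" "Ck_on k S f"
  shows "Ck_on k S (\<lambda>x. h x *\<^sub>R f x)"
  using assms(2,3)
proof (induction k arbitrary: f h)
  case 0
  then show ?case
    by (simp add: continuous_on_scaleR)
next
  case (Suc k)
  show ?case
  proof (rule Ck_on_SucI[OF assms(1)])
    show "((\<lambda>x. h x *\<^sub>R f x) has_derivative
        (\<lambda>v. h x *\<^sub>R frechet_derivative f (at x) v + frechet_derivative h (at x) v *\<^sub>R f x)) (at x)"
      if "x \<in> S" for x
      using that Suc.prems by (intro has_derivative_scaleR Ck_on_Suc_has_derivative)
    show "Ck_on k S (\<lambda>x. h x *\<^sub>R frechet_derivative f (at x) v + frechet_derivative h (at x) v *\<^sub>R f x)" for v
      using Suc.prems Ck_on_SucD[OF Suc.prems(1)] Ck_on_SucD[OF Suc.prems(2)]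
      by (intro Ck_on_add[OF assms(1)] Suc.IH) simp_all
  qed
qed

lemma Ck_on_Pair:
  assumes "open S" "Ck_on k S f" "Ck_on k S g"
  shows "Ck_on k S (\<lambda>x. (f x, g x))"
proof -
  have "Ck_on k S (\<lambda>x. (f x, 0) + (0, g x))"
    by (intro Ck_on_add Ck_on_bounded_linear[of S "\<lambda>y. (y, 0)"] Ck_on_bounded_linear[of S "\<lambda>y. (0, y)"]
        assms bounded_linear_Pair bounded_linear_ident bounded_linear_zero)
  then show ?thesis
    by simp
qed

text \<open>\<open>Ck_on\<close> differentiates in fixed directions, but the chain rule evaluates
  the derivative of \<open>f\<close> at the moving vector \<open>?g' x v\<close>. Expanding that
  vector in \<open>frame\<close> leaves a finite sum of products in which \<open>f\<close> is
  differentiated in fixed directions only, and the induction applies.\<close>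

lemma Ck_on_compose:
  fixes f :: "'b::finite_dim_inner \<Rightarrow> 'c::real_normed_vector" and g :: "'a::real_normed_vector \<Rightarrow> 'b"
  assumes S: "open S" and f: "Ck_on k T f" and g: "Ck_on k S g" and gS: "g ` S \<subseteq> T"
  shows "Ck_on k S (\<lambda>x. f (g x))"
  using f g
proof (induction k arbitrary: f)
  case 0
  then show ?case
    using gS by (auto intro: continuous_on_compose2)
next
  case (Suc k)
  let ?f' = "\<lambda>y. frechet_derivative f (at y)" and ?g' = "\<lambda>x. frechet_derivative g (at x)"
  show ?case
  proof (rule Ck_on_SucI[OF S])
    show "((\<lambda>x. f (g x)) has_derivative (\<lambda>v. \<Sum>b\<in>frame. (?g' x v \<bullet> b) *\<^sub>R ?f' (g x) b)) (at x)"
      if x: "x \<in> S" for x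
    proof -
      have f': "(f has_derivative ?f' (g x)) (at (g x))"
        using Suc.prems(1) x gS by (intro Ck_on_Suc_has_derivative) auto
      interpret linear "?f' (g x)"
        using f' by (rule has_derivative_linear)
      have "?f' (g x) w = (\<Sum>b\<in>frame. (w \<bullet> b) *\<^sub>R ?f' (g x) b)" for w
        by (subst frame_expansion[of w, symmetric]) (simp add: sum scale)
      then have eq: "(\<lambda>v. ?f' (g x) (?g' x v)) =
          (\<lambda>v. \<Sum>b\<in>frame. (?g' x v \<bullet> b) *\<^sub>R ?f' (g x) b)"
        by (intro ext)
      have "((\<lambda>x. f (g x)) has_derivative (\<lambda>v. ?f' (g x) (?g' x v))) (at x)"
        using diff_chain_at[OF Ck_on_Suc_has_derivative[OF Suc.prems(2) x] f'] by (simp add: o_def)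
      then show ?thesis
        unfolding eq .
    qed
    show "Ck_on k S (\<lambda>x. \<Sum>b\<in>frame. (?g' x v \<bullet> b) *\<^sub>R ?f' (g x) b)" for v
    proof (intro Ck_on_sum Ck_on_scaleR S)
      show "Ck_on k S (\<lambda>x. ?g' x v \<bullet> b)" for b
        using Suc.prems(2) by (intro Ck_on_bounded_linear[OF S bounded_linear_inner_left]) simp
      show "Ck_on k S (\<lambda>x. ?f' (g x) b)" for b
        using Suc.prems(1) Ck_on_SucD[OF Suc.prems(2)] by (intro Suc.IH) simp_all
    qed
  qed
qed

lemma smooth_on_subset: "smooth_on T f \<Longrightarrow> S \<subseteq> T \<Longrightarrow> smooth_on S f"
  by (auto simp: smooth_on_def intro: Ck_on_subset)

lemma smooth_on_local:
  assumes "\<And>x. x \<in> S \<Longrightarrow> \<exists>T. open T \<and> x \<in> T \<and> smooth_on T f"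
  shows "smooth_on S f"
  unfolding smooth_on_def
proof
  show "Ck_on k S f" for k
    by (rule Ck_on_local) (use assms in \<open>auto simp: smooth_on_def\<close>)
qed

lemma smooth_on_cong:
  "open S \<Longrightarrow> (\<And>x. x \<in> S \<Longrightarrow> f x = g x) \<Longrightarrow> smooth_on S f \<Longrightarrow> smooth_on S g"
  by (auto simp: smooth_on_def intro: Ck_on_cong)

lemma smooth_on_const: "smooth_on S (\<lambda>x. c)"
  and smooth_on_id: "smooth_on S (\<lambda>x. x)"
  by (auto simp: smooth_on_def)

lemma smooth_on_bounded_linear:
  "open S \<Longrightarrow> bounded_linear L \<Longrightarrow> smooth_on S f \<Longrightarrow> smooth_on S (\<lambda>x. L (f x))"
  by (simp add: smooth_on_def Ck_on_bounded_linear)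

lemma smooth_on_scaleR:
  "open S \<Longrightarrow> smooth_on S h \<Longrightarrow> smooth_on S f \<Longrightarrow> smooth_on S (\<lambda>x. h x *\<^sub>R f x)"
  by (simp add: smooth_on_def Ck_on_scaleR)

lemma smooth_on_add:
  "open S \<Longrightarrow> smooth_on S f \<Longrightarrow> smooth_on S g \<Longrightarrow> smooth_on S (\<lambda>x. f x + g x)"
  by (simp add: smooth_on_def Ck_on_add)

lemma smooth_on_sum:
  "open S \<Longrightarrow> (\<And>i. i \<in> I \<Longrightarrow> smooth_on S (f i)) \<Longrightarrow> smooth_on S (\<lambda>x. \<Sum>i\<in>I. f i x)"
  by (simp add: smooth_on_def Ck_on_sum)

lemma smooth_on_Pair:
  "open S \<Longrightarrow> smooth_on S f \<Longrightarrow> smooth_on S g \<Longrightarrow> smooth_on S (\<lambda>x. (f x, g x))"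
  by (simp add: smooth_on_def Ck_on_Pair)

lemma smooth_on_compose:
  fixes f :: "'b::finite_dim_inner \<Rightarrow> 'c::real_normed_vector"
  assumes "open S" "smooth_on T f" "smooth_on S g" "g ` S \<subseteq> T"
  shows "smooth_on S (\<lambda>x. f (g x))"
  unfolding smooth_on_def
proof
  show "Ck_on k S (\<lambda>x. f (g x))" for k
    by (rule Ck_on_compose[OF assms(1) _ _ assms(4)]) (use assms(2,3) in \<open>simp_all add: smooth_on_def\<close>)
qed

lemma smooth_on_imp_continuous_on: "smooth_on S f \<Longrightarrow> continuous_on S f"
  unfolding smooth_on_def by (drule spec[of _ 0]) simp

section \<open>Series of smooth maps and bump functions\<close>

text \<open>A bound for all partial derivatives of order at most \<open>k\<close>. Restricting to
  directions in \<open>frame\<close> makes a single constant possible, since derivatives are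
  unbounded in the direction.\<close>

primrec Ck_bound :: "nat \<Rightarrow> 'e::finite_dim_inner set \<Rightarrow> ('e \<Rightarrow> 'f::real_normed_vector) \<Rightarrow> real \<Rightarrow> bool" where
  "Ck_bound 0 S f c \<longleftrightarrow> (\<forall>x\<in>S. norm (f x) \<le> c)"
| "Ck_bound (Suc k) S f c \<longleftrightarrow>
     (\<forall>x\<in>S. norm (f x) \<le> c) \<and> (\<forall>b\<in>frame. Ck_bound k S (\<lambda>x. frechet_derivative f (at x) b) c)"

lemma Ck_bound_mono: "Ck_bound k S f c \<Longrightarrow> T \<subseteq> S \<Longrightarrow> c \<le> d \<Longrightarrow> Ck_bound k T f d"
  by (induction k arbitrary: f) (simp, meson order_trans subsetD, simp, meson order_trans subsetD)

lemma Ck_bound_cong: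
  assumes "open S" "\<And>x. x \<in> S \<Longrightarrow> f x = g x" "Ck_bound k S f c"
  shows "Ck_bound k S g c"
  using assms(2,3)
proof (induction k arbitrary: f g)
  case (Suc k)
  have "Ck_bound k S (\<lambda>x. frechet_derivative g (at x) b) c" if "b \<in> frame" for b
  proof (rule Suc.IH)
    show "Ck_bound k S (\<lambda>x. frechet_derivative f (at x) b) c"
      using Suc.prems(2) that by simp
    show "frechet_derivative f (at x) b = frechet_derivative g (at x) b" if "x \<in> S" for x
      using frechet_derivative_cong_open[OF assms(1) that Suc.prems(1)] by simp
  qed
  then show ?case
    using Suc.prems by simp
qed simp

lemma Ck_bound_scaleR:
  assumes "open S" "Ck_on k S f" "Ck_bound k S f c"
  shows "Ck_bound k S (\<lambda>x. t *\<^sub>R f x) (\<bar>t\<bar> * c)"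
  using assms(2,3)
proof (induction k arbitrary: f)
  case (Suc k)
  have "Ck_bound k S (\<lambda>x. frechet_derivative (\<lambda>x. t *\<^sub>R f x) (at x) b) (\<bar>t\<bar> * c)" if "b \<in> frame" for b
  proof (rule Ck_bound_cong[OF assms(1)])
    show "Ck_bound k S (\<lambda>x. t *\<^sub>R frechet_derivative f (at x) b) (\<bar>t\<bar> * c)"
      using Suc.prems that by (intro Suc.IH) simp_all
    show "t *\<^sub>R frechet_derivative f (at x) b = frechet_derivative (\<lambda>x. t *\<^sub>R f x) (at x) b" if "x \<in> S" for x
      using frechet_derivative_at[OF has_derivative_scaleR_right[OF Ck_on_Suc_has_derivative[OF Suc.prems(1) that]]]
      by metis
  qed
  then show ?case
    using Suc.prems(2) by (simp add: mult_left_mono)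
qed (simp add: mult_left_mono)

lemma Ck_on_imp_continuous_on: "Ck_on k S f \<Longrightarrow> continuous_on S f"
proof (induction k)
  case (Suc k)
  then show ?case
    using Ck_on_SucD by blast
qed simp

lemma Ck_bound_exists:
  assumes "compact K" "K \<subseteq> S" "Ck_on k S f"
  shows "\<exists>c. Ck_bound k K f c"
  using assms(3)
proof (induction k arbitrary: f)
  case 0
  then have "compact (f ` K)"
    using assms by (auto intro: compact_continuous_image continuous_on_subset)
  then show ?case
    by (auto dest!: compact_imp_bounded simp: bounded_iff)
next
  case (Suc k)
  have "compact (f ` K)"
    using continuous_on_subset[OF Ck_on_imp_continuous_on[OF Suc.prems] assms(2)] assms(1)
    by (rule compact_continuous_image)
  then obtain c0 where c0: "\<forall>x\<in>K. norm (f x) \<le> c0"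
    by (auto dest!: compact_imp_bounded simp: bounded_iff)
  have "\<forall>b. \<exists>c. Ck_bound k K (\<lambda>x. frechet_derivative f (at x) b) c"
    using Suc by simp
  then obtain c where c: "\<And>b. Ck_bound k K (\<lambda>x. frechet_derivative f (at x) b) (c b)"
    by metis
  let ?c = "\<bar>c0\<bar> + (\<Sum>b\<in>frame. \<bar>c b\<bar>)"
  have "c b \<le> ?c" if "b \<in> frame" for b
    using member_le_sum[OF that, of "\<lambda>b. \<bar>c b\<bar>"] by simp
  then have "\<forall>b\<in>frame. Ck_bound k K (\<lambda>x. frechet_derivative f (at x) b) ?c"
    using c by (blast intro: Ck_bound_mono)
  moreover have "c0 \<le> ?c"
    by (rule order_trans[OF abs_ge_self]) (simp add: sum_nonneg)
  then have "\<forall>x\<in>K. norm (f x) \<le> ?c"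
    using c0 order_trans by blast
  ultimately show ?case
    by auto
qed

lemma Ck_bound_norm: "Ck_bound k S f c \<Longrightarrow> x \<in> S \<Longrightarrow> norm (f x) \<le> c"
  by (cases k) auto

lemma norm_linear_le_frame:
  fixes f :: "'a::finite_dim_inner \<Rightarrow> 'b::real_normed_vector"
  assumes "linear f" "\<And>b. b \<in> frame \<Longrightarrow> norm (f b) \<le> c"
  shows "norm (f h) \<le> real (card (frame :: 'a set)) * c * norm h"
proof -
  interpret linear f by fact
  have "f h = (\<Sum>b\<in>frame. (h \<bullet> b) *\<^sub>R f b)"
    by (subst frame_expansion[of h, symmetric]) (simp add: sum scale)
  also have "norm \<dots> \<le> (\<Sum>b\<in>(frame :: 'a set). norm h * c)"
    by (rule sum_norm_le) (use assms(2) in \<open>auto intro!: mult_mono abs_inner_frame_le\<close>)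
  finally show ?thesis
    by (simp add: mult.assoc mult.commute mult.left_commute)
qed

text \<open>The Weierstrass test applied to the functions and all their partial derivatives at once,
  with \<open>c\<close> as common majorant. Convexity is what termwise differentiation by
  \<open>has_derivative_series\<close> asks for.\<close>

lemma Ck_on_suminf:
  fixes f :: "nat \<Rightarrow> 'e::finite_dim_inner \<Rightarrow> 'f::banach"
  assumes S: "open S" "convex S"
    and f: "\<And>n. Ck_on k S (f n)"
    and c: "\<And>n. Ck_bound k S (f n) (c n)" "summable c"
  shows "Ck_on k S (\<lambda>x. \<Sum>n. f n x)"
  using f c(1)
proof (induction k arbitrary: f)
  case 0
  have "uniform_limit S (\<lambda>n x. \<Sum>i<n. f i x) (\<lambda>x. \<Sum>n. f n x) sequentially"
    using 0 c(2) by (intro Weierstrass_m_test) auto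
  moreover have "continuous_on S (\<lambda>x. \<Sum>i<n. f i x)" for n
    using 0 by (intro continuous_on_sum) auto
  ultimately have "continuous_on S (\<lambda>x. \<Sum>n. f n x)"
    by (intro uniform_limit_theorem[where F = sequentially and f = "\<lambda>n x. \<Sum>i<n. f i x"]) simp_all
  then show ?case
    by simp
next
  case (Suc k)
  let ?D = "\<lambda>n x. frechet_derivative (f n) (at x)"
  let ?C = "real (card (frame :: 'e set))"
  have D: "(f n has_derivative ?D n x) (at x)" if "x \<in> S" for n x
    using Suc.prems(1) that by (rule Ck_on_Suc_has_derivative)
  have sm: "summable (\<lambda>n. f n x)" if "x \<in> S" for x
    by (rule summable_comparison_test[OF _ c(2)]) (use Suc.prems(2) that Ck_bound_norm in blast)
  have Dle: "norm (?D n x h) \<le> ?C * c n * norm h" if "x \<in> S" for n x h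
  proof (rule norm_linear_le_frame)
    show "linear (?D n x)"
      using D[OF that] by (rule has_derivative_linear)
    show "norm (?D n x b) \<le> c n" if "b \<in> frame" for b
      using Suc.prems(2)[of n] that \<open>x \<in> S\<close> Ck_bound_norm by fastforce
  qed
  have smC: "summable (\<lambda>n. ?C * c n * norm h)" for h :: 'e
    using c(2) by (intro summable_mult summable_mult2)
  have smD: "summable (\<lambda>n. ?D n x h)" if "x \<in> S" for x h
    by (rule summable_comparison_test[OF _ smC]) (use Dle[OF that] in blast)
  have unif: "\<forall>\<^sub>F n in sequentially. \<forall>x\<in>S. \<forall>h. norm ((\<Sum>i<n. ?D i x h) - (\<Sum>i. ?D i x h)) \<le> e * norm h"
    if "e > 0" for e
  proof -
    \<comment> \<open>The added 1 covers the model space of dimension 0, where \<open>?C\<close> is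
      0.\<close>
    have "e / (?C + 1) > 0"
      using that by (simp add: add_nonneg_pos)
    then obtain N where N: "\<And>n. n \<ge> N \<Longrightarrow> norm (\<Sum>i. c (i + n)) < e / (?C + 1)"
      using suminf_exist_split[OF _ c(2)] by blast
    have "norm ((\<Sum>i<n. ?D i x h) - (\<Sum>i. ?D i x h)) \<le> e * norm h"
      if "n \<ge> N" "x \<in> S" for n x h
    proof -
      have "norm ((\<Sum>i<n. ?D i x h) - (\<Sum>i. ?D i x h)) = norm (\<Sum>i. ?D (i + n) x h)"
        using suminf_split_initial_segment[OF smD[OF that(2), of h], of n] by simp
      also have "\<dots> \<le> (\<Sum>i. ?C * c (i + n) * norm h)"
        using Dle[OF that(2)] summable_ignore_initial_segment[OF smC[of h], of n] by (intro norm_suminf_le) auto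
      also have "\<dots> = ?C * norm h * (\<Sum>i. c (i + n))"
        using summable_ignore_initial_segment[OF c(2), of n] by (simp add: suminf_mult suminf_mult2 mult.assoc mult.commute)
      also have "\<dots> \<le> ?C * norm h * (e / (?C + 1))"
        using N[OF that(1)] by (intro mult_left_mono) auto
      also have "\<dots> = (?C / (?C + 1)) * (e * norm h)"
        by simp
      also have "\<dots> \<le> 1 * (e * norm h)"
        using \<open>e > 0\<close> by (intro mult_right_mono) (auto simp: field_simps add_nonneg_pos)
      finally show ?thesis by simp
    qed
    then show ?thesis
      unfolding eventually_sequentially by blast
  qed
  have deriv: "((\<lambda>x. \<Sum>n. f n x) has_derivative (\<lambda>h. \<Sum>n. ?D n x h)) (at x)" if x: "x \<in> S" for x
  proof -
    have "\<exists>g. \<forall>x\<in>S. (\<lambda>n. f n x) sums (g x) \<and> (g has_derivative (\<lambda>h. \<Sum>n. ?D n x h)) (at x within S)"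
    proof (rule has_derivative_series[OF S(2)])
      show "(f n has_derivative ?D n x) (at x within S)" if "x \<in> S" for n x
        using D[OF that] by (rule has_derivative_at_withinI)
    qed (use unif x sm[THEN summable_sums] in blast)+
    then obtain g where g: "\<And>x. x \<in> S \<Longrightarrow> (\<lambda>n. f n x) sums (g x)"
      "\<And>x. x \<in> S \<Longrightarrow> (g has_derivative (\<lambda>h. \<Sum>n. ?D n x h)) (at x within S)"
      by blast
    have "(g has_derivative (\<lambda>h. \<Sum>n. ?D n x h)) (at x)"
      using g(2)[OF x] at_within_open[OF x S(1)] by simp
    then show ?thesis
      by (rule has_derivative_transform_within_open[OF _ S(1) x]) (use g(1) sums_unique in blast)
  qed
  show ?case
  proof (rule Ck_on_SucI[OF S(1) deriv])
    \<comment> \<open>The bounds, and so the induction hypothesis, concern frame directions only; a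
      general direction \<open>v\<close> is reached by linearity.\<close>
    have base: "Ck_on k S (\<lambda>x. \<Sum>n. ?D n x b)" if "b \<in> frame" for b
      using Suc.prems that by (intro Suc.IH) auto
    have expand: "(\<Sum>b\<in>frame. (v \<bullet> b) *\<^sub>R (\<Sum>n. ?D n x b)) = (\<Sum>n. ?D n x v)" if "x \<in> S" for x v
    proof -
      have "(\<Sum>b\<in>frame. (v \<bullet> b) *\<^sub>R (\<Sum>n. ?D n x b)) = (\<Sum>n. \<Sum>b\<in>frame. (v \<bullet> b) *\<^sub>R ?D n x b)"
        using smD[OF that] by (simp add: suminf_sum suminf_scaleR_right summable_scaleR_right)
      also have "\<dots> = (\<Sum>n. ?D n x v)"
      proof (rule suminf_cong)
        fix n
        interpret linear "?D n x"
          using D[OF that] by (rule has_derivative_linear)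
        show "(\<Sum>b\<in>frame. (v \<bullet> b) *\<^sub>R ?D n x b) = ?D n x v"
          by (subst (2) frame_expansion[of v, symmetric]) (simp add: sum scale)
      qed
      finally show ?thesis .
    qed
    have comb: "Ck_on k S (\<lambda>x. \<Sum>b\<in>frame. (v \<bullet> b) *\<^sub>R (\<Sum>n. ?D n x b))" for v
      using base by (intro Ck_on_sum Ck_on_scaleR S(1)) auto
    show "Ck_on k S (\<lambda>x. \<Sum>n. ?D n x v)" for v
      by (rule Ck_on_cong[OF S(1) _ comb[of v]]) (rule expand)
  qed
qed

text \<open>The classical \<open>exp (- 1 / x)\<close>, extended by 0. The extra powers of
  \<open>1 / x\<close> give a family whose linear span is closed under differentiation, so
  smoothness of all members follows by one induction.\<close>

definition flat :: "nat \<Rightarrow> real \<Rightarrow> real" where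
  "flat m x = (if x \<le> 0 then 0 else inverse x ^ m * exp (- inverse x))"

text \<open>With \<open>y = 1 / x\<close>, the exponential series dominates its term of degree
  \<open>m + 1\<close>; the power of \<open>y\<close> that is left over becomes the factor
  \<open>\<bar>x\<bar>\<close>.\<close>

lemma flat_le: "\<bar>flat m x\<bar> \<le> fact (Suc m) * \<bar>x\<bar>"
proof (cases "x \<le> 0")
  case False
  define y where "y = inverse x"
  have y: "y > 0"
    using False by (simp add: y_def)
  have "y ^ Suc m / fact (Suc m) \<le> exp y"
  proof -
    have "(\<Sum>i\<in>{Suc m}. inverse (fact i) * y ^ i) \<le> (\<Sum>i. inverse (fact i) * y ^ i)"
      using summable_exp[of y] y by (intro sum_le_suminf) auto
    then show ?thesis
      by (simp add: exp_def divide_inverse mult.commute)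
  qed
  then have "y ^ m * exp (- y) \<le> fact (Suc m) * inverse y"
    using y by (simp add: exp_minus field_simps del: fact_Suc)
  then show ?thesis
    using False y by (simp add: flat_def y_def)
qed (simp add: flat_def mult_nonneg_nonpos)

lemma flat_tendsto_0: "(flat m \<longlongrightarrow> 0) (at 0)"
proof (rule Lim_null_comparison)
  show "\<forall>\<^sub>F x in at 0. norm (flat m x) \<le> fact (Suc m) * \<bar>x\<bar>"
    using flat_le by simp
  show "((\<lambda>x::real. fact (Suc m) * \<bar>x\<bar>) \<longlongrightarrow> 0) (at 0)"
    by (rule tendsto_eq_intros refl | simp)+
qed

lemma flat_has_derivative:
  "(flat m has_real_derivative - real m * flat (Suc m) x + flat (Suc (Suc m)) x) (at x)"
proof -
  consider "x < 0" | "x = 0" | "x > 0"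
    by linarith
  then show ?thesis
  proof cases
    case 1
    have "(flat m has_real_derivative 0) (at x)"
      by (rule has_field_derivative_transform_within_open[of "\<lambda>_. 0" _ _ "{..<0}"])
        (use 1 in \<open>auto simp: flat_def\<close>)
    then show ?thesis
      using 1 by (simp add: flat_def)
  next
    case 2
    \<comment> \<open>The difference quotient at 0 is itself a member of the family, so the
      derivative there is its limit 0.\<close>
    have "(\<lambda>h. (flat m (0 + h) - flat m 0) / h) = flat (Suc m)"
      by (auto simp: flat_def fun_eq_iff field_simps)
    then have "(flat m has_real_derivative 0) (at 0)"
      using flat_tendsto_0[of "Suc m"] by (simp only: DERIV_def)
    then show ?thesis
      using 2 by (simp add: flat_def)
  next
    case 3
    have "((\<lambda>x. inverse x ^ m * exp (- inverse x)) has_real_derivative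
        - real m * flat (Suc m) x + flat (Suc (Suc m)) x) (at x)"
    proof (cases m)
      case 0
      then show ?thesis
        using 3 by (auto intro!: derivative_eq_intros simp: flat_def power2_eq_square)
    next
      case (Suc k)
      have "(inverse has_real_derivative - (inverse x * inverse x)) (at x)"
        using DERIV_inverse[of x] 3 by simp
      moreover have "((\<lambda>x. exp (- inverse x)) has_real_derivative exp (- inverse x) * (inverse x * inverse x)) (at x)"
        using 3 by (auto intro!: derivative_eq_intros)
      ultimately show ?thesis
        unfolding Suc using 3
        by (intro DERIV_cong[OF DERIV_mult[OF DERIV_power_Suc]]) (auto simp: flat_def algebra_simps)
    qed
    then show ?thesis
      by (rule has_field_derivative_transform_within_open[of _ _ _ "{0<..}"])
        (use 3 in \<open>auto simp: flat_def\<close>)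
  qed
qed

lemma smooth_on_flat: "smooth_on S (flat m)"
proof -
  have "Ck_on k UNIV (flat m)" for k
  proof (induction k arbitrary: m)
    case 0
    show ?case
      by (auto intro!: continuous_at_imp_continuous_on DERIV_isCont[OF flat_has_derivative])
  next
    case (Suc k)
    show ?case
    proof (rule Ck_on_SucI[OF open_UNIV])
      show "(flat m has_derivative (\<lambda>v. v *\<^sub>R ((- real m) *\<^sub>R flat (Suc m) x + flat (Suc (Suc m)) x))) (at x)" for x
      proof -
        have "(\<lambda>v. v *\<^sub>R ((- real m) *\<^sub>R flat (Suc m) x + flat (Suc (Suc m)) x)) =
            (*) (- real m * flat (Suc m) x + flat (Suc (Suc m)) x)"
          by (auto simp: fun_eq_iff)
        then show ?thesis
          using flat_has_derivative[of m x] by (simp only: has_field_derivative_def)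
      qed
      show "Ck_on k UNIV (\<lambda>x. v *\<^sub>R ((- real m) *\<^sub>R flat (Suc m) x + flat (Suc (Suc m)) x))" for v
        by (intro Ck_on_scaleR Ck_on_add open_UNIV Ck_on_const Suc.IH)
    qed
  qed
  then show ?thesis
    unfolding smooth_on_def by (blast intro: Ck_on_subset)
qed

text \<open>The squared distance keeps the argument of \<open>flat\<close> polynomial, hence smooth
  at the centre as well.\<close>

definition bump :: "'a::finite_dim_inner \<Rightarrow> real \<Rightarrow> 'a \<Rightarrow> real" where
  "bump a r x = flat 0 (r\<^sup>2 - (x - a) \<bullet> (x - a))"

lemma smooth_on_bump: "smooth_on S (bump a r)"
proof -
  have sum_eq: "y \<bullet> y = (\<Sum>b\<in>frame. (y \<bullet> b) *\<^sub>R (y \<bullet> b))" for y :: 'a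
  proof -
    have "y \<bullet> (\<Sum>b\<in>frame. (y \<bullet> b) *\<^sub>R b) = y \<bullet> y"
      by (simp only: frame_expansion)
    then show ?thesis
      by (simp add: inner_sum_right)
  qed
  have lin: "smooth_on UNIV (\<lambda>x. (x - a) \<bullet> b)" for b
    using smooth_on_bounded_linear[OF open_UNIV bounded_linear_inner_left
        smooth_on_add[OF open_UNIV smooth_on_id smooth_on_const[of _ "- a"]], of b]
    by simp
  have "smooth_on UNIV (\<lambda>x. r\<^sup>2 + (- 1) *\<^sub>R (\<Sum>b\<in>frame. ((x - a) \<bullet> b) *\<^sub>R ((x - a) \<bullet> b)))"
    by (intro smooth_on_add smooth_on_scaleR smooth_on_sum open_UNIV smooth_on_const lin)
  moreover have "r\<^sup>2 + (- 1) *\<^sub>R (\<Sum>b\<in>frame. ((x - a) \<bullet> b) *\<^sub>R ((x - a) \<bullet> b)) = r\<^sup>2 - (x - a) \<bullet> (x - a)" for x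
    by (simp only: sum_eq[symmetric]) simp
  ultimately have "smooth_on UNIV (\<lambda>x. r\<^sup>2 - (x - a) \<bullet> (x - a))"
    by (simp only:)
  then have "smooth_on UNIV (\<lambda>x. flat 0 (r\<^sup>2 - (x - a) \<bullet> (x - a)))"
    by (rule smooth_on_compose[OF open_UNIV smooth_on_flat]) auto
  then show ?thesis
    unfolding bump_def[abs_def] by (rule smooth_on_subset) simp
qed

lemma bump_nonzero_iff: "r > 0 \<Longrightarrow> bump a r x \<noteq> 0 \<longleftrightarrow> x \<in> ball a r"
  by (simp add: bump_def flat_def dist_norm norm_minus_commute power2_norm_eq_inner[symmetric]
      not_le power_mono_iff)

section \<open>Generic linear combinations\<close>

text \<open>The label \<open>cl R x\<close> consists of the coordinates of \<open>x\<close> times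
  \<open>R\<close>, rounded down. A coordinate bounded by \<open>m\<close> gives at most
  \<open>2 * R * m + 1\<close> values, which is at most \<open>(2 * m + 1) * R\<close>; thus
  \<open>C\<close> is independent of \<open>R\<close>, and this is what the later count
  exploits.\<close>

lemma box_partition:
  fixes X :: "'z::finite_dim_inner set"
  assumes "bounded X"
  obtains C :: nat and cl :: "nat \<Rightarrow> 'z \<Rightarrow> 'z \<Rightarrow> int" where
    "\<And>R. R \<ge> 1 \<Longrightarrow> finite (cl R ` X)"
    "\<And>R. R \<ge> 1 \<Longrightarrow> card (cl R ` X) \<le> C * R ^ card (frame :: 'z set)"
    "\<And>R x y. R \<ge> 1 \<Longrightarrow> cl R x = cl R y \<Longrightarrow> norm (x - y) \<le> real (card (frame :: 'z set)) / real R"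
proof -
  obtain r where r: "\<And>x. x \<in> X \<Longrightarrow> norm x \<le> r"
    using assms by (auto simp: bounded_iff)
  obtain m :: nat where m: "r \<le> real m"
    using real_arch_simple by blast
  let ?D = "card (frame :: 'z set)"
  define cl :: "nat \<Rightarrow> 'z \<Rightarrow> 'z \<Rightarrow> int" where "cl R x = restrict (\<lambda>b. \<lfloor>real R * (x \<bullet> b)\<rfloor>) frame" for R x
  have img: "cl R ` X \<subseteq> frame \<rightarrow>\<^sub>E {- int (R * m)..int (R * m)}" for R
  proof
    fix h assume "h \<in> cl R ` X"
    then obtain x where x: "x \<in> X" "h = cl R x"
      by blast
    have "\<lfloor>real R * (x \<bullet> b)\<rfloor> \<in> {- int (R * m)..int (R * m)}" if "b \<in> frame" for b
    proof -
      have "\<bar>x \<bullet> b\<bar> \<le> real m"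
        using abs_inner_frame_le[OF that, of x] r[OF x(1)] m by linarith
      then have "\<bar>real R * (x \<bullet> b)\<bar> \<le> real R * real m"
        by (simp add: abs_mult mult_left_mono)
      then have "- real R * real m \<le> real R * (x \<bullet> b)" "real R * (x \<bullet> b) \<le> real R * real m"
        by auto
      then show ?thesis
        by (auto simp: le_floor_iff floor_le_iff)
    qed
    then show "h \<in> frame \<rightarrow>\<^sub>E {- int (R * m)..int (R * m)}"
      unfolding x(2) cl_def by auto
  qed
  have fin: "finite (frame \<rightarrow>\<^sub>E {- int (R * m)..int (R * m)} :: ('z \<Rightarrow> int) set)" for R
    by (intro finite_PiE) auto
  have "card (cl R ` X) \<le> (2 * m + 1) ^ ?D * R ^ ?D" if "R \<ge> 1" for R
  proof -
    have "card (cl R ` X) \<le> card (frame \<rightarrow>\<^sub>E {- int (R * m)..int (R * m)} :: ('z \<Rightarrow> int) set)"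
      using img fin by (rule card_mono[rotated])
    also have "\<dots> = (2 * (R * m) + 1) ^ ?D"
      by (simp add: card_PiE nat_add_distrib nat_mult_distrib)
    also have "\<dots> \<le> ((2 * m + 1) * R) ^ ?D"
      using that by (intro power_mono) (auto simp: algebra_simps)
    finally show ?thesis
      by (simp only: power_mult_distrib)
  qed
  moreover have "norm (x - y) \<le> real ?D / real R" if "R \<ge> 1" "cl R x = cl R y" for R x y
  proof -
    have "\<bar>(x - y) \<bullet> b\<bar> \<le> 1 / real R" if "b \<in> frame" for b
    proof -
      have "\<lfloor>real R * (x \<bullet> b)\<rfloor> = \<lfloor>real R * (y \<bullet> b)\<rfloor>"
        using fun_cong[OF \<open>cl R x = cl R y\<close>, of b] that by (simp add: cl_def)
      then have "\<bar>real R * (x \<bullet> b) - real R * (y \<bullet> b)\<bar> \<le> 1"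
        by linarith
      then have "real R * \<bar>(x - y) \<bullet> b\<bar> \<le> 1"
        by (simp add: abs_mult[of "real R", simplified, symmetric] inner_diff_left right_diff_distrib)
      then show ?thesis
        using \<open>R \<ge> 1\<close> by (simp add: field_simps)
    qed
    then show ?thesis
      using norm_le_frame_bound[of "x - y" "1 / real R"] by simp
  qed
  moreover have "finite (cl R ` X)" for R
    using img fin by (rule finite_subset)
  ultimately show ?thesis
    using that by blast
qed

text \<open>
  Cells of diameter about \<open>1 / R\<close> cover \<open>X\<close>, and there are \<open>O(R ^ D)\<close> of them. A cell excludes at
  most one of the \<open>R ^ (D + 1)\<close> points of a grid of mesh about \<open>1 / R\<close> in the parameter space, so some
  grid point survives.
\<close>

lemma generic_coefficients_step:
  fixes X :: "'z::finite_dim_inner set" and g :: "nat \<Rightarrow> 'z \<Rightarrow> real" and F :: "'z \<Rightarrow> real"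
  defines "N \<equiv> Suc (card (frame :: 'z set))"
  assumes X: "bounded X"
    and g: "\<And>j x y. x \<in> X \<Longrightarrow> y \<in> X \<Longrightarrow> \<bar>g j x - g j y\<bar> \<le> K * norm (x - y)"
    and F: "\<And>x y. x \<in> X \<Longrightarrow> y \<in> X \<Longrightarrow> \<bar>F x - F y\<bar> \<le> L * norm (x - y)"
    and c: "c > 0" "\<And>x. x \<in> X \<Longrightarrow> c \<le> \<bar>F x\<bar>"
    and \<eta>: "\<eta> > 0"
  shows "\<exists>t \<mu>. (\<forall>j. 0 \<le> t j \<and> t j \<le> \<eta>) \<and> \<mu> > 0 \<and> (\<forall>x\<in>X. \<exists>j<N. \<mu> \<le> \<bar>g j x + t j * F x\<bar>)"
proof -
  let ?D = "card (frame :: 'z set)"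
  obtain C :: nat and cl :: "nat \<Rightarrow> 'z \<Rightarrow> 'z \<Rightarrow> int" where cl:
    "\<And>R. R \<ge> 1 \<Longrightarrow> finite (cl R ` X)"
    "\<And>R. R \<ge> 1 \<Longrightarrow> card (cl R ` X) \<le> C * R ^ ?D"
    "\<And>R x y. R \<ge> 1 \<Longrightarrow> cl R x = cl R y \<Longrightarrow> norm (x - y) \<le> real ?D / real R"
    using box_partition[OF X] by metis
  \<comment> \<open>\<open>Q / R'\<close> bounds the oscillation of \<open>g j + t j * F\<close>
    over a cell of scale \<open>1 / R'\<close>, for every \<open>t j\<close> between 0 and
    \<eta>.\<close>
  define Q where "Q = (\<bar>K\<bar> + \<eta> * \<bar>L\<bar>) * real ?D"
  have Q: "Q \<ge> 0"
    unfolding Q_def using \<eta> by simp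
  \<comment> \<open>Cells are taken finer than the parameter grid by a factor \<open>A\<close>,
    fixed before \<open>R\<close>. The choice makes the oscillation \<open>Q / (A * R)\<close> at
    most a quarter of \<open>c\<close> times the mesh \<open>\<eta> / R\<close>, which is
    \<mu>.\<close>
  obtain A0 :: nat where A0: "4 * Q / (\<eta> * c) \<le> real A0"
    using real_arch_simple by blast
  define A where "A = Suc A0"
  have A: "4 * Q \<le> real A * (\<eta> * c)" "A \<ge> 1"
  proof -
    have "4 * Q \<le> real A0 * (\<eta> * c)"
      using A0 c(1) \<eta> by (simp add: pos_divide_le_eq)
    also have "\<dots> \<le> real A * (\<eta> * c)"
      using c(1) \<eta> by (intro mult_right_mono) (auto simp: A_def)
    finally show "4 * Q \<le> real A * (\<eta> * c)" .
  qed (simp add: A_def)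
  \<comment> \<open>Exceeding \<open>C * A ^ ?D\<close> makes the \<open>R ^ N\<close> grid points
    outnumber the at most \<open>C * (A * R) ^ ?D\<close> cells, as
    \<open>N = ?D + 1\<close>.\<close>
  define R where "R = Suc (C * A ^ ?D)"
  have R: "R \<ge> 1"
    by (simp add: R_def)
  define h where "h = \<eta> / real R"
  have h: "h > 0" "h * real R = \<eta>"
    using \<eta> R by (auto simp: h_def)
  define \<mu> where "\<mu> = h * c / 4"
  have \<mu>: "\<mu> > 0"
    using h c by (simp add: \<mu>_def)
  let ?cl = "cl (A * R)"
  have AR: "A * R \<ge> 1"
    using A R by simp
  have small: "Q / (real A * real R) \<le> \<mu>"
    using A R \<eta> by (simp add: \<mu>_def h_def field_simps)
  define rep where "rep \<kappa> = (SOME x. x \<in> X \<and> ?cl x = \<kappa>)" for \<kappa>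
  have rep: "rep (?cl x) \<in> X" "?cl (rep (?cl x)) = ?cl x" if "x \<in> X" for x
  proof -
    have "\<exists>y. y \<in> X \<and> ?cl y = ?cl x"
      using that by blast
    then show "rep (?cl x) \<in> X" "?cl (rep (?cl x)) = ?cl x"
      unfolding rep_def by (metis (mono_tags, lifting) someI_ex)+
  qed
  \<comment> \<open>Smallness is tested at one representative of each cell; the threshold
    \<open>2 * \<mu>\<close> leaves \<mu> for the oscillation across the cell.\<close>
  define P where "P \<kappa> j i \<longleftrightarrow> \<bar>g j (rep \<kappa>) + (h * real i) * F (rep \<kappa>)\<bar> < 2 * \<mu>" for \<kappa> j i
  \<comment> \<open>Two bad values \<open>i\<close> and \<open>i'\<close> would be less than
    \<open>4 * \<mu> = h * c\<close> apart in the tested quantity, yet they change it by at least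
    \<open>h * c\<close> because \<open>\<bar>F\<bar>\<close> is at least \<open>c\<close>.\<close>
  have uniq: "i = i'" if x: "x \<in> X" and P: "P (?cl x) j i" "P (?cl x) j i'" for x j i i'
  proof (rule ccontr)
    assume "i \<noteq> i'"
    then have "1 \<le> \<bar>real i - real i'\<bar>"
      by linarith
    then have "h * 1 * c \<le> h * \<bar>real i - real i'\<bar> * \<bar>F (rep (?cl x))\<bar>"
      using h c(1) c(2)[OF rep(1)[OF x]] by (intro mult_mono) auto
    also have "\<dots> = \<bar>(g j (rep (?cl x)) + (h * real i) * F (rep (?cl x))) -
        (g j (rep (?cl x)) + (h * real i') * F (rep (?cl x)))\<bar>"
    proof -
      have "(g j (rep (?cl x)) + (h * real i) * F (rep (?cl x))) -
        (g j (rep (?cl x)) + (h * real i') * F (rep (?cl x))) = h * (real i - real i') * F (rep (?cl x))"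
        by (simp add: algebra_simps)
      then show ?thesis
        using h by (simp add: abs_mult)
    qed
    also have "\<dots> < 4 * \<mu>"
      using P unfolding P_def by linarith
    finally show False
      by (simp add: \<mu>_def)
  qed
  \<comment> \<open>A grid point fails on a cell only if all its coordinates are bad there, and by
    \<open>uniq\<close> these conditions determine it. If some coordinate has no bad value,
    \<open>SOME\<close> yields an arbitrary entry, which only adds a needless exclusion.\<close>
  define kill where "kill \<kappa> = restrict (\<lambda>j. SOME i. P \<kappa> j i) {..<N}" for \<kappa>
  let ?G = "{..<N} \<rightarrow>\<^sub>E {..<R}"
  have "card (kill ` ?cl ` X) \<le> card (?cl ` X)"
    using cl(1)[OF AR] by (rule card_image_le)
  also have "\<dots> \<le> C * (A * R) ^ ?D"
    using cl(2)[OF AR] .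
  also have "\<dots> < R ^ N"
  proof -
    have "C * A ^ ?D * R ^ ?D < R * R ^ ?D"
      using R by (intro mult_strict_right_mono) (auto simp: R_def)
    then show ?thesis
      by (simp add: N_def power_mult_distrib mult.assoc)
  qed
  also have "\<dots> = card ?G"
    by (simp add: card_PiE)
  finally have "\<not> ?G \<subseteq> kill ` ?cl ` X"
    using cl(1)[OF AR] card_mono[of "kill ` ?cl ` X" ?G] by fastforce
  then obtain \<gamma> where \<gamma>: "\<gamma> \<in> ?G" "\<gamma> \<notin> kill ` ?cl ` X"
    by blast
  define t where "t j = (if j < N then h * real (\<gamma> j) else 0)" for j
  have t: "0 \<le> t j \<and> t j \<le> \<eta>" for j
  proof (cases "j < N")
    case True
    then have "real (\<gamma> j) \<le> real R"
      using \<gamma>(1) by (auto simp: PiE_iff less_imp_le)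
    then have "h * real (\<gamma> j) \<le> h * real R"
      using h(1) by (intro mult_left_mono) auto
    then show ?thesis
      using True h by (simp add: t_def)
  qed (use \<eta> in \<open>simp add: t_def\<close>)
  have "\<exists>j<N. \<mu> \<le> \<bar>g j x + t j * F x\<bar>" if x: "x \<in> X" for x
  proof -
    have "\<exists>j<N. \<not> P (?cl x) j (\<gamma> j)"
    proof (rule ccontr)
      assume "\<not> ?thesis"
      then have all: "P (?cl x) j (\<gamma> j)" if "j < N" for j
        using that by blast
      have "kill (?cl x) = \<gamma>"
      proof
        fix j
        show "kill (?cl x) j = \<gamma> j"
        proof (cases "j < N")
          case True
          have "P (?cl x) j (SOME i. P (?cl x) j i)"
            using all[OF True] by (rule someI)
          then show ?thesis
            using uniq[OF x _ all[OF True]] True by (simp add: kill_def)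
        next
          case False
          then show ?thesis
            using \<gamma>(1) by (simp add: kill_def PiE_iff extensional_def)
        qed
      qed
      then show False
        using \<gamma>(2) x by blast
    qed
    then obtain j where j: "j < N" "\<not> P (?cl x) j (\<gamma> j)"
      by blast
    let ?y = "rep (?cl x)"
    have y: "?y \<in> X"
      using rep(1)[OF x] .
    have nrm: "norm (x - ?y) \<le> real ?D / real (A * R)"
      using cl(3)[OF AR] rep(2)[OF x] by metis
    have "\<bar>(g j x + t j * F x) - (g j ?y + t j * F ?y)\<bar> \<le> \<bar>g j x - g j ?y\<bar> + \<bar>t j * (F x - F ?y)\<bar>"
      by (simp add: algebra_simps)
    also have "\<bar>g j x - g j ?y\<bar> \<le> \<bar>K\<bar> * norm (x - ?y)"
      by (rule order_trans[OF g[OF x y]]) (simp add: mult_right_mono)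
    also have "\<bar>t j * (F x - F ?y)\<bar> \<le> \<eta> * (\<bar>L\<bar> * norm (x - ?y))"
    proof -
      have "\<bar>F x - F ?y\<bar> \<le> \<bar>L\<bar> * norm (x - ?y)"
        by (rule order_trans[OF F[OF x y]]) (simp add: mult_right_mono)
      then show ?thesis
        unfolding abs_mult using t[of j] \<eta> by (intro mult_mono) auto
    qed
    also have "\<bar>K\<bar> * norm (x - ?y) + \<eta> * (\<bar>L\<bar> * norm (x - ?y)) = (\<bar>K\<bar> + \<eta> * \<bar>L\<bar>) * norm (x - ?y)"
      by (simp add: algebra_simps)
    also have "\<dots> \<le> (\<bar>K\<bar> + \<eta> * \<bar>L\<bar>) * (real ?D / real (A * R))"
      using nrm \<eta> by (intro mult_left_mono) auto
    also have "\<dots> \<le> \<mu>"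
      using small by (simp add: Q_def)
    finally have "\<bar>(g j x + t j * F x) - (g j ?y + t j * F ?y)\<bar> \<le> \<mu>"
      by simp
    moreover have "2 * \<mu> \<le> \<bar>g j ?y + t j * F ?y\<bar>"
      using j by (simp add: P_def t_def)
    ultimately have "\<mu> \<le> \<bar>g j x + t j * F x\<bar>"
      by linarith
    then show ?thesis
      using j(1) by blast
  qed
  then show ?thesis
    using t \<mu> by blast
qed

text \<open>\<open>F n i\<close> is the \<open>i\<close>-th term of the series on the piece
  \<open>X n\<close>. Step \<open>n\<close> brings the sum of the terms up to \<open>n\<close> away
  from 0 on \<open>X n\<close> by a margin; the tail allowed on \<open>X n\<close> afterwards totals
  at most a quarter of that margin. The conclusion is phrased with \<open>sums\<close>, leaving
  convergence to the user of the lemma.\<close>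

lemma generic_coefficients:
  fixes X :: "nat \<Rightarrow> 'z::finite_dim_inner set" and F :: "nat \<Rightarrow> nat \<Rightarrow> 'z \<Rightarrow> real"
  defines "N \<equiv> Suc (card (frame :: 'z set))"
  assumes X: "\<And>n. bounded (X n)"
    and L: "\<And>n i x y. x \<in> X n \<Longrightarrow> y \<in> X n \<Longrightarrow> \<bar>F n i x - F n i y\<bar> \<le> L n i * norm (x - y)"
    and B: "\<And>n i x. x \<in> X n \<Longrightarrow> \<bar>F n i x\<bar> \<le> B n i"
    and c: "\<And>n. c n > 0" "\<And>n x. x \<in> X n \<Longrightarrow> c n \<le> \<bar>F n n x\<bar>"
    and \<epsilon>: "\<And>n. \<epsilon> n > 0"
  obtains t :: "nat \<Rightarrow> nat \<Rightarrow> real" where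
    "\<And>n j. 0 \<le> t n j" "\<And>n j. t n j \<le> \<epsilon> n"
    "\<And>n x. x \<in> X n \<Longrightarrow> \<exists>j<N. \<forall>s. (\<lambda>i. t i j * F n i x) sums s \<longrightarrow> s \<noteq> 0"
proof -
  \<comment> \<open>\<open>r\<close> pairs the new coefficients with their margin, and
    \<open>f\<close> is the history. The \<open>if\<close> supplies a positive bound even for
    histories with a nonpositive margin, so that a continuation exists after any history;
    \<open>1 + \<bar>B k n\<bar>\<close> avoids dividing by 0.\<close>
  define P where "P f n r \<longleftrightarrow>
      (\<forall>j. 0 \<le> fst r j \<and> fst r j \<le> \<epsilon> n) \<and>
      (\<forall>k<n. \<forall>j. fst r j * (1 + \<bar>B k n\<bar>) \<le> (if 0 < snd (f k) then snd (f k) else 1) * (1 / 2) ^ (n + 2)) \<and>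
      0 < snd r \<and>
      (\<forall>x\<in>X n. \<exists>j<N. snd r \<le> \<bar>(\<Sum>i<n. fst (f i) j * F n i x) + fst r j * F n n x\<bar>)"
    for f :: "nat \<Rightarrow> (nat \<Rightarrow> real) \<times> real" and n r
  have "\<exists>f. \<forall>n. P f n (f n)"
  proof (rule dependent_wf_choice[OF wf_less])
    show "P f n r = P g n r" if "\<And>z. (z, n) \<in> {(x, y). x < y} \<Longrightarrow> f z = g z" for f g n r
      using that unfolding P_def by (simp cong: conj_cong)
    show "\<exists>r. P f n r" for n f
    proof -
      let ?m = "\<lambda>k. if 0 < snd (f k) then snd (f k) else (1 :: real)"
      define e where "e k = ?m k * (1 / 2) ^ (n + 2) / (1 + \<bar>B k n\<bar>)" for k
      have e: "e k > 0" for k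
        unfolding e_def by (auto intro!: divide_pos_pos mult_pos_pos)
      define \<eta> where "\<eta> = Min (insert (\<epsilon> n) (e ` {..<n}))"
      have \<eta>: "\<eta> > 0"
        unfolding \<eta>_def using e \<epsilon> by (subst Min_gr_iff) auto
      have le: "\<eta> \<le> \<epsilon> n" "k < n \<Longrightarrow> \<eta> \<le> e k" for k
        unfolding \<eta>_def by (auto intro!: Min_le)
      \<comment> \<open>Cutting off at \<open>j < N\<close> allows one Lipschitz constant
        \<open>?K\<close>, a finite sum over \<open>j\<close>, to serve all \<open>j\<close> as the
        single step demands.\<close>
      let ?g = "\<lambda>j x. \<Sum>i<n. (if j < N then fst (f i) j else 0) * F n i x"
      let ?K = "\<Sum>j<N. \<Sum>i<n. \<bar>fst (f i) j\<bar> * \<bar>L n i\<bar>"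
      have gL: "\<bar>?g j x - ?g j y\<bar> \<le> ?K * norm (x - y)" if "x \<in> X n" "y \<in> X n" for j x y
      proof (cases "j < N")
        case True
        have "\<bar>?g j x - ?g j y\<bar> = \<bar>\<Sum>i<n. fst (f i) j * (F n i x - F n i y)\<bar>"
          using True by (simp add: sum_subtractf right_diff_distrib)
        also have "\<dots> \<le> (\<Sum>i<n. \<bar>fst (f i) j * (F n i x - F n i y)\<bar>)"
          by (rule sum_abs)
        also have "\<dots> \<le> (\<Sum>i<n. \<bar>fst (f i) j\<bar> * (\<bar>L n i\<bar> * norm (x - y)))"
        proof (rule sum_mono)
          fix i
          have "\<bar>F n i x - F n i y\<bar> \<le> \<bar>L n i\<bar> * norm (x - y)"
            by (rule order_trans[OF L[OF that]]) (simp add: mult_right_mono)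
          then show "\<bar>fst (f i) j * (F n i x - F n i y)\<bar> \<le> \<bar>fst (f i) j\<bar> * (\<bar>L n i\<bar> * norm (x - y))"
            by (simp add: abs_mult mult_left_mono)
        qed
        also have "\<dots> = (\<Sum>i<n. \<bar>fst (f i) j\<bar> * \<bar>L n i\<bar>) * norm (x - y)"
          by (simp add: sum_distrib_right mult.assoc)
        also have "\<dots> \<le> ?K * norm (x - y)"
          using True by (intro mult_right_mono member_le_sum[of j "{..<N}"]) (auto intro: sum_nonneg)
        finally show ?thesis .
      next
        case False
        have "0 \<le> ?K * norm (x - y)"
          by (intro mult_nonneg_nonneg sum_nonneg) auto
        then show ?thesis
          using False by simp
      qed
      have "\<exists>t \<mu>. (\<forall>j. 0 \<le> t j \<and> t j \<le> \<eta>) \<and> \<mu> > 0 \<and>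
          (\<forall>x\<in>X n. \<exists>j<N. \<mu> \<le> \<bar>?g j x + t j * F n n x\<bar>)"
        unfolding N_def
        by (rule generic_coefficients_step[OF X[of n] gL[unfolded N_def] L[of _ n _ n] c(1)[of n] c(2) \<eta>])
      then obtain t \<mu> where tm: "(\<forall>j. 0 \<le> t j \<and> t j \<le> \<eta>) \<and> \<mu> > 0 \<and>
          (\<forall>x\<in>X n. \<exists>j<N. \<mu> \<le> \<bar>?g j x + t j * F n n x\<bar>)"
        by (elim exE) (rule that)
      have t: "0 \<le> t j \<and> t j \<le> \<eta>" for j
        using tm by blast
      have \<mu>: "\<mu> > 0"
        using tm by blast
      have ge: "\<forall>x\<in>X n. \<exists>j<N. \<mu> \<le> \<bar>?g j x + t j * F n n x\<bar>"
        by (rule tm[THEN conjunct2, THEN conjunct2])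
      have "t j * (1 + \<bar>B k n\<bar>) \<le> ?m k * (1 / 2) ^ (n + 2)" if "k < n" for k j
      proof -
        have "t j \<le> e k"
          using t[of j] le(2)[OF that] by linarith
        moreover have "0 < 1 + \<bar>B k n\<bar>"
          by simp
        ultimately show ?thesis
          unfolding e_def by (simp only: pos_le_divide_eq)
      qed
      moreover have "\<forall>x\<in>X n. \<exists>j<N. \<mu> \<le> \<bar>(\<Sum>i<n. fst (f i) j * F n i x) + t j * F n n x\<bar>"
      proof
        fix x assume "x \<in> X n"
        then obtain j where "j < N" "\<mu> \<le> \<bar>?g j x + t j * F n n x\<bar>"
          using ge by blast
        then show "\<exists>j<N. \<mu> \<le> \<bar>(\<Sum>i<n. fst (f i) j * F n i x) + t j * F n n x\<bar>"
          by (intro exI[of _ j]) simp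
      qed
      moreover have "0 \<le> t j \<and> t j \<le> \<epsilon> n" for j
        using t[of j] le(1) by linarith
      ultimately have "P f n (t, \<mu>)"
        unfolding P_def using \<mu> by simp
      then show ?thesis
        by blast
    qed
  qed
  then obtain f where f: "\<And>n. P f n (f n)"
    by blast
  define t where "t n j = fst (f n) j" for n j
  define \<mu> where "\<mu> n = snd (f n)" for n
  have t0: "0 \<le> t n j" and t\<epsilon>: "t n j \<le> \<epsilon> n" and \<mu>: "\<mu> n > 0" for n j
    using f[of n] unfolding P_def t_def \<mu>_def by blast+
  have later: "t n j * (1 + \<bar>B k n\<bar>) \<le> \<mu> k * (1 / 2) ^ (n + 2)" if "k < n" for k n j
  proof -
    have "snd (f k) > 0"
      using \<mu>[of k] by (simp add: \<mu>_def)
    then show ?thesis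
      using f[of n] that unfolding P_def t_def \<mu>_def by auto
  qed
  have "\<exists>j<N. \<forall>s. (\<lambda>i. t i j * F n i x) sums s \<longrightarrow> s \<noteq> 0" if x: "x \<in> X n" for n x
  proof -
    obtain j where j: "j < N" "\<mu> n \<le> \<bar>(\<Sum>i<n. t i j * F n i x) + t n j * F n n x\<bar>"
      using f[of n] x unfolding P_def t_def \<mu>_def by blast
    have "s \<noteq> 0" if s: "(\<lambda>i. t i j * F n i x) sums s" for s
    proof
      assume "s = 0"
      let ?a = "\<lambda>i. t i j * F n i x"
      have "(\<lambda>i. ?a (i + Suc n)) sums (s - (\<Sum>i<Suc n. ?a i))"
        using s by (rule sums_split_initial_segment)
      then have tail: "(\<lambda>i. ?a (i + Suc n)) sums (- ((\<Sum>i<n. ?a i) + ?a n))"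
        using \<open>s = 0\<close> by simp
      \<comment> \<open>The terms after index \<open>n\<close> start with exponent
        \<open>n + 3\<close>, at least 3; summing the geometric bounds gives
        \<open>\<mu> n / 4\<close>, too little to cancel a head of size
        \<open>\<mu> n\<close>.\<close>
      have bnd: "norm (?a (i + Suc n)) \<le> (\<mu> n / 8) * (1 / 2) ^ i" for i
      proof -
        have "norm (?a (i + Suc n)) \<le> t (i + Suc n) j * (1 + \<bar>B n (i + Suc n)\<bar>)"
          using B[OF x, of "i + Suc n"] t0[of "i + Suc n" j] by (auto simp: abs_mult intro!: mult_left_mono)
        also have "\<dots> \<le> \<mu> n * (1 / 2) ^ (i + Suc n + 2)"
          by (rule later) simp
        also have "\<dots> \<le> \<mu> n * (1 / 2) ^ (i + 3)"
          using \<mu>[of n] by (intro mult_left_mono power_decreasing) auto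
        also have "\<dots> = (\<mu> n / 8) * (1 / 2) ^ i"
          by (simp add: power_add power3_eq_cube)
        finally show ?thesis .
      qed
      have geo: "(\<lambda>i. (\<mu> n / 8) * (1 / 2) ^ i) sums (\<mu> n / 4)"
        using sums_mult[OF geometric_sums[of "1 / 2 :: real"], of "\<mu> n / 8"] by simp
      have "norm (\<Sum>i. ?a (i + Suc n)) \<le> (\<Sum>i. (\<mu> n / 8) * (1 / 2) ^ i)"
        by (rule norm_suminf_le[OF bnd sums_summable[OF geo]])
      then have "norm (- ((\<Sum>i<n. ?a i) + ?a n)) \<le> \<mu> n / 4"
        by (simp only: sums_unique[OF tail, symmetric] sums_unique[OF geo, symmetric])
      then have "\<bar>(\<Sum>i<n. ?a i) + ?a n\<bar> \<le> \<mu> n / 4"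
        by (simp only: real_norm_def abs_minus_cancel)
      then show False
        using j(2) \<mu>[of n] by linarith
    qed
    then show ?thesis
      using j(1) by blast
  qed
  then show ?thesis
    by (rule that[OF t0 t\<epsilon>])
qed

section \<open>Generic combinations of maps given in countably many charts\<close>

lemma smooth_on_cball_bounds:
  fixes u :: "'e::finite_dim_inner \<Rightarrow> 'v::finite_dim_inner"
  assumes "cball a r \<subseteq> \<Omega>" "smooth_on \<Omega> u"
  shows "\<exists>B L. (\<forall>x\<in>cball a r. norm (u x) \<le> B) \<and>
    (\<forall>x\<in>cball a r. \<forall>y\<in>cball a r. norm (u x - u y) \<le> L * norm (x - y))"
proof -
  have C1: "Ck_on (Suc 0) \<Omega> u"
    using assms(2) by (simp only: smooth_on_def)
  then obtain c where c: "Ck_bound (Suc 0) (cball a r) u c"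
    using Ck_bound_exists[OF compact_cball assms(1)] by blast
  let ?L = "real (card (frame :: 'e set)) * c"
  have "norm (u x - u y) \<le> ?L * norm (x - y)" if xy: "x \<in> cball a r" "y \<in> cball a r" for x y
  proof (rule differentiable_bound[OF convex_cball _ _ xy])
    fix z assume z: "z \<in> cball a r"
    have D: "(u has_derivative frechet_derivative u (at z)) (at z)"
      using Ck_on_Suc_has_derivative[OF C1] z assms(1) by blast
    then show "(u has_derivative frechet_derivative u (at z)) (at z within cball a r)"
      by (rule has_derivative_at_withinI)
    have "norm (frechet_derivative u (at z) h) \<le> ?L * norm h" for h
      using c z by (intro norm_linear_le_frame has_derivative_linear[OF D]) simp
    moreover have "0 \<le> c"
      using order_trans[OF norm_ge_zero Ck_bound_norm[OF c z]] .
    ultimately show "onorm (frechet_derivative u (at z)) \<le> ?L"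
      by (intro onorm_bound) simp_all
  qed
  then show ?thesis
    using Ck_bound_norm[OF c] by blast
qed

text \<open>\<open>u i a\<close> is meant as section \<open>i\<close> in the coordinates of chart
  \<open>a\<close>. The domain where \<open>w \<bullet> u i a x\<close> is nonzero is cut into
  bounded pieces by lower bounds \<open>1 / (m + 1)\<close>. Every triple \<open>(i, a, m)\<close>
  receives its own step, so one section enters the series many times, each time with fresh
  coefficients.\<close>

lemma generic_combination:
  fixes u :: "nat \<Rightarrow> nat \<Rightarrow> 'e::finite_dim_inner \<Rightarrow> 'v::finite_dim_inner"
  assumes sub: "\<And>a. cball (z a) (r a) \<subseteq> \<Omega> a"
    and sm: "\<And>i a. smooth_on (\<Omega> a) (u i a)"
  obtains idx :: "nat \<Rightarrow> nat" and t :: "nat \<Rightarrow> nat \<Rightarrow> real" and N :: nat where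
    "\<And>a j x. x \<in> cball (z a) (r a) \<Longrightarrow> summable (\<lambda>n. t n j *\<^sub>R u (idx n) a x)"
    "\<And>a j. smooth_on (ball (z a) (r a)) (\<lambda>x. \<Sum>n. t n j *\<^sub>R u (idx n) a x)"
    "\<And>a x w i. x \<in> cball (z a) (r a) \<Longrightarrow> w \<bullet> u i a x \<noteq> 0 \<Longrightarrow>
      \<exists>j<N. w \<bullet> (\<Sum>n. t n j *\<^sub>R u (idx n) a x) \<noteq> 0"
proof -
  let ?K = "\<lambda>a. cball (z a) (r a)"
  have "\<forall>i a k. \<exists>c. Ck_bound k (?K a) (u i a) c"
    using Ck_bound_exists[OF compact_cball sub] sm unfolding smooth_on_def by blast
  then obtain \<beta>0 where \<beta>0: "\<And>i a k. Ck_bound k (?K a) (u i a) (\<beta>0 i a k)"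
    by metis
  define \<beta> where "\<beta> i a k = \<bar>\<beta>0 i a k\<bar>" for i a k
  have \<beta>: "Ck_bound k (?K a) (u i a) (\<beta> i a k)" for i a k
    by (rule Ck_bound_mono[OF \<beta>0]) (simp_all add: \<beta>_def)
  have \<beta>nn: "0 \<le> \<beta> i a k" for i a k
    by (simp add: \<beta>_def)
  have "\<forall>i a. \<exists>B L. (\<forall>x\<in>?K a. norm (u i a x) \<le> B) \<and>
      (\<forall>x\<in>?K a. \<forall>y\<in>?K a. norm (u i a x - u i a y) \<le> L * norm (x - y))"
    using smooth_on_cball_bounds[OF sub sm] by (intro allI)
  then obtain B0 L0 where B0: "\<And>i a x. x \<in> ?K a \<Longrightarrow> norm (u i a x) \<le> B0 i a"
    and L0: "\<And>i a x y. x \<in> ?K a \<Longrightarrow> y \<in> ?K a \<Longrightarrow> norm (u i a x - u i a y) \<le> L0 i a * norm (x - y)"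
    by metis
  \<comment> \<open>Nested pairing enumerates the triples: section \<open>idx n\<close>, chart
    \<open>ch n\<close>, level \<open>lev n\<close>.\<close>
  define idx where "idx n = fst (prod_decode n)" for n
  define ch where "ch n = fst (prod_decode (snd (prod_decode n)))" for n
  define lev where "lev n = snd (prod_decode (snd (prod_decode n)))" for n
  define F where "F n i = (\<lambda>(x, w). w \<bullet> u (idx i) (ch n) x)" for n i
  define c where "c n = 1 / real (Suc (lev n))" for n
  \<comment> \<open>On piece \<open>n\<close> it is the term added at step \<open>n\<close> that has
    the lower bound, as the single step needs. Its pairs have \<open>dim 'e + dim 'v\<close>
    parameters, whence the number of equations.\<close>
  define X where "X n = {p \<in> ?K (ch n) \<times> cball 0 1. c n \<le> \<bar>F n n p\<bar>}" for n
  \<comment> \<open>A diagonal choice: \<open>\<epsilon> n\<close> beats the bounds for all charts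
    and orders up to \<open>n\<close>. For each fixed chart \<open>a\<close> and order
    \<open>k\<close> the series is thus dominated by \<open>(1 / 2) ^ n\<close> from
    \<open>n = max a k\<close> on, which gives smoothness in every chart.\<close>
  define \<epsilon> where "\<epsilon> n = (1 / 2) ^ n / (1 + (\<Sum>a\<le>n. \<Sum>k\<le>n. \<beta> (idx n) a k))" for n
  have den: "0 < 1 + (\<Sum>a\<le>n. \<Sum>k\<le>n. \<beta> (idx n) a k)" for n
    using \<beta>nn by (intro add_pos_nonneg sum_nonneg) auto
  have \<epsilon>: "\<epsilon> n > 0" for n
    unfolding \<epsilon>_def using den by simp
  have bounded: "bounded (X n)" for n
    by (rule bounded_subset[OF bounded_Times[OF bounded_cball bounded_cball]]) (auto simp: X_def)
  have Lip: "\<bar>F n i p - F n i q\<bar> \<le> (\<bar>L0 (idx i) (ch n)\<bar> + \<bar>B0 (idx i) (ch n)\<bar>) * norm (p - q)"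
    if "p \<in> X n" "q \<in> X n" for n i p q
  proof -
    obtain x w x' w' where pq: "p = (x, w)" "q = (x', w')"
      by fastforce
    let ?u = "u (idx i) (ch n)"
    have mem: "x \<in> ?K (ch n)" "norm w \<le> 1" "x' \<in> ?K (ch n)"
      using that unfolding X_def pq by auto
    have nx: "norm (x - x') \<le> norm (p - q)" and nw: "norm (w - w') \<le> norm (p - q)"
      using norm_fst_le[of "x - x'" "w - w'"] norm_snd_le[of "w - w'" "x - x'"] by (simp_all add: pq)
    have "F n i p - F n i q = w \<bullet> (?u x - ?u x') + (w - w') \<bullet> ?u x'"
      by (simp add: F_def pq inner_diff_left inner_diff_right)
    then have "\<bar>F n i p - F n i q\<bar> \<le> \<bar>w \<bullet> (?u x - ?u x')\<bar> + \<bar>(w - w') \<bullet> ?u x'\<bar>"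
      by linarith
    also have "\<bar>w \<bullet> (?u x - ?u x')\<bar> \<le> norm w * norm (?u x - ?u x')"
      by (rule Cauchy_Schwarz_ineq2)
    also have "\<dots> \<le> 1 * (\<bar>L0 (idx i) (ch n)\<bar> * norm (p - q))"
    proof (intro mult_mono)
      have "L0 (idx i) (ch n) * norm (x - x') \<le> \<bar>L0 (idx i) (ch n)\<bar> * norm (p - q)"
        using nx by (intro mult_mono) auto
      then show "norm (?u x - ?u x') \<le> \<bar>L0 (idx i) (ch n)\<bar> * norm (p - q)"
        using L0[OF mem(1,3), of "idx i"] by linarith
    qed (use mem in auto)
    also have "\<bar>(w - w') \<bullet> ?u x'\<bar> \<le> norm (w - w') * norm (?u x')"
      by (rule Cauchy_Schwarz_ineq2)
    also have "\<dots> \<le> norm (p - q) * \<bar>B0 (idx i) (ch n)\<bar>"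
      using nw order_trans[OF B0[OF mem(3), of "idx i"] abs_ge_self] by (intro mult_mono) auto
    finally show ?thesis
      by (simp add: algebra_simps)
  qed
  have bnd: "\<bar>F n i p\<bar> \<le> \<bar>B0 (idx i) (ch n)\<bar>" if "p \<in> X n" for n i p
  proof -
    obtain x w where p: "p = (x, w)"
      by fastforce
    have mem: "x \<in> ?K (ch n)" "norm w \<le> 1"
      using that unfolding X_def p by auto
    have "\<bar>F n i p\<bar> \<le> norm w * norm (u (idx i) (ch n) x)"
      unfolding F_def p by (simp add: Cauchy_Schwarz_ineq2)
    also have "\<dots> \<le> 1 * \<bar>B0 (idx i) (ch n)\<bar>"
      using mem(2) order_trans[OF B0[OF mem(1), of "idx i"] abs_ge_self] by (intro mult_mono) auto
    finally show ?thesis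
      by simp
  qed
  have cpos: "c n > 0" for n
    by (simp add: c_def)
  have lower: "c n \<le> \<bar>F n n p\<bar>" if "p \<in> X n" for n p
    using that by (simp add: X_def)
  obtain t :: "nat \<Rightarrow> nat \<Rightarrow> real" where t0: "\<And>n j. 0 \<le> t n j" and t\<epsilon>: "\<And>n j. t n j \<le> \<epsilon> n"
    and nz: "\<And>n p. p \<in> X n \<Longrightarrow> \<exists>j<Suc (card (frame :: ('e \<times> 'v) set)).
        \<forall>s. (\<lambda>i. t i j * F n i p) sums s \<longrightarrow> s \<noteq> 0"
    by (rule generic_coefficients[of X F "\<lambda>n i. \<bar>L0 (idx i) (ch n)\<bar> + \<bar>B0 (idx i) (ch n)\<bar>"
          "\<lambda>n i. \<bar>B0 (idx i) (ch n)\<bar>" c \<epsilon>, OF bounded Lip bnd cpos lower \<epsilon>]) (assumption | rule that)+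
  have summable_t: "summable (\<lambda>n. \<bar>t n j\<bar> * \<beta> (idx n) a k)" for j a k
  proof (rule summable_comparison_test)
    show "summable (\<lambda>n. (1 / 2 :: real) ^ n)"
      by (simp add: summable_geometric)
    have "norm (\<bar>t n j\<bar> * \<beta> (idx n) a k) \<le> (1 / 2) ^ n" if "n \<ge> max a k" for n
    proof -
      have "\<beta> (idx n) a k \<le> (\<Sum>k\<le>n. \<beta> (idx n) a k)"
        using that \<beta>nn by (intro member_le_sum) auto
      also have "\<dots> \<le> (\<Sum>a\<le>n. \<Sum>k\<le>n. \<beta> (idx n) a k)"
        using that \<beta>nn by (intro member_le_sum[of a "{..n}" "\<lambda>a. \<Sum>k\<le>n. \<beta> (idx n) a k"] sum_nonneg) auto
      finally have "\<beta> (idx n) a k \<le> 1 + (\<Sum>a\<le>n. \<Sum>k\<le>n. \<beta> (idx n) a k)"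
        by simp
      then have "\<bar>t n j\<bar> * \<beta> (idx n) a k \<le> \<epsilon> n * (1 + (\<Sum>a\<le>n. \<Sum>k\<le>n. \<beta> (idx n) a k))"
        using t0[of n j] t\<epsilon>[of n j] \<beta>nn \<epsilon>[of n] by (intro mult_mono) auto
      also have "\<dots> = (1 / 2) ^ n"
        unfolding \<epsilon>_def using den[of n] by simp
      finally show ?thesis
        using \<beta>nn by simp
    qed
    then show "\<exists>N. \<forall>n\<ge>N. norm (\<bar>t n j\<bar> * \<beta> (idx n) a k) \<le> (1 / 2) ^ n"
      by blast
  qed
  have summable: "summable (\<lambda>n. t n j *\<^sub>R u (idx n) a x)" if "x \<in> ?K a" for a j x
  proof (rule summable_comparison_test[OF _ summable_t[of j a 0]])
    have "norm (t n j *\<^sub>R u (idx n) a x) \<le> \<bar>t n j\<bar> * \<beta> (idx n) a 0" for n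
      using Ck_bound_norm[OF \<beta> that] by (simp add: mult_left_mono)
    then show "\<exists>N. \<forall>n\<ge>N. norm (t n j *\<^sub>R u (idx n) a x) \<le> \<bar>t n j\<bar> * \<beta> (idx n) a 0"
      by blast
  qed
  have smooth: "smooth_on (ball (z a) (r a)) (\<lambda>x. \<Sum>n. t n j *\<^sub>R u (idx n) a x)" for a j
    unfolding smooth_on_def
  proof
    fix k
    have Ck: "Ck_on k (ball (z a) (r a)) (u i a)" for i
      using sm[of a i] sub[of a] ball_subset_cball[of "z a" "r a"] Ck_on_subset
      unfolding smooth_on_def by blast
    show "Ck_on k (ball (z a) (r a)) (\<lambda>x. \<Sum>n. t n j *\<^sub>R u (idx n) a x)"
    proof (rule Ck_on_suminf[OF open_ball convex_ball _ _ summable_t[of j a k]])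
      show "Ck_on k (ball (z a) (r a)) (\<lambda>x. t n j *\<^sub>R u (idx n) a x)" for n
        by (intro Ck_on_scaleR open_ball Ck_on_const Ck)
      show "Ck_bound k (ball (z a) (r a)) (\<lambda>x. t n j *\<^sub>R u (idx n) a x) (\<bar>t n j\<bar> * \<beta> (idx n) a k)" for n
        by (intro Ck_bound_scaleR open_ball Ck Ck_bound_mono[OF \<beta> ball_subset_cball order_refl])
    qed
  qed
  have generic: "\<exists>j<Suc (card (frame :: ('e \<times> 'v) set)). w \<bullet> (\<Sum>n. t n j *\<^sub>R u (idx n) a x) \<noteq> 0"
    if x: "x \<in> ?K a" and w: "w \<bullet> u i a x \<noteq> 0" for a x w i
  proof -
    have "w \<noteq> 0"
      using w by auto
    \<comment> \<open>Nonvanishing is unaffected by scaling, so \<open>w\<close> may be moved into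
      the unit ball on which the pieces live.\<close>
    define w' where "w' = w /\<^sub>R norm w"
    have w': "w' \<bullet> u i a x \<noteq> 0" "norm w' = 1"
      using w \<open>w \<noteq> 0\<close> by (simp_all add: w'_def)
    obtain m where m: "inverse (real (Suc m)) < \<bar>w' \<bullet> u i a x\<bar>"
      using reals_Archimedean[of "\<bar>w' \<bullet> u i a x\<bar>"] w'(1) by auto
    define n where "n = prod_encode (i, prod_encode (a, m))"
    have n: "idx n = i" "ch n = a" "lev n = m"
      by (simp_all add: n_def idx_def ch_def lev_def)
    have mem: "(x, w') \<in> X n"
      using x w'(2) m unfolding X_def by (simp add: n F_def c_def inverse_eq_divide)
    obtain j where j: "j < Suc (card (frame :: ('e \<times> 'v) set))"
      "\<forall>s. (\<lambda>i. t i j * F n i (x, w')) sums s \<longrightarrow> s \<noteq> 0"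
      using nz[OF mem] by (elim exE conjE) (rule that)
    have "(\<lambda>i. w' \<bullet> (t i j *\<^sub>R u (idx i) a x)) sums (w' \<bullet> (\<Sum>n. t n j *\<^sub>R u (idx n) a x))"
      by (rule bounded_linear.sums[OF bounded_linear_inner_right summable_sums[OF summable[OF x]]])
    then have "w' \<bullet> (\<Sum>n. t n j *\<^sub>R u (idx n) a x) \<noteq> 0"
      by (intro j(2)[rule_format]) (simp add: F_def n)
    then have "w \<bullet> (\<Sum>n. t n j *\<^sub>R u (idx n) a x) \<noteq> 0"
      by (simp add: w'_def)
    then show ?thesis
      using j(1) by blast
  qed
  show ?thesis
    by (rule that[OF summable smooth generic])
qed

section \<open>Smooth functions on manifolds\<close>

lemma is_chart_openin: "is_chart X U \<phi> \<Longrightarrow> openin X U"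
  by (simp add: is_chart_def)

lemma is_chart_topspace: "is_chart X U \<phi> \<Longrightarrow> topspace (subtopology X U) = U"
  using openin_subset[of X U] by (auto simp: is_chart_def)

lemma is_chart_inj_on:
  assumes "is_chart X U \<phi>"
  shows "inj_on \<phi> U"
  using homeomorphic_imp_injective_map[of "subtopology X U" "top_of_set (\<phi> ` U)" \<phi>] assms
  by (simp only: is_chart_topspace[OF assms]) (simp add: is_chart_def)

lemma is_chart_inv: "is_chart X U \<phi> \<Longrightarrow> p \<in> U \<Longrightarrow> inv_into U \<phi> (\<phi> p) = p"
  by (simp add: is_chart_inj_on)

text \<open>\<open>open_submanifold\<close> shrinks the domain of a chart but keeps its map, so
  inverses over the smaller domain occur too.\<close>

lemma is_chart_inv_Int: "is_chart X U \<phi> \<Longrightarrow> p \<in> U \<inter> W \<Longrightarrow> inv_into (U \<inter> W) \<phi> (\<phi> p) = p"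
  by (rule inv_into_f_f) (auto intro: inj_on_subset is_chart_inj_on)

lemma is_chart_open_image:
  assumes "is_chart X U \<phi>" "openin X W" "W \<subseteq> U"
  shows "open (\<phi> ` W)"
proof -
  have "open_map (subtopology X U) (top_of_set (\<phi> ` U)) \<phi>"
    using assms(1) by (simp add: is_chart_def homeomorphic_imp_open_map)
  moreover have "openin (subtopology X U) W"
    using assms(2,3) by (simp add: openin_subset_topspace_eq subset_openin_subtopology)
  ultimately have "openin (top_of_set (\<phi> ` U)) (\<phi> ` W)"
    by (simp add: open_map_def)
  then show ?thesis
    using assms(1) openin_open_trans by (auto simp: is_chart_def)
qed

lemma is_chart_continuous_map:
  "is_chart X U \<phi> \<Longrightarrow> continuous_map (subtopology X U) euclidean \<phi>"
  unfolding is_chart_def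
  using continuous_map_in_subtopology homeomorphic_imp_continuous_map by blast

lemma is_chart_openin_preimage:
  assumes "is_chart X U \<phi>" "open T"
  shows "openin X {p \<in> U. \<phi> p \<in> T}"
proof -
  have "openin (subtopology X U) {p \<in> topspace (subtopology X U). \<phi> p \<in> T}"
    using is_chart_continuous_map[OF assms(1)] assms(2) by (intro openin_continuous_map_preimage) auto
  then have "openin (subtopology X U) {p \<in> U. \<phi> p \<in> T}"
    unfolding is_chart_topspace[OF assms(1)] .
  then show ?thesis
    using is_chart_openin[OF assms(1)] by (rule openin_trans_full)
qed

lemma atlas_is_chart: "smooth_manifold M \<Longrightarrow> (U, \<phi>) \<in> atlas M \<Longrightarrow> is_chart (mtop M) U \<phi>"
  by (auto simp: smooth_manifold_def)

lemma atlas_covers: "smooth_manifold M \<Longrightarrow> p \<in> points M \<Longrightarrow> \<exists>U \<phi>. (U, \<phi>) \<in> atlas M \<and> p \<in> U"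
  unfolding smooth_manifold_def by blast

lemma atlas_transition:
  assumes "smooth_manifold M" "(U, \<phi>) \<in> atlas M" "(V, \<psi>) \<in> atlas M"
  shows "smooth_on (\<phi> ` (U \<inter> V)) (\<psi> \<circ> inv_into U \<phi>)"
proof -
  have "\<forall>(U, \<phi>)\<in>atlas M. \<forall>(V, \<psi>)\<in>atlas M. smooth_on (\<phi> ` (U \<inter> V)) (\<psi> \<circ> inv_into U \<phi>)"
    using assms(1) unfolding smooth_manifold_def by (elim conjE)
  from bspec[OF this assms(2)] show ?thesis
    using assms(3) by auto
qed

lemma continuous_map_local:
  assumes "\<And>p. p \<in> topspace X \<Longrightarrow> \<exists>W. openin X W \<and> p \<in> W \<and> continuous_map (subtopology X W) Y f"
  shows "continuous_map X Y f"
  unfolding continuous_map_def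
proof (intro conjI allI impI)
  show "f \<in> topspace X \<rightarrow> topspace Y"
  proof
    fix p assume p: "p \<in> topspace X"
    then obtain W where "p \<in> W" "continuous_map (subtopology X W) Y f"
      using assms by blast
    then show "f p \<in> topspace Y"
      using p by (auto simp: continuous_map_def)
  qed
  fix V assume V: "openin Y V"
  show "openin X {x \<in> topspace X. f x \<in> V}"
  proof (subst openin_subopen, rule ballI)
    fix p assume "p \<in> {x \<in> topspace X. f x \<in> V}"
    then have p: "p \<in> topspace X" "f p \<in> V"
      by auto
    obtain W where W: "openin X W" "p \<in> W" "continuous_map (subtopology X W) Y f"
      using assms[OF p(1)] by blast
    have "openin (subtopology X W) {x \<in> topspace (subtopology X W). f x \<in> V}"
      using W(3) V by (rule openin_continuous_map_preimage)
    then have "openin X {x \<in> topspace (subtopology X W). f x \<in> V}"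
      using W(1) by (rule openin_trans_full)
    then show "\<exists>T. openin X T \<and> p \<in> T \<and> T \<subseteq> {x \<in> topspace X. f x \<in> V}"
      using p W(2) by (intro exI[of _ "{x \<in> topspace (subtopology X W). f x \<in> V}"]) auto
  qed
qed

text \<open>Smoothness for maps into a normed space, stated in the charts of \<open>M\<close>
  itself, so that the target need not be made a manifold in order to use
  \<open>smooth_map\<close>.\<close>

definition smooth_fun :: "('m, 'e::finite_dim_inner) mfd \<Rightarrow> 'm set \<Rightarrow> ('m \<Rightarrow> 'f::real_normed_vector) \<Rightarrow> bool" where
  "smooth_fun M W u \<longleftrightarrow> (\<forall>(U, \<phi>)\<in>atlas M. smooth_on (\<phi> ` (U \<inter> W)) (\<lambda>x. u (inv_into U \<phi> x)))"

lemma smooth_funI: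
  "(\<And>U \<phi>. (U, \<phi>) \<in> atlas M \<Longrightarrow> smooth_on (\<phi> ` (U \<inter> W)) (\<lambda>x. u (inv_into U \<phi> x))) \<Longrightarrow>
    smooth_fun M W u"
  by (auto simp: smooth_fun_def)

lemma smooth_funD:
  "smooth_fun M W u \<Longrightarrow> (U, \<phi>) \<in> atlas M \<Longrightarrow> smooth_on (\<phi> ` (U \<inter> W)) (\<lambda>x. u (inv_into U \<phi> x))"
  by (auto simp: smooth_fun_def)

lemma smooth_fun_subset: "smooth_fun M W u \<Longrightarrow> V \<subseteq> W \<Longrightarrow> smooth_fun M V u"
  by (rule smooth_funI) (auto intro: smooth_on_subset[OF smooth_funD])

lemma open_chart_image:
  assumes "smooth_manifold M" "(U, \<phi>) \<in> atlas M" "openin (mtop M) W"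
  shows "open (\<phi> ` (U \<inter> W))"
  using atlas_is_chart[OF assms(1,2)] assms(3)
  by (intro is_chart_open_image) (auto intro: is_chart_openin)

lemma smooth_fun_cong:
  assumes M: "smooth_manifold M" and W: "openin (mtop M) W"
    and eq: "\<And>q. q \<in> W \<Longrightarrow> u q = v q" and u: "smooth_fun M W u"
  shows "smooth_fun M W v"
proof (rule smooth_funI)
  fix U \<phi> assume at: "(U, \<phi>) \<in> atlas M"
  show "smooth_on (\<phi> ` (U \<inter> W)) (\<lambda>x. v (inv_into U \<phi> x))"
    using smooth_funD[OF u at] by (rule smooth_on_cong[OF open_chart_image[OF M at W], rotated])
      (auto simp: is_chart_inv[OF atlas_is_chart[OF M at]] eq)
qed

lemma smooth_fun_const: "smooth_fun M W (\<lambda>q. c)"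
  by (rule smooth_funI) (rule smooth_on_const)

lemma smooth_fun_scaleR:
  assumes "smooth_manifold M" "openin (mtop M) W" "smooth_fun M W h" "smooth_fun M W u"
  shows "smooth_fun M W (\<lambda>q. h q *\<^sub>R u q)"
proof (rule smooth_funI)
  fix U \<phi> assume at: "(U, \<phi>) \<in> atlas M"
  show "smooth_on (\<phi> ` (U \<inter> W)) (\<lambda>x. h (inv_into U \<phi> x) *\<^sub>R u (inv_into U \<phi> x))"
    by (rule smooth_on_scaleR[OF open_chart_image[OF assms(1) at assms(2)]
          smooth_funD[OF assms(3) at] smooth_funD[OF assms(4) at]])
qed

text \<open>Transition maps carry smoothness in the single chart \<open>\<phi>\<close> over to all
  charts of the atlas.\<close>

lemma smooth_fun_chart:
  fixes M :: "('m, 'e::finite_dim_inner) mfd"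
  assumes M: "smooth_manifold M" and at: "(C, \<phi>) \<in> atlas M" and H: "smooth_on T H"
    and W: "W \<subseteq> C" "\<phi> ` W \<subseteq> T" "openin (mtop M) W"
  shows "smooth_fun M W (\<lambda>q. H (\<phi> q))"
proof (rule smooth_funI)
  fix U \<psi> assume at': "(U, \<psi>) \<in> atlas M"
  have "smooth_on (\<psi> ` (U \<inter> C)) (\<phi> \<circ> inv_into U \<psi>)"
    by (rule atlas_transition[OF M at' at])
  then have "smooth_on (\<psi> ` (U \<inter> W)) (\<phi> \<circ> inv_into U \<psi>)"
    by (rule smooth_on_subset) (use W(1) in blast)
  moreover have "(\<phi> \<circ> inv_into U \<psi>) ` \<psi> ` (U \<inter> W) \<subseteq> T"
    using W(2) by (auto simp: is_chart_inv[OF atlas_is_chart[OF M at']])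
  ultimately have "smooth_on (\<psi> ` (U \<inter> W)) (\<lambda>x. H ((\<phi> \<circ> inv_into U \<psi>) x))"
    by (rule smooth_on_compose[OF open_chart_image[OF M at' W(3)] H])
  then show "smooth_on (\<psi> ` (U \<inter> W)) (\<lambda>x. H (\<phi> (inv_into U \<psi> x)))"
    by simp
qed

lemma smooth_fun_imp_continuous_map:
  assumes M: "smooth_manifold M" and W: "openin (mtop M) W" and u: "smooth_fun M W u"
  shows "continuous_map (subtopology (mtop M) W) euclidean u"
proof (rule continuous_map_local)
  fix p assume "p \<in> topspace (subtopology (mtop M) W)"
  then have p: "p \<in> points M" "p \<in> W"
    by auto
  obtain U \<phi> where at: "(U, \<phi>) \<in> atlas M" "p \<in> U"
    using atlas_covers[OF M p(1)] by blast
  note ch = atlas_is_chart[OF M at(1)]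
  have "continuous_on (\<phi> ` (U \<inter> W)) (u \<circ> inv_into U \<phi>)"
    unfolding o_def by (rule smooth_on_imp_continuous_on[OF smooth_funD[OF u at(1)]])
  then have "continuous_map (top_of_set (\<phi> ` (U \<inter> W))) euclidean (u \<circ> inv_into U \<phi>)"
    by simp
  moreover have "continuous_map (subtopology (mtop M) (U \<inter> W)) (top_of_set (\<phi> ` (U \<inter> W))) \<phi>"
    using continuous_map_from_subtopology[OF is_chart_continuous_map[OF ch], of W]
    by (auto simp: continuous_map_in_subtopology subtopology_subtopology)
  ultimately have "continuous_map (subtopology (mtop M) (U \<inter> W)) euclidean ((u \<circ> inv_into U \<phi>) \<circ> \<phi>)"
    by (rule continuous_map_compose[rotated])
  then have "continuous_map (subtopology (mtop M) (U \<inter> W)) euclidean u"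
    by (rule continuous_map_eq) (simp add: is_chart_inv[OF ch])
  then have "continuous_map (subtopology (subtopology (mtop M) W) (U \<inter> W)) euclidean u"
    by (simp add: subtopology_subtopology inf_commute inf_left_commute)
  moreover have "openin (subtopology (mtop M) W) (U \<inter> W)"
    using is_chart_openin[OF ch] by (auto simp: openin_subtopology)
  ultimately show "\<exists>V. openin (subtopology (mtop M) W) V \<and> p \<in> V \<and>
      continuous_map (subtopology (subtopology (mtop M) W) V) euclidean u"
    using p at(2) by blast
qed

section \<open>Sections in local trivializations\<close>

lemma bundle_manifolds:
  "smooth_vector_bundle M E \<Longrightarrow> smooth_manifold M"
  "smooth_vector_bundle M E \<Longrightarrow> smooth_manifold (total E)"
  by (auto simp: smooth_vector_bundle_def)

lemma bundle_trivialization: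
  assumes "smooth_vector_bundle M E" "p \<in> points M"
  obtains U \<Phi> where "p \<in> U" "local_trivialization M E U \<Phi>"
  using assms unfolding smooth_vector_bundle_def by meson

lemma local_trivializationE:
  fixes M :: "('m, 'e::finite_dim_inner) mfd" and E :: "('m, 't, 'e, 'v::finite_dim_inner) vbundle"
  assumes "local_trivialization M E U \<Phi>"
  obtains g where
    "openin (mtop M) U"
    "smooth_map (open_submanifold (total E) (bundle_over E U)) (times_model (open_submanifold M U)) \<Phi>"
    "smooth_map (times_model (open_submanifold M U)) (open_submanifold (total E) (bundle_over E U)) g"
    "\<And>x. x \<in> bundle_over E U \<Longrightarrow> g (\<Phi> x) = x"
    "\<And>q v. q \<in> U \<Longrightarrow> \<Phi> (g (q, v)) = (q, v)"
    "\<And>q v. q \<in> U \<Longrightarrow> g (q, v) \<in> bundle_over E U"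
proof -
  have U: "openin (mtop M) U"
    and d: "diffeomorphism (open_submanifold (total E) (bundle_over E U)) (times_model (open_submanifold M U)) \<Phi>"
    using assms unfolding local_trivialization_def by blast+
  have sub: "U \<subseteq> points M"
    using U by (rule openin_subset)
  have pts: "points (open_submanifold (total E) (bundle_over E U)) = bundle_over E U"
    "points (times_model (open_submanifold M U) :: ('m \<times> 'v, 'e \<times> 'v) mfd) = U \<times> UNIV"
    using sub by (auto simp: open_submanifold_def times_model_def bundle_over_def)
  obtain g where g: "smooth_map (times_model (open_submanifold M U)) (open_submanifold (total E) (bundle_over E U)) g"
    and gi: "\<forall>x\<in>bundle_over E U. g (\<Phi> x) = x" "\<forall>y\<in>U \<times> UNIV. \<Phi> (g y) = y"
    using d unfolding diffeomorphism_def pts by blast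
  have cont: "continuous_map (mtop (times_model (open_submanifold M U) :: ('m \<times> 'v, 'e \<times> 'v) mfd))
      (mtop (open_submanifold (total E) (bundle_over E U))) g"
    using g unfolding smooth_map_def by blast
  have "g y \<in> bundle_over E U" if "y \<in> U \<times> UNIV" for y
    using continuous_map_image_subset_topspace[OF cont] that unfolding pts by blast
  then show ?thesis
    using that[OF U _ g] d gi unfolding diffeomorphism_def by auto
qed

lemma local_trivialization_openin: "local_trivialization M E U \<Phi> \<Longrightarrow> openin (mtop M) U"
  by (simp add: local_trivialization_def)

lemma trivialization_fst: "local_trivialization M E U \<Phi> \<Longrightarrow> p \<in> U \<Longrightarrow> x \<in> fibre E p \<Longrightarrow> fst (\<Phi> x) = p"
  by (auto simp: local_trivialization_def bundle_over_def)

lemma trivialization_vadd: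
  "local_trivialization M E U \<Phi> \<Longrightarrow> p \<in> U \<Longrightarrow> x \<in> fibre E p \<Longrightarrow> y \<in> fibre E p \<Longrightarrow>
    snd (\<Phi> (vadd E x y)) = snd (\<Phi> x) + snd (\<Phi> y)"
  unfolding local_trivialization_def by blast

lemma trivialization_vscale:
  "local_trivialization M E U \<Phi> \<Longrightarrow> p \<in> U \<Longrightarrow> x \<in> fibre E p \<Longrightarrow>
    snd (\<Phi> (vscale E c x)) = c *\<^sub>R snd (\<Phi> x)"
  unfolding local_trivialization_def by blast

text \<open>Together with \<open>trivialization_vadd\<close> and
  \<open>trivialization_vscale\<close> this is a linear isomorphism, so linear algebra in the fibres
  can be done in \<open>'v\<close>.\<close>

lemma trivialization_bij_betw:
  assumes triv: "local_trivialization M E U \<Phi>" and p: "p \<in> U"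
  shows "bij_betw (\<lambda>x. snd (\<Phi> x)) (fibre E p) UNIV"
proof -
  obtain g where g: "\<And>x. x \<in> bundle_over E U \<Longrightarrow> g (\<Phi> x) = x"
    "\<And>q v. q \<in> U \<Longrightarrow> \<Phi> (g (q, v)) = (q, v)" "\<And>q v. q \<in> U \<Longrightarrow> g (q, v) \<in> bundle_over E U"
    by (rule local_trivializationE[OF triv]) (rule that)
  show ?thesis
  proof (rule bij_betwI[where g = "\<lambda>v. g (p, v)"])
    show "(\<lambda>v. g (p, v)) \<in> UNIV \<rightarrow> fibre E p"
    proof
      fix v
      have b: "g (p, v) \<in> bundle_over E U"
        using g(3)[OF p] .
      then have "proj E (g (p, v)) = fst (\<Phi> (g (p, v)))"
        using triv by (simp add: local_trivialization_def)
      then show "g (p, v) \<in> fibre E p"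
        using b g(2)[OF p] by (simp add: bundle_over_def)
    qed
    show "g (p, snd (\<Phi> x)) = x" if "x \<in> fibre E p" for x
    proof -
      have "\<Phi> x = (p, snd (\<Phi> x))"
        using trivialization_fst[OF triv p that] by (simp add: prod_eq_iff)
      moreover have "x \<in> bundle_over E U"
        using that p by (auto simp: bundle_over_def)
      ultimately show ?thesis
        using g(1) by metis
    qed
  qed (use g(2)[OF p] in auto)
qed

lemma fibre_vector_space:
  "smooth_vector_bundle M E \<Longrightarrow> p \<in> points M \<Longrightarrow>
    real_vector_space_on (fibre E p) (vadd E) (vscale E) (vzero E p)"
  by (simp add: smooth_vector_bundle_def)

lemma fibre_closed:
  assumes "smooth_vector_bundle M E" "p \<in> points M"
  shows "vzero E p \<in> fibre E p"
    and "x \<in> fibre E p \<Longrightarrow> y \<in> fibre E p \<Longrightarrow> vadd E x y \<in> fibre E p"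
    and "x \<in> fibre E p \<Longrightarrow> vscale E c x \<in> fibre E p"
  using fibre_vector_space[OF assms] unfolding real_vector_space_on_def by simp_all

lemma trivialization_vzero:
  assumes E: "smooth_vector_bundle M E" and triv: "local_trivialization M E U \<Phi>" and p: "p \<in> U"
  shows "snd (\<Phi> (vzero E p)) = 0"
proof -
  have pM: "p \<in> points M"
    using openin_subset[OF local_trivialization_openin[OF triv]] p by blast
  note z = fibre_closed(1)[OF E pM]
  have "vadd E (vzero E p) (vzero E p) = vzero E p"
    using fibre_vector_space[OF E pM] z unfolding real_vector_space_on_def by blast
  then have "snd (\<Phi> (vzero E p)) = snd (\<Phi> (vzero E p)) + snd (\<Phi> (vzero E p))"
    using trivialization_vadd[OF triv p z z] by simp
  then show ?thesis
    by simp
qed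

lemma trivialization_inj:
  assumes "local_trivialization M E U \<Phi>" "p \<in> U" "x \<in> fibre E p" "y \<in> fibre E p" "snd (\<Phi> x) = snd (\<Phi> y)"
  shows "x = y"
  using bij_betw_imp_inj_on[OF trivialization_bij_betw[OF assms(1,2)]] assms(3-5) by (auto dest: inj_onD)

lemma vscale_0:
  assumes E: "smooth_vector_bundle M E" and p: "p \<in> points M" and x: "x \<in> fibre E p"
  shows "vscale E 0 x = vzero E p"
proof -
  obtain U \<Phi> where t: "p \<in> U" "local_trivialization M E U \<Phi>"
    by (rule bundle_trivialization[OF E p])
  show ?thesis
    by (rule trivialization_inj[OF t(2,1)])
      (simp_all add: fibre_closed[OF E p] x trivialization_vscale[OF t(2,1)] trivialization_vzero[OF E t(2,1)])
qed

lemma smooth_section_fibre: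
  assumes "smooth_section M E W s" "p \<in> W"
  shows "s p \<in> fibre E p"
proof -
  have "continuous_map (subtopology (mtop M) W) (mtop (total E)) s" "openin (mtop M) W"
    using assms(1) by (auto simp: smooth_section_def smooth_map_def open_submanifold_def)
  then have "s p \<in> points (total E)"
    using assms(2) openin_subset by (fastforce simp: continuous_map_def)
  then show ?thesis
    using assms by (simp add: bundle_over_def smooth_section_def)
qed

text \<open>Near each point the fibre coordinate is \<open>s\<close> followed by the trivialization,
  composed through coordinates \<open>\<psi>\<close> of the total space around \<open>s p\<close>,
  in which both are smooth.\<close>

lemma smooth_section_local_rep:
  fixes M :: "('m, 'e::finite_dim_inner) mfd" and E :: "('m, 't, 'e, 'v::finite_dim_inner) vbundle"
  assumes E: "smooth_vector_bundle M E" and s: "smooth_section M E W s"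
    and triv: "local_trivialization M E U \<Phi>"
  shows "smooth_fun M (W \<inter> U) (\<lambda>q. snd (\<Phi> (s q)))"
proof (rule smooth_funI)
  fix C \<phi> assume at: "(C, \<phi>) \<in> atlas M"
  note M = bundle_manifolds(1)[OF E] and TE = bundle_manifolds(2)[OF E]
  note ch = atlas_is_chart[OF M at]
  have W: "openin (mtop M) W" and sm: "smooth_map (open_submanifold M W) (total E) s"
    using s by (auto simp: smooth_section_def)
  have cont: "continuous_map (subtopology (mtop M) W) (mtop (total E)) s"
    using sm by (simp add: smooth_map_def open_submanifold_def)
  have U: "openin (mtop M) U"
    and \<Phi>: "smooth_map (open_submanifold (total E) (bundle_over E U)) (times_model (open_submanifold M U)) \<Phi>"
    using triv by (auto simp: local_trivialization_def diffeomorphism_def)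
  show "smooth_on (\<phi> ` (C \<inter> (W \<inter> U))) (\<lambda>x. snd (\<Phi> (s (inv_into C \<phi> x))))"
  proof (rule smooth_on_local)
    fix x assume "x \<in> \<phi> ` (C \<inter> (W \<inter> U))"
    then obtain p where p: "p \<in> C" "p \<in> W" "p \<in> U" "x = \<phi> p"
      by blast
    have "s p \<in> points (total E)"
      using smooth_section_fibre[OF s p(2)] by (simp add: bundle_over_def)
    then obtain V \<psi> where at': "(V, \<psi>) \<in> atlas (total E)" "s p \<in> V"
      using atlas_covers[OF TE] by blast
    note ch' = atlas_is_chart[OF TE at'(1)]
    let ?B = "bundle_over E U"
    \<comment> \<open>Small enough that \<open>s\<close> stays inside the one chart \<open>V\<close>
      of the total space.\<close>
    define Q where "Q = {q \<in> topspace (subtopology (mtop M) W). s q \<in> V} \<inter> (C \<inter> U)"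
    have Q: "openin (mtop M) Q"
      unfolding Q_def using openin_trans_full[OF openin_continuous_map_preimage[OF cont is_chart_openin[OF ch']] W]
        is_chart_openin[OF ch] U by (intro openin_Int)
    have QD: "q \<in> C" "q \<in> W" "q \<in> U" "s q \<in> V" "s q \<in> ?B" "\<Phi> (s q) = (q, snd (\<Phi> (s q)))" if "q \<in> Q" for q
    proof -
      show q: "q \<in> C" "q \<in> W" "q \<in> U" "s q \<in> V"
        using that by (auto simp: Q_def)
      have f: "s q \<in> fibre E q"
        by (rule smooth_section_fibre[OF s q(2)])
      then show "s q \<in> ?B"
        using q(3) by (auto simp: bundle_over_def)
      show "\<Phi> (s q) = (q, snd (\<Phi> (s q)))"
        using trivialization_fst[OF triv q(3) f] by (simp add: prod_eq_iff)
    qed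
    have pQ: "p \<in> Q"
      using p at'(2) openin_subset[OF W] by (auto simp: Q_def)
    have oQ: "open (\<phi> ` Q)"
      using is_chart_open_image[OF ch Q] QD(1) by blast
    let ?f = "map_prod \<phi> id \<circ> \<Phi> \<circ> inv_into (V \<inter> ?B) \<psi>" and ?g = "\<psi> \<circ> s \<circ> inv_into (C \<inter> W) \<phi>"
    have f: "smooth_on (\<psi> ` ((V \<inter> ?B) \<inter> \<Phi> -` ((C \<inter> U) \<times> UNIV))) ?f"
      using \<Phi> at at'(1) unfolding smooth_map_def open_submanifold_def times_model_def by fastforce
    have "smooth_on (\<phi> ` ((C \<inter> W) \<inter> s -` V)) ?g"
      using sm at at'(1) unfolding smooth_map_def open_submanifold_def by fastforce
    then have g: "smooth_on (\<phi> ` Q) ?g"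
      by (rule smooth_on_subset) (use QD in blast)
    have ginv: "?g (\<phi> q) = \<psi> (s q)" if "q \<in> Q" for q
      using is_chart_inv_Int[OF ch, of q W] QD(1,2)[OF that] by simp
    have "?g ` \<phi> ` Q \<subseteq> \<psi> ` ((V \<inter> ?B) \<inter> \<Phi> -` ((C \<inter> U) \<times> UNIV))"
    proof
      fix y assume "y \<in> ?g ` \<phi> ` Q"
      then obtain q where q: "q \<in> Q" and y: "y = ?g (\<phi> q)"
        by blast
      have "s q \<in> (V \<inter> ?B) \<inter> \<Phi> -` ((C \<inter> U) \<times> UNIV)"
        using QD[OF q] by (metis IntI SigmaI UNIV_I vimageI2)
      then show "y \<in> \<psi> ` ((V \<inter> ?B) \<inter> \<Phi> -` ((C \<inter> U) \<times> UNIV))"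
        unfolding y ginv[OF q] by (rule imageI)
    qed
    then have "smooth_on (\<phi> ` Q) (\<lambda>x. ?f (?g x))"
      by (rule smooth_on_compose[OF oQ f g])
    then have "smooth_on (\<phi> ` Q) (\<lambda>x. snd (?f (?g x)))"
      by (rule smooth_on_bounded_linear[OF oQ bounded_linear_snd])
    moreover have "snd (?f (?g x)) = snd (\<Phi> (s (inv_into C \<phi> x)))" if x: "x \<in> \<phi> ` Q" for x
    proof -
      obtain q where q: "q \<in> Q" "x = \<phi> q"
        using x by blast
      have "inv_into (V \<inter> ?B) \<psi> (\<psi> (s q)) = s q"
        using QD[OF q(1)] by (intro is_chart_inv_Int[OF ch']) blast
      then show ?thesis
        using ginv[OF q(1)] is_chart_inv[OF ch QD(1)[OF q(1)]] by (simp add: q(2))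
    qed
    ultimately have "smooth_on (\<phi> ` Q) (\<lambda>x. snd (\<Phi> (s (inv_into C \<phi> x))))"
      by (rule smooth_on_cong[OF oQ, rotated])
    then show "\<exists>T. open T \<and> x \<in> T \<and> smooth_on T (\<lambda>x. snd (\<Phi> (s (inv_into C \<phi> x))))"
      using oQ pQ p(4) by blast
  qed
qed

text \<open>The inverse \<open>g\<close> of a trivialization recovers \<open>s q\<close> from
  \<open>q\<close> and its fibre coordinate. As the trivialization may depend on the point, this
  serves as the gluing criterion for every section constructed below.\<close>

lemma smooth_section_if_local_rep:
  fixes M :: "('m, 'e::finite_dim_inner) mfd" and E :: "('m, 't, 'e, 'v::finite_dim_inner) vbundle"
  assumes E: "smooth_vector_bundle M E" and W: "openin (mtop M) W"
    and fib: "\<And>p. p \<in> W \<Longrightarrow> s p \<in> fibre E p"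
    and rep: "\<And>p. p \<in> W \<Longrightarrow> \<exists>U \<Phi> Q. p \<in> Q \<and> openin (mtop M) Q \<and> Q \<subseteq> U \<and> Q \<subseteq> W \<and>
        local_trivialization M E U \<Phi> \<and> smooth_fun M Q (\<lambda>q. snd (\<Phi> (s q)))"
  shows "smooth_section M E W s"
proof -
  note M = bundle_manifolds(1)[OF E] and TE = bundle_manifolds(2)[OF E]
  have WM: "W \<subseteq> points M"
    using W by (rule openin_subset)
  \<comment> \<open>Continuity has to come first: it makes the neighbourhood \<open>R\<close> used
    for smoothness open.\<close>
  have cont: "continuous_map (subtopology (mtop M) W) (mtop (total E)) s"
  proof (rule continuous_map_local)
    fix p assume "p \<in> topspace (subtopology (mtop M) W)"
    then have "p \<in> W" by simp
    from rep[OF this] obtain U \<Phi> Q where Q: "p \<in> Q" "openin (mtop M) Q" "Q \<subseteq> U" "Q \<subseteq> W"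
      "local_trivialization M E U \<Phi>" "smooth_fun M Q (\<lambda>q. snd (\<Phi> (s q)))"
      by (elim exE conjE) (rule that)
    obtain g where g: "smooth_map (times_model (open_submanifold M U)) (open_submanifold (total E) (bundle_over E U)) g"
      "\<And>x. x \<in> bundle_over E U \<Longrightarrow> g (\<Phi> x) = x"
      by (rule local_trivializationE[OF Q(5)]) (rule that)
    have gc: "continuous_map (prod_topology (subtopology (mtop M) U) euclidean) (mtop (total E)) g"
      using g(1) unfolding smooth_map_def open_submanifold_def times_model_def
      by (simp add: continuous_map_in_subtopology)
    have "continuous_map (subtopology (mtop M) Q) (subtopology (mtop M) U) (\<lambda>q. q)"
      using Q(3) by (auto simp: continuous_map_in_subtopology intro: continuous_map_from_subtopology)
    then have "continuous_map (subtopology (mtop M) Q) (prod_topology (subtopology (mtop M) U) euclidean)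
        (\<lambda>q. (q, snd (\<Phi> (s q))))"
      using smooth_fun_imp_continuous_map[OF M Q(2,6)] by (rule continuous_map_pairedI)
    then have "continuous_map (subtopology (mtop M) Q) (mtop (total E)) (g \<circ> (\<lambda>q. (q, snd (\<Phi> (s q)))))"
      using gc by (rule continuous_map_compose)
    then have "continuous_map (subtopology (mtop M) Q) (mtop (total E)) s"
    proof (rule continuous_map_eq)
      fix q assume "q \<in> topspace (subtopology (mtop M) Q)"
      then have q: "q \<in> Q" "q \<in> W" "q \<in> U"
        using Q(3,4) by auto
      have "\<Phi> (s q) = (q, snd (\<Phi> (s q)))"
        using trivialization_fst[OF Q(5) q(3) fib[OF q(2)]] by (simp add: prod_eq_iff)
      moreover have "g (\<Phi> (s q)) = s q"
        using fib[OF q(2)] q(3) by (intro g(2)) (auto simp: bundle_over_def)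
      ultimately show "(g \<circ> (\<lambda>q. (q, snd (\<Phi> (s q))))) q = s q"
        by (metis comp_apply)
    qed
    then have "continuous_map (subtopology (subtopology (mtop M) W) Q) (mtop (total E)) s"
      using Q(4) by (simp add: subtopology_subtopology inf_absorb2)
    moreover have "openin (subtopology (mtop M) W) Q"
      using Q(2,4) by (simp add: subset_openin_subtopology)
    ultimately show "\<exists>Q. openin (subtopology (mtop M) W) Q \<and> p \<in> Q \<and>
        continuous_map (subtopology (subtopology (mtop M) W) Q) (mtop (total E)) s"
      using Q(1) by blast
  qed
  have smooth: "smooth_on (\<phi> ` ((C \<inter> W) \<inter> s -` V)) (\<psi> \<circ> s \<circ> inv_into (C \<inter> W) \<phi>)"
    if at: "(C, \<phi>) \<in> atlas M" and at': "(V, \<psi>) \<in> atlas (total E)" for C \<phi> V \<psi>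
  proof (rule smooth_on_local)
    note ch = atlas_is_chart[OF M at] and ch' = atlas_is_chart[OF TE at']
    fix x assume "x \<in> \<phi> ` ((C \<inter> W) \<inter> s -` V)"
    then obtain p where p: "p \<in> C" "p \<in> W" "s p \<in> V" "x = \<phi> p"
      by blast
    from rep[OF p(2)] obtain U \<Phi> Q where Q: "p \<in> Q" "openin (mtop M) Q" "Q \<subseteq> U" "Q \<subseteq> W"
      "local_trivialization M E U \<Phi>" "smooth_fun M Q (\<lambda>q. snd (\<Phi> (s q)))"
      by (elim exE conjE) (rule that)
    let ?B = "bundle_over E U"
    obtain g where g: "smooth_map (times_model (open_submanifold M U)) (open_submanifold (total E) ?B) g"
      "\<And>x. x \<in> ?B \<Longrightarrow> g (\<Phi> x) = x"
      by (rule local_trivializationE[OF Q(5)]) (rule that)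
    define R where "R = {q \<in> topspace (subtopology (mtop M) W). s q \<in> V} \<inter> (C \<inter> Q)"
    have R: "openin (mtop M) R"
      unfolding R_def using openin_trans_full[OF openin_continuous_map_preimage[OF cont is_chart_openin[OF ch']] W]
        is_chart_openin[OF ch] Q(2) by (intro openin_Int)
    have RD: "q \<in> C" "q \<in> W" "q \<in> U" "q \<in> Q" "s q \<in> V" "s q \<in> ?B" "g (q, snd (\<Phi> (s q))) = s q" if "q \<in> R" for q
    proof -
      show q: "q \<in> C" "q \<in> W" "q \<in> U" "q \<in> Q" "s q \<in> V"
        using that Q(3) by (auto simp: R_def)
      show b: "s q \<in> ?B"
        using fib[OF q(2)] q(3) by (auto simp: bundle_over_def)
      have "\<Phi> (s q) = (q, snd (\<Phi> (s q)))"
        using trivialization_fst[OF Q(5) q(3) fib[OF q(2)]] by (simp add: prod_eq_iff)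
      then show "g (q, snd (\<Phi> (s q))) = s q"
        using g(2)[OF b] by metis
    qed
    have pR: "p \<in> R"
      using p Q(1) WM by (auto simp: R_def)
    have oR: "open (\<phi> ` R)"
      using is_chart_open_image[OF ch R] RD(1) by blast
    let ?X = "(C \<inter> U) \<times> (UNIV :: 'v set)"
    \<comment> \<open>\<open>?f\<close> is the inverse trivialization in coordinates and
      \<open>?h\<close> the graph of the fibre coordinate; their composite is \<open>s\<close> in
      coordinates.\<close>
    let ?f = "\<psi> \<circ> g \<circ> inv_into ?X (map_prod \<phi> id)"
    let ?h = "\<lambda>x. (x, snd (\<Phi> (s (inv_into C \<phi> x))))"
    have f: "smooth_on (map_prod \<phi> id ` (?X \<inter> g -` (V \<inter> ?B))) ?f"
      using g(1) at at' unfolding smooth_map_def open_submanifold_def times_model_def by fastforce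
    have h: "smooth_on (\<phi> ` R) ?h"
    proof (intro smooth_on_Pair oR smooth_on_id)
      show "smooth_on (\<phi> ` R) (\<lambda>x. snd (\<Phi> (s (inv_into C \<phi> x))))"
        by (rule smooth_on_subset[OF smooth_funD[OF Q(6) at]]) (use RD in blast)
    qed
    have h_eq: "?h (\<phi> q) = map_prod \<phi> id (q, snd (\<Phi> (s q)))" if "q \<in> R" for q
      using is_chart_inv[OF ch RD(1)[OF that]] by simp
    have "?h ` \<phi> ` R \<subseteq> map_prod \<phi> id ` (?X \<inter> g -` (V \<inter> ?B))"
    proof
      fix y assume "y \<in> ?h ` \<phi> ` R"
      then obtain q where q: "q \<in> R" and y: "y = ?h (\<phi> q)"
        by blast
      have "(q, snd (\<Phi> (s q))) \<in> ?X \<inter> g -` (V \<inter> ?B)"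
        using RD[OF q] by simp
      then show "y \<in> map_prod \<phi> id ` (?X \<inter> g -` (V \<inter> ?B))"
        unfolding y h_eq[OF q] by (rule imageI)
    qed
    then have "smooth_on (\<phi> ` R) (\<lambda>x. ?f (?h x))"
      by (rule smooth_on_compose[OF oR f h])
    moreover have "?f (?h x) = (\<psi> \<circ> s \<circ> inv_into (C \<inter> W) \<phi>) x" if x: "x \<in> \<phi> ` R" for x
    proof -
      obtain q where q: "q \<in> R" "x = \<phi> q"
        using x by blast
      have inj: "inj_on (map_prod \<phi> (id :: 'v \<Rightarrow> 'v)) ?X"
        using is_chart_inj_on[OF ch] by (auto simp: inj_on_def)
      have "inv_into ?X (map_prod \<phi> id) (map_prod \<phi> id (q, snd (\<Phi> (s q)))) = (q, snd (\<Phi> (s q)))"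
        using RD[OF q(1)] by (intro inv_into_f_f inj) auto
      then have "?f (?h x) = \<psi> (s q)"
        unfolding q(2) h_eq[OF q(1)] using RD(7)[OF q(1)] by simp
      moreover have "inv_into (C \<inter> W) \<phi> (\<phi> q) = q"
        using RD[OF q(1)] by (intro is_chart_inv_Int[OF ch]) blast
      ultimately show ?thesis
        by (simp add: q(2))
    qed
    ultimately have "smooth_on (\<phi> ` R) (\<psi> \<circ> s \<circ> inv_into (C \<inter> W) \<phi>)"
      by (rule smooth_on_cong[OF oR, rotated])
    then show "\<exists>T. open T \<and> x \<in> T \<and> smooth_on T (\<psi> \<circ> s \<circ> inv_into (C \<inter> W) \<phi>)"
      using oR pR p(4) by blast
  qed
  have "proj E (s p) = p" if "p \<in> W" for p
    using fib[OF that] by (simp add: bundle_over_def)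
  then show ?thesis
    unfolding smooth_section_def smooth_map_def open_submanifold_def
    using W cont smooth by auto
qed

section \<open>Generating a generalized subbundle\<close>

lemma smooth_section_zero:
  assumes E: "smooth_vector_bundle M E"
  shows "smooth_section M E (points M) (vzero E)"
proof (rule smooth_section_if_local_rep[OF E openin_topspace])
  fix p assume p: "p \<in> points M"
  show "vzero E p \<in> fibre E p"
    by (rule fibre_closed(1)[OF E p])
  obtain U \<Phi> where t: "p \<in> U" "local_trivialization M E U \<Phi>"
    by (rule bundle_trivialization[OF E p])
  note U = local_trivialization_openin[OF t(2)]
  have "smooth_fun M U (\<lambda>q. snd (\<Phi> (vzero E q)))"
    by (rule smooth_fun_cong[OF bundle_manifolds(1)[OF E] U _ smooth_fun_const[of M U 0]])
      (simp add: trivialization_vzero[OF E t(2)])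
  then show "\<exists>U \<Phi> Q. p \<in> Q \<and> openin (mtop M) Q \<and> Q \<subseteq> U \<and> Q \<subseteq> points M \<and>
      local_trivialization M E U \<Phi> \<and> smooth_fun M Q (\<lambda>q. snd (\<Phi> (vzero E q)))"
    using t U openin_subset[OF U] by blast
qed

lemma is_chart_compactin:
  assumes ch: "is_chart X U \<phi>" and T: "compact T" "T \<subseteq> \<phi> ` U"
  shows "compactin X {q \<in> U. \<phi> q \<in> T}"
proof -
  obtain g where g: "homeomorphic_maps (subtopology X U) (top_of_set (\<phi> ` U)) \<phi> g"
    using ch by (auto simp: is_chart_def homeomorphic_map_maps)
  have gc: "continuous_map (top_of_set (\<phi> ` U)) (subtopology X U) g"
    and inv: "\<And>q. q \<in> U \<Longrightarrow> g (\<phi> q) = q"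
    using g is_chart_topspace[OF ch] by (auto simp: homeomorphic_maps_def)
  have "compactin (top_of_set (\<phi> ` U)) T"
    using T by (simp add: compactin_subtopology)
  then have "compactin (subtopology X U) (g ` T)"
    using gc by (rule image_compactin)
  then have "compactin X (g ` T)"
    by (simp add: compactin_subtopology)
  moreover have "g ` T = {q \<in> U. \<phi> q \<in> T}"
  proof
    show "g ` T \<subseteq> {q \<in> U. \<phi> q \<in> T}"
    proof
      fix y assume "y \<in> g ` T"
      then obtain x where x: "x \<in> T" "y = g x"
        by blast
      then obtain q where q: "q \<in> U" "x = \<phi> q"
        using T(2) by blast
      then show "y \<in> {q \<in> U. \<phi> q \<in> T}"
        using x inv[OF q(1)] by simp
    qed
    show "{q \<in> U. \<phi> q \<in> T} \<subseteq> g ` T"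
    proof
      fix q assume "q \<in> {q \<in> U. \<phi> q \<in> T}"
      then have "q \<in> U" "\<phi> q \<in> T"
        by auto
      then show "q \<in> g ` T"
        using inv by (metis imageI)
    qed
  qed
  ultimately show ?thesis
    by simp
qed

text \<open>Multiply by a bump function and extend by zero; \<open>G\<close> contains the zero
  vectors and is closed under scaling. The bump is not normalized at \<open>p\<close>, hence the
  factor \<open>c\<close>.\<close>

lemma global_section_from_local:
  fixes M :: "('m, 'e::finite_dim_inner) mfd" and E :: "('m, 't, 'e, 'v::finite_dim_inner) vbundle"
  assumes E: "smooth_vector_bundle M E" and G: "generalized_subbundle M E G"
    and s: "smooth_section M E W s" "\<And>q. q \<in> W \<Longrightarrow> s q \<in> G q" and p: "p \<in> W"
  obtains \<sigma> c where "smooth_section M E (points M) \<sigma>" "\<And>q. q \<in> points M \<Longrightarrow> \<sigma> q \<in> G q"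
    "c \<noteq> 0" "\<sigma> p = vscale E c (s p)"
proof -
  note M = bundle_manifolds(1)[OF E]
  have W: "openin (mtop M) W"
    using s(1) by (simp add: smooth_section_def)
  have WM: "W \<subseteq> points M"
    using W by (rule openin_subset)
  obtain C \<phi> where at: "(C, \<phi>) \<in> atlas M" "p \<in> C"
    using atlas_covers[OF M] p WM by blast
  note ch = atlas_is_chart[OF M at(1)]
  have "open (\<phi> ` (C \<inter> W))" "\<phi> p \<in> \<phi> ` (C \<inter> W)"
    using open_chart_image[OF M at(1) W] at(2) p by auto
  then obtain r where r: "r > 0" "cball (\<phi> p) r \<subseteq> \<phi> ` (C \<inter> W)"
    using open_contains_cball by blast
  let ?\<beta> = "\<lambda>q. bump (\<phi> p) r (\<phi> q)"
  define \<sigma> where "\<sigma> q = (if q \<in> C \<inter> W then vscale E (?\<beta> q) (s q) else vzero E q)" for q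
  have sG: "fibre_subspace E q (G q)" if "q \<in> points M" for q
    using G that by (simp add: generalized_subbundle_def)
  have \<sigma>G: "\<sigma> q \<in> G q" if "q \<in> points M" for q
    using sG[OF that] s(2) by (auto simp: \<sigma>_def fibre_subspace_def)
  \<comment> \<open>Compact, hence closed as \<open>M\<close> is Hausdorff. So its complement is
    open; there \<sigma> is the zero section, and together with \<open>C \<inter> W\<close> it
    covers \<open>M\<close>.\<close>
  define K where "K = {q \<in> C. \<phi> q \<in> cball (\<phi> p) r}"
  have "compactin (mtop M) K"
    unfolding K_def using r(2) by (intro is_chart_compactin[OF ch]) auto
  then have "closedin (mtop M) K"
    using M by (intro compactin_imp_closedin) (auto simp: smooth_manifold_def)
  then have cK: "openin (mtop M) (points M - K)"
    by (simp add: openin_diff)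
  have CW: "openin (mtop M) (C \<inter> W)"
    using is_chart_openin[OF ch] W by (rule openin_Int)
  have "smooth_section M E (points M) \<sigma>"
  proof (rule smooth_section_if_local_rep[OF E openin_topspace])
    fix q assume q: "q \<in> points M"
    show "\<sigma> q \<in> fibre E q"
      using \<sigma>G[OF q] sG[OF q] by (auto simp: fibre_subspace_def)
    obtain U \<Phi> where t: "q \<in> U" "local_trivialization M E U \<Phi>"
      by (rule bundle_trivialization[OF E q])
    note U = local_trivialization_openin[OF t(2)]
    show "\<exists>U \<Phi> Q. q \<in> Q \<and> openin (mtop M) Q \<and> Q \<subseteq> U \<and> Q \<subseteq> points M \<and>
        local_trivialization M E U \<Phi> \<and> smooth_fun M Q (\<lambda>q. snd (\<Phi> (\<sigma> q)))"
    proof (cases "q \<in> C \<inter> W")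
      case True
      let ?Q = "C \<inter> W \<inter> U"
      have Q: "openin (mtop M) ?Q"
        using CW U by (rule openin_Int)
      have "smooth_fun M ?Q ?\<beta>"
        by (rule smooth_fun_chart[OF M at(1) smooth_on_bump[of UNIV] _ _ Q]) auto
      moreover have "smooth_fun M ?Q (\<lambda>q. snd (\<Phi> (s q)))"
        by (rule smooth_fun_subset[OF smooth_section_local_rep[OF E s(1) t(2)]]) blast
      ultimately have "smooth_fun M ?Q (\<lambda>q. ?\<beta> q *\<^sub>R snd (\<Phi> (s q)))"
        by (rule smooth_fun_scaleR[OF M Q])
      then have "smooth_fun M ?Q (\<lambda>q. snd (\<Phi> (\<sigma> q)))"
        by (rule smooth_fun_cong[OF M Q, rotated])
          (auto simp: \<sigma>_def intro!: trivialization_vscale[OF t(2), symmetric] smooth_section_fibre[OF s(1)])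
      moreover have "q \<in> ?Q" "?Q \<subseteq> U" "?Q \<subseteq> points M"
        using True t(1) WM by auto
      ultimately show ?thesis
        using Q t(2) by (intro exI[of _ U] exI[of _ \<Phi>] exI[of _ ?Q] conjI)
    next
      case False
      let ?Q = "(points M - K) \<inter> U"
      have Q: "openin (mtop M) ?Q"
        using cK U by (rule openin_Int)
      have zero: "\<sigma> x = vzero E x" if "x \<in> ?Q" for x
      proof (cases "x \<in> C \<inter> W")
        case True
        then have "\<phi> x \<notin> cball (\<phi> p) r"
          using that by (auto simp: K_def)
        then have "?\<beta> x = 0"
          using bump_nonzero_iff[OF r(1), of "\<phi> p" "\<phi> x"] by auto
        then show ?thesis
          using True that vscale_0[OF E _ smooth_section_fibre[OF s(1)], of x] WM by (simp add: \<sigma>_def subset_iff)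
      qed (auto simp: \<sigma>_def)
      have "smooth_fun M ?Q (\<lambda>q. snd (\<Phi> (\<sigma> q)))"
        by (rule smooth_fun_cong[OF M Q _ smooth_fun_const[of M ?Q 0]])
          (simp add: zero trivialization_vzero[OF E t(2)])
      moreover have "q \<in> ?Q"
      proof -
        have "q \<notin> K"
        proof
          assume "q \<in> K"
          then have q': "q \<in> C" "\<phi> q \<in> \<phi> ` (C \<inter> W)"
            using r(2) by (auto simp: K_def)
          then obtain y where "y \<in> C \<inter> W" "\<phi> q = \<phi> y"
            by blast
          then have "q = y"
            using inj_onD[OF is_chart_inj_on[OF ch]] q'(1) by blast
          then show False
            using False \<open>y \<in> C \<inter> W\<close> by blast
        qed
        then show ?thesis
          using q t(1) by blast
      qed
      moreover have "?Q \<subseteq> U" "?Q \<subseteq> points M"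
        by auto
      ultimately show ?thesis
        using Q t(2) by (intro exI[of _ U] exI[of _ \<Phi>] exI[of _ ?Q] conjI)
    qed
  qed
  moreover have "\<sigma> p = vscale E (?\<beta> p) (s p)"
    using at(2) p by (simp add: \<sigma>_def)
  moreover have "?\<beta> p \<noteq> 0"
    using bump_nonzero_iff[OF r(1), of "\<phi> p" "\<phi> p"] r(1) by simp
  ultimately show ?thesis
    using that[of \<sigma> "?\<beta> p"] \<sigma>G by blast
qed

section \<open>Linear algebra in a trivialized fibre and detection of vectors\<close>

lemma fibre_span_least: "fibre_subspace E p T \<Longrightarrow> S \<subseteq> T \<Longrightarrow> fibre_span E p S \<subseteq> T"
  unfolding fibre_span_def by (rule hull_minimal)

lemma subspace_trivialization_image:
  assumes triv: "local_trivialization M E U \<Phi>" and p: "p \<in> U"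
    and E: "smooth_vector_bundle M E" and T: "fibre_subspace E p T"
  shows "subspace ((\<lambda>x. snd (\<Phi> x)) ` T)"
proof -
  have sub: "T \<subseteq> fibre E p" and cl: "vzero E p \<in> T" "\<And>x y. x \<in> T \<Longrightarrow> y \<in> T \<Longrightarrow> vadd E x y \<in> T"
    "\<And>c x. x \<in> T \<Longrightarrow> vscale E c x \<in> T"
    using T by (auto simp: fibre_subspace_def)
  have "0 \<in> (\<lambda>x. snd (\<Phi> x)) ` T"
    using trivialization_vzero[OF E triv p] cl(1) by (metis imageI)
  moreover have "snd (\<Phi> x) + snd (\<Phi> y) \<in> (\<lambda>x. snd (\<Phi> x)) ` T" if "x \<in> T" "y \<in> T" for x y
    using trivialization_vadd[OF triv p, of x y] cl(2)[OF that] that sub by (metis imageI subsetD)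
  moreover have "c *\<^sub>R snd (\<Phi> x) \<in> (\<lambda>x. snd (\<Phi> x)) ` T" if "x \<in> T" for c x
    using trivialization_vscale[OF triv p, of x c] cl(3)[OF that] that sub by (metis imageI subsetD)
  ultimately show ?thesis
    unfolding subspace_def by blast
qed

lemma trivialization_image_mem:
  assumes "local_trivialization M E U \<Phi>" "p \<in> U" "T \<subseteq> fibre E p" "x \<in> fibre E p"
    "snd (\<Phi> x) \<in> (\<lambda>x. snd (\<Phi> x)) ` T"
  shows "x \<in> T"
proof -
  obtain y where y: "y \<in> T" "snd (\<Phi> x) = snd (\<Phi> y)"
    using assms(5) by blast
  have "x = y"
    by (rule trivialization_inj[OF assms(1,2,4) _ y(2)]) (use y(1) assms(3) in blast)
  then show ?thesis
    using y(1) by simp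
qed

text \<open>
  Instead of spanning \<open>G q\<close>, which is not an open condition on \<open>q\<close>, we detect the nonzero vectors
  of \<open>G q\<close> by inner products; this condition is open in the pair of \<open>q\<close> and the vector, so Lindelof applies.
\<close>

lemma countable_detecting_sections:
  fixes M :: "('m, 'e::finite_dim_inner) mfd" and E :: "('m, 't, 'e, 'v::finite_dim_inner) vbundle"
  assumes E: "smooth_vector_bundle M E" and G: "smooth_generalized_subbundle M E G"
    and at: "(C, \<phi>) \<in> atlas M" and triv: "local_trivialization M E U \<Phi>"
  shows "\<exists>S. countable S \<and>
    (\<forall>\<sigma>\<in>S. smooth_section M E (points M) \<sigma> \<and> (\<forall>q\<in>points M. \<sigma> q \<in> G q)) \<and>
    (\<forall>q\<in>C \<inter> U. \<forall>y\<in>G q. snd (\<Phi> y) \<noteq> 0 \<longrightarrow> (\<exists>\<sigma>\<in>S. snd (\<Phi> y) \<bullet> snd (\<Phi> (\<sigma> q)) \<noteq> 0))"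
proof -
  note M = bundle_manifolds(1)[OF E]
  note ch = atlas_is_chart[OF M at] and U = local_trivialization_openin[OF triv]
  have UM: "U \<subseteq> points M"
    using U by (rule openin_subset)
  have GB: "generalized_subbundle M E G"
    using G by (simp add: smooth_generalized_subbundle_def)
  define Sec where "Sec = {\<sigma>. smooth_section M E (points M) \<sigma> \<and> (\<forall>q\<in>points M. \<sigma> q \<in> G q)}"
  let ?\<Omega> = "\<phi> ` (C \<inter> U)"
  have \<Omega>: "open ?\<Omega>"
    by (rule open_chart_image[OF M at U])
  define u where "u \<sigma> x = snd (\<Phi> (\<sigma> (inv_into C \<phi> x)))" for \<sigma> x
  \<comment> \<open>The coordinate pairs \<open>(x, w)\<close> that \<sigma> detects.\<close>
  define T where "T \<sigma> = (?\<Omega> \<times> UNIV) \<inter> (\<lambda>z. snd z \<bullet> u \<sigma> (fst z)) -` (- {0})" for \<sigma>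
  have "open (T \<sigma>)" if "\<sigma> \<in> Sec" for \<sigma>
  proof -
    have "smooth_fun M (points M \<inter> U) (\<lambda>q. snd (\<Phi> (\<sigma> q)))"
      using that by (intro smooth_section_local_rep[OF E _ triv]) (simp add: Sec_def)
    then have "smooth_on (\<phi> ` (C \<inter> (points M \<inter> U))) (u \<sigma>)"
      unfolding u_def[abs_def] using at by (rule smooth_funD)
    then have "continuous_on ?\<Omega> (u \<sigma>)"
      using UM by (simp add: smooth_on_imp_continuous_on inf_absorb2)
    then have "continuous_on (?\<Omega> \<times> (UNIV :: 'v set)) (\<lambda>z. snd z \<bullet> u \<sigma> (fst z))"
      by (intro continuous_intros) (auto elim: continuous_on_compose2 intro!: continuous_intros)
    then show ?thesis
      unfolding T_def using \<Omega> by (intro continuous_open_preimage open_Times) auto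
  qed
  then have "\<And>A. A \<in> T ` Sec \<Longrightarrow> open A"
    by blast
  then obtain F where F: "F \<subseteq> T ` Sec" "countable F" "\<Union>F = \<Union>(T ` Sec)"
    by (rule Lindelof)
  then obtain S where S: "countable S" "S \<subseteq> Sec" "F = T ` S"
    using countable_subset_image by metis
  have "\<exists>\<sigma>\<in>S. snd (\<Phi> y) \<bullet> snd (\<Phi> (\<sigma> q)) \<noteq> 0"
    if q: "q \<in> C \<inter> U" and y: "y \<in> G q" and w: "snd (\<Phi> y) \<noteq> 0" for q y
  proof -
    let ?w = "snd (\<Phi> y)"
    have qU: "q \<in> U" and qM: "q \<in> points M"
      using q UM by auto
    have Tmem: "(\<phi> q, ?w) \<in> T \<sigma> \<longleftrightarrow> ?w \<bullet> snd (\<Phi> (\<sigma> q)) \<noteq> 0" for \<sigma>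
      using q is_chart_inv[OF ch, of q] by (auto simp: T_def u_def)
    have "\<exists>(k::nat) V s. (\<forall>i<k. q \<in> V i \<and> smooth_section M E (V i) (s i) \<and> (\<forall>x\<in>V i. s i x \<in> G x)) \<and>
        G q = fibre_span E q ((\<lambda>i. s i q) ` {..<k})"
      using G qM by (simp add: smooth_generalized_subbundle_def)
    then obtain k :: nat and V s where
      s: "\<forall>i<k. q \<in> V i \<and> smooth_section M E (V i) (s i) \<and> (\<forall>x\<in>V i. s i x \<in> G x)"
      and span: "G q = fibre_span E q ((\<lambda>i. s i q) ` {..<k})"
      by (elim exE conjE) (rule that)
    have "\<exists>i<k. ?w \<bullet> snd (\<Phi> (s i q)) \<noteq> 0"
    proof (rule ccontr)
      assume none: "\<not> ?thesis"
      \<comment> \<open>The hyperplane orthogonal to \<open>?w\<close>. If it contained all values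
        \<open>s i q\<close>, it would contain their span \<open>G q\<close> and so \<open>y\<close>
        itself, making \<open>?w\<close> orthogonal to itself.\<close>
      let ?H = "{x \<in> fibre E q. ?w \<bullet> snd (\<Phi> x) = 0}"
      have "fibre_subspace E q ?H"
        unfolding fibre_subspace_def
        by (auto simp: fibre_closed[OF E qM] trivialization_vzero[OF E triv qU]
            trivialization_vadd[OF triv qU] trivialization_vscale[OF triv qU] inner_add_right)
      moreover have "(\<lambda>i. s i q) ` {..<k} \<subseteq> ?H"
      proof
        fix x assume "x \<in> (\<lambda>i. s i q) ` {..<k}"
        then obtain i where i: "i < k" "x = s i q"
          by auto
        have "s i q \<in> fibre E q"
          using s i(1) by (intro smooth_section_fibre[of M E "V i"]) blast+
        then show "x \<in> ?H"
          using none i by auto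
      qed
      ultimately have "G q \<subseteq> ?H"
        unfolding span by (rule fibre_span_least)
      then have "?w \<bullet> ?w = 0"
        using y by blast
      then show False
        using w by simp
    qed
    then obtain i where i: "i < k" "?w \<bullet> snd (\<Phi> (s i q)) \<noteq> 0"
      by blast
    have si: "smooth_section M E (V i) (s i)" "\<And>x. x \<in> V i \<Longrightarrow> s i x \<in> G x" "q \<in> V i"
      using s i(1) by blast+
    \<comment> \<open>Globalizing multiplies the inner product by \<open>c\<close>, so it remains
      nonzero.\<close>
    obtain \<sigma> c where \<sigma>: "smooth_section M E (points M) \<sigma>" "\<And>q. q \<in> points M \<Longrightarrow> \<sigma> q \<in> G q"
      and c: "c \<noteq> 0" "\<sigma> q = vscale E c (s i q)"
      by (rule global_section_from_local[OF E GB si]) (assumption, rule that)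
    have "snd (\<Phi> (\<sigma> q)) = c *\<^sub>R snd (\<Phi> (s i q))"
      unfolding c(2) by (rule trivialization_vscale[OF triv qU smooth_section_fibre[OF si(1,3)]])
    then have "(\<phi> q, ?w) \<in> T \<sigma>"
      unfolding Tmem using c(1) i(2) by simp
    moreover have "\<sigma> \<in> Sec"
      using \<sigma> by (simp add: Sec_def)
    ultimately have "(\<phi> q, ?w) \<in> \<Union>F"
      unfolding F(3) by blast
    then show ?thesis
      unfolding S(3) using Tmem by blast
  qed
  moreover have "\<forall>\<sigma>\<in>S. smooth_section M E (points M) \<sigma> \<and> (\<forall>q\<in>points M. \<sigma> q \<in> G q)"
    using S(2) by (auto simp: Sec_def)
  ultimately show ?thesis
    using S(1) by blast
qed

text \<open>The closed ball must fit into the coordinate domain: bounds are taken on it, whereas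
  covering and smoothness of sums use the open ball.\<close>

definition trivialized_ball ::
  "('m, 'e::finite_dim_inner) mfd \<Rightarrow> ('m, 't, 'e, 'v::finite_dim_inner) vbundle \<Rightarrow>
   'm set \<Rightarrow> ('m \<Rightarrow> 'e) \<Rightarrow> 'm set \<Rightarrow> ('t \<Rightarrow> 'm \<times> 'v) \<Rightarrow> 'e \<Rightarrow> real \<Rightarrow> bool" where
  "trivialized_ball M E C \<phi> U \<Phi> z r \<longleftrightarrow>
     (C, \<phi>) \<in> atlas M \<and> local_trivialization M E U \<Phi> \<and> cball z r \<subseteq> \<phi> ` (C \<inter> U)"

lemma countable_trivialized_balls:
  fixes M :: "('m, 'e::finite_dim_inner) mfd" and E :: "('m, 't, 'e, 'v::finite_dim_inner) vbundle"
  assumes E: "smooth_vector_bundle M E" and ne: "points M \<noteq> {}"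
  obtains C :: "nat \<Rightarrow> 'm set" and \<phi> U and \<Phi> :: "nat \<Rightarrow> 't \<Rightarrow> 'm \<times> 'v" and z r where
    "\<And>a. trivialized_ball M E (C a) (\<phi> a) (U a) (\<Phi> a) (z a) (r a)"
    "\<And>q. q \<in> points M \<Longrightarrow> \<exists>a. q \<in> C a \<inter> U a \<and> \<phi> a q \<in> ball (z a) (r a)"
proof -
  note M = bundle_manifolds(1)[OF E]
  have "\<exists>C \<phi> U (\<Phi> :: 't \<Rightarrow> 'm \<times> 'v) z r. trivialized_ball M E C \<phi> U \<Phi> z r \<and> p \<in> C \<inter> U \<and> \<phi> p \<in> ball z r"
    if p: "p \<in> points M" for p
  proof -
    obtain C \<phi> where at: "(C, \<phi>) \<in> atlas M" "p \<in> C"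
      using atlas_covers[OF M p] by blast
    obtain U and \<Phi> :: "'t \<Rightarrow> 'm \<times> 'v" where t: "p \<in> U" "local_trivialization M E U \<Phi>"
      by (rule bundle_trivialization[OF E p])
    have "open (\<phi> ` (C \<inter> U))" "\<phi> p \<in> \<phi> ` (C \<inter> U)"
      using open_chart_image[OF M at(1) local_trivialization_openin[OF t(2)]] at(2) t(1) by auto
    then obtain r where r: "r > 0" "cball (\<phi> p) r \<subseteq> \<phi> ` (C \<inter> U)"
      using open_contains_cball by blast
    then show ?thesis
      unfolding trivialized_ball_def
      using at t by (intro exI[of _ C] exI[of _ \<phi>] exI[of _ U] exI[of _ \<Phi>] exI[of _ "\<phi> p"] exI[of _ r]) simp
  qed
  then obtain C \<phi> U and \<Phi> :: "'m \<Rightarrow> 't \<Rightarrow> 'm \<times> 'v" and z r where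
    tb: "\<And>p. p \<in> points M \<Longrightarrow> trivialized_ball M E (C p) (\<phi> p) (U p) (\<Phi> p) (z p) (r p) \<and>
      p \<in> C p \<inter> U p \<and> \<phi> p p \<in> ball (z p) (r p)"
    by metis
  define B where "B p = {q \<in> C p. \<phi> p q \<in> ball (z p) (r p)} \<inter> U p" for p
  have B: "openin (mtop M) (B p)" "p \<in> B p" if "p \<in> points M" for p
  proof -
    have "is_chart (mtop M) (C p) (\<phi> p)" "openin (mtop M) (U p)"
      using tb[OF that] atlas_is_chart[OF M] local_trivialization_openin by (auto simp: trivialized_ball_def)
    then show "openin (mtop M) (B p)"
      unfolding B_def by (intro openin_Int is_chart_openin_preimage) auto
    show "p \<in> B p"
      using tb[OF that] by (auto simp: B_def)
  qed
  have "Lindelof_space (mtop M)"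
    using M by (intro second_countable_imp_Lindelof_space) (simp add: smooth_manifold_def)
  moreover have "openin (mtop M) V" if "V \<in> B ` points M" for V
    using that B(1) by auto
  moreover have "\<Union>(B ` points M) = points M"
    using B(2) openin_subset[OF B(1)] by auto
  ultimately have "\<exists>F. countable F \<and> F \<subseteq> B ` points M \<and> \<Union>F = points M"
    by (rule Lindelof_spaceD)
  then obtain F where F: "countable F" "F \<subseteq> B ` points M" "\<Union>F = points M"
    by (elim exE conjE) (rule that)
  then obtain P where P: "countable P" "P \<subseteq> points M" "F = B ` P"
    using countable_subset_image by metis
  have "P \<noteq> {}"
  proof
    assume "P = {}"
    with F(3) P(3) have "points M = {}"
      by (metis image_empty Union_empty)
    with ne show False
      by (rule notE)
  qed
  \<comment> \<open>Repetitions fill up the sequence when \<open>P\<close> is finite, so that charts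
    are indexed by all natural numbers.\<close>
  define e where "e = from_nat_into P"
  have e: "range e = P"
    unfolding e_def using \<open>P \<noteq> {}\<close> P(1) by (rule range_from_nat_into)
  have eM: "e a \<in> points M" for a
    using e P(2) by blast
  have "\<exists>a. q \<in> C (e a) \<inter> U (e a) \<and> \<phi> (e a) q \<in> ball (z (e a)) (r (e a))" if "q \<in> points M" for q
  proof -
    have "q \<in> \<Union>(B ` range e)"
      using that F(3) P(3) e by simp
    then show ?thesis
      by (auto simp: B_def)
  qed
  then show ?thesis
    by (rule that[OF conjunct1[OF tb[OF eM]]])
qed

text \<open>Over a single point, changing the trivialization is a linear map of \<open>'v\<close>,
  continuous by finite dimension, and so commutes with the series. Infinite sums are formed in
  coordinates only; this shows that the vector they define does not depend on the
  coordinates.\<close>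

lemma trivialization_change_suminf:
  fixes f :: "nat \<Rightarrow> 't" and M :: "('m, 'e::finite_dim_inner) mfd"
    and E :: "('m, 't, 'e, 'v::finite_dim_inner) vbundle"
  assumes E: "smooth_vector_bundle M E"
    and \<Phi>: "local_trivialization M E U \<Phi>" "p \<in> U" and \<Psi>: "local_trivialization M E V \<Psi>" "p \<in> V"
    and f: "\<And>n. f n \<in> fibre E p" and sm: "summable (\<lambda>n. t n *\<^sub>R snd (\<Phi> (f n)))"
    and x: "x \<in> fibre E p" "snd (\<Phi> x) = (\<Sum>n. t n *\<^sub>R snd (\<Phi> (f n)))"
  shows "snd (\<Psi> x) = (\<Sum>n. t n *\<^sub>R snd (\<Psi> (f n)))"
proof -
  have pM: "p \<in> points M"
    using openin_subset[OF local_trivialization_openin[OF \<Phi>(1)]] \<Phi>(2) by blast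
  define inv where "inv = inv_into (fibre E p) (\<lambda>x. snd (\<Phi> x))"
  note bij = trivialization_bij_betw[OF \<Phi>]
  have inv_mem: "inv v \<in> fibre E p" and inv_right: "snd (\<Phi> (inv v)) = v" for v
    unfolding inv_def using bij_betw_imp_surj_on[OF bij] by (auto intro: inv_into_into f_inv_into_f)
  have inv_left: "inv (snd (\<Phi> y)) = y" if "y \<in> fibre E p" for y
    unfolding inv_def using bij_betw_inv_into_left[OF bij that] .
  define L where "L v = snd (\<Psi> (inv v))" for v
  have "linear L"
  proof (rule linearI)
    fix v w :: 'v and c :: real
    have "inv (v + w) = vadd E (inv v) (inv w)"
      by (rule trivialization_inj[OF \<Phi>])
        (simp_all add: inv_mem inv_right fibre_closed[OF E pM] trivialization_vadd[OF \<Phi>])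
    then show "L (v + w) = L v + L w"
      by (simp add: L_def trivialization_vadd[OF \<Psi>] inv_mem)
    have "inv (c *\<^sub>R v) = vscale E c (inv v)"
      by (rule trivialization_inj[OF \<Phi>])
        (simp_all add: inv_mem inv_right fibre_closed[OF E pM] trivialization_vscale[OF \<Phi>])
    then show "L (c *\<^sub>R v) = c *\<^sub>R L v"
      by (simp add: L_def trivialization_vscale[OF \<Psi>] inv_mem)
  qed
  then have bl: "bounded_linear L"
    by (rule linear_imp_bounded_linear_finite_dim)
  have Leq: "L (snd (\<Phi> y)) = snd (\<Psi> y)" if "y \<in> fibre E p" for y
    by (simp add: L_def inv_left[OF that])
  have "snd (\<Psi> x) = L (\<Sum>n. t n *\<^sub>R snd (\<Phi> (f n)))"
    using Leq[OF x(1)] by (simp only: x(2))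
  also have "\<dots> = (\<Sum>n. L (t n *\<^sub>R snd (\<Phi> (f n))))"
    by (rule bounded_linear.suminf[OF bl sm])
  also have "\<dots> = (\<Sum>n. t n *\<^sub>R snd (\<Psi> (f n)))"
    by (simp add: linear_cmul[OF \<open>linear L\<close>] Leq[OF f])
  finally show ?thesis .
qed

section \<open>Assembling the global generators\<close>

theorem theorem4p1:
  fixes M :: "('m, 'e::finite_dim_inner) mfd"
    and E :: "('m, 't, 'e, 'v::finite_dim_inner) vbundle"
    and G :: "'m \<Rightarrow> 't set"
  assumes "smooth_manifold M"
    and "connected_space (mtop M)"
    and "smooth_vector_bundle M E"
    and "smooth_generalized_subbundle M E G"
  shows "globally_finitely_generated M E G"
proof (cases "points M = {}")
  case True
  then show ?thesis
    unfolding globally_finitely_generated_def by (intro exI[of _ 0]) simp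
next
  case False
  note M = assms(1) and E = assms(3) and G = assms(4)
  have sG: "fibre_subspace E q (G q)" if "q \<in> points M" for q
    using G that by (simp add: smooth_generalized_subbundle_def generalized_subbundle_def)
  obtain C :: "nat \<Rightarrow> 'm set" and \<phi> U and \<Phi> :: "nat \<Rightarrow> 't \<Rightarrow> 'm \<times> 'v" and z r where
    tb: "\<And>a. trivialized_ball M E (C a) (\<phi> a) (U a) (\<Phi> a) (z a) (r a)" and
    cover: "\<And>q. q \<in> points M \<Longrightarrow> \<exists>a. q \<in> C a \<inter> U a \<and> \<phi> a q \<in> ball (z a) (r a)"
    by (rule countable_trivialized_balls[OF E False]) (rule that)
  have at: "(C a, \<phi> a) \<in> atlas M" and triv: "local_trivialization M E (U a) (\<Phi> a)"
    and cb: "cball (z a) (r a) \<subseteq> \<phi> a ` (C a \<inter> U a)" for a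
    using tb[of a] by (auto simp: trivialized_ball_def)
  note ch = atlas_is_chart[OF M at]
  have UM: "U a \<subseteq> points M" for a
    using local_trivialization_openin[OF triv] by (rule openin_subset)
  have "\<forall>a. \<exists>S. countable S \<and>
      (\<forall>\<sigma>\<in>S. smooth_section M E (points M) \<sigma> \<and> (\<forall>q\<in>points M. \<sigma> q \<in> G q)) \<and>
      (\<forall>q\<in>C a \<inter> U a. \<forall>y\<in>G q. snd (\<Phi> a y) \<noteq> 0 \<longrightarrow> (\<exists>\<sigma>\<in>S. snd (\<Phi> a y) \<bullet> snd (\<Phi> a (\<sigma> q)) \<noteq> 0))"
    using countable_detecting_sections[OF E G at triv] by (intro allI)
  from choice[OF this] obtain S where S: "\<forall>a. countable (S a) \<and>
      (\<forall>\<sigma>\<in>S a. smooth_section M E (points M) \<sigma> \<and> (\<forall>q\<in>points M. \<sigma> q \<in> G q)) \<and>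
      (\<forall>q\<in>C a \<inter> U a. \<forall>y\<in>G q. snd (\<Phi> a y) \<noteq> 0 \<longrightarrow> (\<exists>\<sigma>\<in>S a. snd (\<Phi> a y) \<bullet> snd (\<Phi> a (\<sigma> q)) \<noteq> 0))"
    by (elim exE) (rule that)
  note S_countable = S[THEN spec, THEN conjunct1]
    and S_section = S[THEN spec, THEN conjunct2, THEN conjunct1, rule_format]
    and S_detect = S[THEN spec, THEN conjunct2, THEN conjunct2, rule_format]
  \<comment> \<open>The zero section makes the set nonempty, so that it can be enumerated by a
    sequence; it belongs to \<open>G\<close> anyway.\<close>
  let ?S = "insert (vzero E) (\<Union>a. S a)"
  define \<sigma> where "\<sigma> = from_nat_into ?S"
  have range: "range \<sigma> = ?S"
    unfolding \<sigma>_def using S_countable by (intro range_from_nat_into) auto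
  have \<sigma>: "smooth_section M E (points M) (\<sigma> i)" and \<sigma>G: "q \<in> points M \<Longrightarrow> \<sigma> i q \<in> G q" for i q
  proof -
    have "\<sigma> i \<in> ?S"
      using range by blast
    then have "smooth_section M E (points M) (\<sigma> i) \<and> (\<forall>q\<in>points M. \<sigma> i q \<in> G q)"
      using S_section smooth_section_zero[OF E] sG by (auto simp: fibre_subspace_def)
    then show "smooth_section M E (points M) (\<sigma> i)" "q \<in> points M \<Longrightarrow> \<sigma> i q \<in> G q"
      by auto
  qed
  have \<sigma>f: "\<sigma> i q \<in> fibre E q" if "q \<in> points M" for i q
    by (rule smooth_section_fibre[OF \<sigma> that])
  define u where "u i a x = snd (\<Phi> a (\<sigma> i (inv_into (C a) (\<phi> a) x)))" for i a x
  have u: "u i a (\<phi> a q) = snd (\<Phi> a (\<sigma> i q))" if "q \<in> C a" for i a q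
    by (simp add: u_def is_chart_inv[OF ch that])
  have u_smooth: "smooth_on (\<phi> a ` (C a \<inter> U a)) (u i a)" for i a
  proof -
    have "points M \<inter> U a = U a"
      using UM by blast
    then show ?thesis
      using smooth_funD[OF smooth_section_local_rep[OF E \<sigma>[of i] triv[of a]] at[of a]] by (simp add: u_def[abs_def])
  qed
  obtain idx :: "nat \<Rightarrow> nat" and t :: "nat \<Rightarrow> nat \<Rightarrow> real" and N :: nat where
    sm: "\<And>a j x. x \<in> cball (z a) (r a) \<Longrightarrow> summable (\<lambda>n. t n j *\<^sub>R u (idx n) a x)" and
    smooth: "\<And>a j. smooth_on (ball (z a) (r a)) (\<lambda>x. \<Sum>n. t n j *\<^sub>R u (idx n) a x)" and
    generic: "\<And>a x w i. x \<in> cball (z a) (r a) \<Longrightarrow> w \<bullet> u i a x \<noteq> 0 \<Longrightarrow>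
      \<exists>j<N. w \<bullet> (\<Sum>n. t n j *\<^sub>R u (idx n) a x) \<noteq> 0"
    by (rule generic_combination[OF cb u_smooth]) (rule that)
  define Q where "Q a = {q \<in> C a. \<phi> a q \<in> ball (z a) (r a)} \<inter> U a" for a
  have Q: "openin (mtop M) (Q a)" for a
    unfolding Q_def
    by (intro openin_Int is_chart_openin_preimage[OF ch] local_trivialization_openin[OF triv] open_ball)
  have QD: "q \<in> C a" "q \<in> U a" "q \<in> points M" "\<phi> a q \<in> cball (z a) (r a)" if "q \<in> Q a" for a q
    using that UM by (auto simp: Q_def)
  have "\<forall>q. \<exists>a. q \<in> points M \<longrightarrow> q \<in> Q a"
    using cover by (auto simp: Q_def)
  then obtain a where a: "\<And>q. q \<in> points M \<Longrightarrow> q \<in> Q (a q)"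
    by metis
  define X where "X j b q = (\<Sum>n. t n j *\<^sub>R snd (\<Phi> b (\<sigma> (idx n) q)))" for j b q
  have X_eq: "X j b q = (\<Sum>n. t n j *\<^sub>R u (idx n) b (\<phi> b q))" if "q \<in> Q b" for j b q
    by (simp add: X_def u[OF QD(1)[OF that]])
  have X_sm: "summable (\<lambda>n. t n j *\<^sub>R snd (\<Phi> b (\<sigma> (idx n) q)))" if "q \<in> Q b" for j b q
    using sm[OF QD(4)[OF that], of j] by (simp add: u[OF QD(1)[OF that]])
  \<comment> \<open>The chart \<open>a q\<close> is chosen pointwise without any regularity in
    \<open>q\<close>. \<open>s_rep\<close> then shows that the same series represents
    \<open>s j q\<close> in every ball containing \<open>q\<close>; with the ball fixed, smoothness
    becomes a local matter.\<close>
  define s where "s j q = inv_into (fibre E q) (\<lambda>x. snd (\<Phi> (a q) x)) (X j (a q) q)" for j q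
  have s_fib: "s j q \<in> fibre E q" and s_a: "snd (\<Phi> (a q) (s j q)) = X j (a q) q" if q: "q \<in> points M" for j q
  proof -
    have "X j (a q) q \<in> (\<lambda>x. snd (\<Phi> (a q) x)) ` fibre E q"
      using bij_betw_imp_surj_on[OF trivialization_bij_betw[OF triv QD(2)[OF a[OF q]]]] by simp
    then show "s j q \<in> fibre E q" "snd (\<Phi> (a q) (s j q)) = X j (a q) q"
      unfolding s_def by (rule inv_into_into, rule f_inv_into_f)
  qed
  have s_rep: "snd (\<Phi> b (s j q)) = X j b q" if q: "q \<in> Q b" for j b q
  proof -
    note qM = QD(3)[OF q]
    show ?thesis
      unfolding X_def
      by (rule trivialization_change_suminf[OF E triv QD(2)[OF a[OF qM]] triv QD(2)[OF q] \<sigma>f[OF qM]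
            X_sm[OF a[OF qM]] s_fib[OF qM] s_a[OF qM, unfolded X_def]])
  qed
  have s_smooth: "smooth_section M E (points M) (s j)" for j
  proof (rule smooth_section_if_local_rep[OF E openin_topspace s_fib])
    fix q assume "q \<in> points M"
    then have q: "q \<in> Q (a q)"
      by (rule a)
    let ?b = "a q"
    have "smooth_fun M (Q ?b) (\<lambda>q. \<Sum>n. t n j *\<^sub>R u (idx n) ?b (\<phi> ?b q))"
      by (rule smooth_fun_chart[OF M at smooth _ _ Q]) (auto simp: Q_def)
    then have "smooth_fun M (Q ?b) (\<lambda>q. snd (\<Phi> ?b (s j q)))"
      by (rule smooth_fun_cong[OF M Q, rotated]) (simp add: s_rep X_eq)
    moreover have "Q ?b \<subseteq> U ?b" "Q ?b \<subseteq> points M"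
      using QD by auto
    ultimately show "\<exists>U \<Phi> Q. q \<in> Q \<and> openin (mtop M) Q \<and> Q \<subseteq> U \<and> Q \<subseteq> points M \<and>
        local_trivialization M E U \<Phi> \<and> smooth_fun M Q (\<lambda>q. snd (\<Phi> (s j q)))"
      using q Q triv by (intro exI[of _ "U ?b"] exI[of _ "\<Phi> ?b"] exI[of _ "Q ?b"] conjI)
  qed
  have "G q = fibre_span E q ((\<lambda>j. s j q) ` {..<N})" if qM: "q \<in> points M" for q
  proof -
    let ?b = "a q"
    note q = a[OF qM]
    let ?\<rho> = "\<lambda>x. snd (\<Phi> ?b x)"
    note triv_q = triv[of ?b] QD(2)[OF q]
    have Gf: "G q \<subseteq> fibre E q"
      using sG[OF qM] by (simp add: fibre_subspace_def)
    have sub: "subspace (?\<rho> ` G q)"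
      by (rule subspace_trivialization_image[OF triv_q E sG[OF qM]])
    have sG_mem: "s j q \<in> G q" for j
    proof (rule trivialization_image_mem[OF triv_q Gf s_fib[OF qM]])
      show "?\<rho> (s j q) \<in> ?\<rho> ` G q"
        unfolding s_rep[OF q] X_def
        by (intro subspace_suminf_mem[OF sub X_sm[OF q]] subspace_scale[OF sub] imageI \<sigma>G[OF qM])
    qed
    \<comment> \<open>The span is the intersection of all such \<open>T\<close>. Each is cut down to
      \<open>T \<inter> G q\<close>, since the separation argument compares a subspace with a larger
      one containing it.\<close>
    have "G q \<subseteq> T" if T: "fibre_subspace E q T" "(\<lambda>j. s j q) ` {..<N} \<subseteq> T" for T
    proof -
      let ?T = "T \<inter> G q"
      have fT: "fibre_subspace E q ?T"
        using T(1) sG[OF qM] by (auto simp: fibre_subspace_def)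
      have "?\<rho> ` G q \<subseteq> ?\<rho> ` ?T"
      proof (rule subspace_subset_if_separating[OF sub subspace_trivialization_image[OF triv_q E fT]])
        show "?\<rho> ` ?T \<subseteq> ?\<rho> ` G q"
          by blast
        fix w assume "w \<in> ?\<rho> ` G q" "w \<noteq> 0"
        then obtain y where y: "y \<in> G q" "w = ?\<rho> y" "?\<rho> y \<noteq> 0"
          by blast
        have "q \<in> C ?b \<inter> U ?b"
          using QD[OF q] by blast
        from S_detect[OF this y(1,3)] obtain \<tau> where \<tau>: "\<tau> \<in> S ?b" "?\<rho> y \<bullet> ?\<rho> (\<tau> q) \<noteq> 0"
          by (elim bexE) (rule that)
        have "\<tau> \<in> range \<sigma>"
          unfolding range using \<tau>(1) by blast
        then obtain i where "\<tau> = \<sigma> i"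
          by blast
        then have "w \<bullet> u i ?b (\<phi> ?b q) \<noteq> 0"
          using \<tau>(2) y(2) u[OF QD(1)[OF q]] by simp
        from generic[OF QD(4)[OF q] this, folded X_eq[OF q], folded s_rep[OF q]]
        obtain j where j: "j < N" "w \<bullet> ?\<rho> (s j q) \<noteq> 0"
          by (elim exE conjE) (rule that)
        have "s j q \<in> ?T"
          using T(2) j(1) sG_mem by blast
        then show "\<exists>y\<in>?\<rho> ` ?T. w \<bullet> y \<noteq> 0"
          using j(2) by blast
      qed
      show "G q \<subseteq> T"
      proof
        fix x assume x: "x \<in> G q"
        have "?\<rho> x \<in> ?\<rho> ` ?T"
          using \<open>?\<rho> ` G q \<subseteq> ?\<rho> ` ?T\<close> x by blast
        then have "x \<in> ?T"
          using Gf x by (intro trivialization_image_mem[OF triv_q, of ?T x]) auto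
        then show "x \<in> T"
          by simp
      qed
    qed
    then have "G q \<subseteq> fibre_span E q ((\<lambda>j. s j q) ` {..<N})"
      unfolding fibre_span_def hull_def by blast
    moreover have "fibre_span E q ((\<lambda>j. s j q) ` {..<N}) \<subseteq> G q"
      using sG_mem by (intro fibre_span_least[OF sG[OF qM]]) blast
    ultimately show ?thesis
      by (rule subset_antisym)
  qed
  then show ?thesis
    unfolding globally_finitely_generated_def using s_smooth by blast
qed

end
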